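(* Every graph $G$ with maximum degree $\Delta\geq 3$ is $\lceil\frac13(\Delta+2)\rceil$-choosable with clustering $\lceil\frac{19}{2}\Delta\rceil-17$.
   Context: Graphs are finite and simple. In a coloured graph the monochromatic subgraph is the spanning subgraph of edges whose endpoints have the same colour; its connected components are monochromatic components. A colouring has clustering $c$ if every monochromatic component has at most $c$ vertices. A $k$-list-assignment $L$ assigns to each vertex $v$ a set $L(v)$ of at least $k$ colours; an $L$-colouring colours each $v$ with a colour from $L(v)$. $G$ is $k$-choosable with clustering $c$ if for every $k$-list-assignment $L$, $G$ has an $L$-colouring with clustering $c$. *)

theory Defs
  imports Complex_Main "Graph_Theory.Graph_Theory"
begin

text \<open>
  A finite simple graph is an instance of the locale \<open>graph\<close>: a finite loop-free symmetric digraph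
  without parallel arcs, each edge \<open>uv\<close> being represented by the two arcs \<open>(u, v)\<close> and \<open>(v, u)\<close>.
  Hence the degree of a vertex is its out-degree, and the connected components of a graph are its
  strongly connected components \<open>pre_digraph.sccs\<close>.
\<close>

text \<open>Inserting \<open>0\<close> only matters for the graph with no vertices.\<close>

definition max_degree :: "('a, 'b) pre_digraph \<Rightarrow> nat" where
  "max_degree G = Max (insert 0 (out_degree G ` verts G))"

definition mono_subgraph :: "('a, 'b) pre_digraph \<Rightarrow> ('a \<Rightarrow> 'c) \<Rightarrow> ('a, 'b) pre_digraph" where
  "mono_subgraph G f = G\<lparr>arcs := {e \<in> arcs G. f (tail G e) = f (head G e)}\<rparr>"

definition has_clustering :: "('a, 'b) pre_digraph \<Rightarrow> ('a \<Rightarrow> 'c) \<Rightarrow> nat \<Rightarrow> bool" where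
  "has_clustering G f c \<longleftrightarrow> (\<forall>C \<in> pre_digraph.sccs (mono_subgraph G f). card (verts C) \<le> c)"

text \<open>Lists may be infinite; since \<open>card\<close> is \<open>0\<close> on infinite sets, that case is listed separately.\<close>

definition list_assignment :: "('a, 'b) pre_digraph \<Rightarrow> nat \<Rightarrow> ('a \<Rightarrow> 'c set) \<Rightarrow> bool" where
  "list_assignment G k L \<longleftrightarrow> (\<forall>v \<in> verts G. infinite (L v) \<or> k \<le> card (L v))"

definition list_colouring :: "('a, 'b) pre_digraph \<Rightarrow> ('a \<Rightarrow> 'c set) \<Rightarrow> ('a \<Rightarrow> 'c) \<Rightarrow> bool" where
  "list_colouring G L f \<longleftrightarrow> (\<forall>v \<in> verts G. f v \<in> L v)"

text \<open>
  The type of colours cannot be quantified inside a definition, so it is a parameter. Choosability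
  is meant with \<open>'c\<close> left as a type variable, that is, for colours of every type: for a single
  type with fewer than \<open>k\<close> elements and a nonempty graph the predicate holds vacuously.
\<close>

definition choosable_with_clustering ::
    "'c itself \<Rightarrow> ('a, 'b) pre_digraph \<Rightarrow> nat \<Rightarrow> nat \<Rightarrow> bool" where
  "choosable_with_clustering (_ :: 'c itself) G k c \<longleftrightarrow>
     (\<forall>L :: 'a \<Rightarrow> 'c set. list_assignment G k L \<longrightarrow>
        (\<exists>f. list_colouring G L f \<and> has_clustering G f c))"

end

(*
  Among all L-colourings take one with the fewest monochromatic edges. Counting neighbours colour by
  colour shows that monochromatic degrees are at most 2, so monochromatic components are paths and
  cycles, and that a vertex v of monochromatic degree 2 can be moved to another colour b v of its list
  in which it also has exactly two neighbours; these are ends of paths, and the colouring stays optimal.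

  If Delta = 3, there are no vertices of monochromatic degree 2 and components have at most 2 vertices.
  Otherwise put D = Delta - 3. Cut the components into blocks of 2 D consecutive vertices and choose, by Haxell's
  theorem, one vertex in each block such that any subset T' of the chosen set T can be moved
  simultaneously. Moving v cuts its old component and links two other paths; each path is linked at
  most twice, so the links can be oriented with every path having at most one incoming and one
  outgoing link. What T' has to satisfy in order to cut long paths often enough, and to break long
  chains of linked short paths, is a 2-CNF formula in which every literal occurs at most once; such a
  formula is satisfiable, since it amounts to 2-colouring a union of two matchings.

  The new components have at most 9 D + 10 vertices, except for pieces of long cycles, and these are
  paths. A second pass therefore meets no long cycles and leaves only components with at most
  9 D + 10 = 9 Delta - 17 vertices.
*)

theory Submission
  imports Defs "HOL-Library.Disjoint_Sets"
begin

text \<open>The block length comes from a degree count. Of the at most \<open>\<Delta>\<close>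
  neighbours of a movable vertex, two carry its new colour and are never movable themselves, and one
  more lies in its own block; at most \<open>D = \<Delta> - 3\<close> neighbours in other blocks can
  conflict with it, and Haxell's theorem then asks for classes of size \<open>2 * D\<close>. The
  obstacle is that a moved vertex also glues two other paths together, so moving everything is no
  better than moving nothing. A requirement saying that some block must be cut if \<open>v\<close>
  moves consumes the negative literal of \<open>v\<close>, which may be used only once. So
  \<open>v\<close> can be responsible for the path it enters, or for the path it leaves, or for
  breaking a chain of short paths, but not for two of these. The rules are balanced so that a chain
  through more short paths starts with a shorter piece; chains of three moved vertices give the
  bound \<open>9 * D + 10\<close>. A long cycle receives a single clause, by which at least one of
  two chosen vertices moves; this opens the cycle without bounding its pieces.\<close>

section \<open>Unions of two matchings\<close>

text \<open>A matching is encoded as an involution whose fixed points are the unmatched points.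
  Cycles of the union alternate between the two matchings and hence are even. The induction removes
  one pair of \<open>s\<close> at a time.\<close>

lemma two_involutions_2_colourable:
  fixes s t :: "'a \<Rightarrow> 'a"
  assumes "finite A" "\<And>x. s (s x) = x" "\<And>x. t (t x) = x" "{x. s x \<noteq> x} \<subseteq> A"
  shows "\<exists>c :: 'a \<Rightarrow> bool. \<forall>x. (s x \<noteq> x \<longrightarrow> c (s x) \<noteq> c x) \<and> (t x \<noteq> x \<longrightarrow> c (t x) \<noteq> c x)"
  using assms
proof (induction "card {x. s x \<noteq> x}" arbitrary: s t rule: less_induct)
  case less
  note ss = less.prems(2) and tt = less.prems(3)
  show ?case
  proof (cases "\<exists>a. s a \<noteq> a")
    case False
    \<comment> \<open>With \<open>s\<close> the identity, one point of every pair of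
      \<open>t\<close> has to be singled out. The choice depends on the set \<open>{x, t x}\<close>
      alone, so both points agree on it.\<close>
    define y where "y x = (SOME z. z \<in> {x, t x})" for x
    have y: "y x \<in> {x, t x}" for x unfolding y_def by (rule someI[of _ x]) simp
    have yt: "y (t x) = y x" for x by (simp add: y_def tt insert_commute)
    have "t x \<noteq> x \<longrightarrow> (y (t x) = t x) \<noteq> (y x = x)" for x
      using y[of x] yt[of x] by auto
    then show ?thesis using False by (intro exI[of _ "\<lambda>x. y x = x"]) blast
  next
    case True
    then obtain a where a: "s a \<noteq> a" by blast
    define b where "b = s a"
    have ab: "a \<noteq> b" "s a = b" "s b = a" using a ss b_def by auto
    define s' where "s' x = (if x = a \<or> x = b then x else s x)" for x
    \<comment> \<open>The stretch \<open>t a\<close>, \<open>a\<close>, \<open>b\<close>,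
      \<open>t b\<close> of three edges is contracted to one edge of \<open>t'\<close>, which
      preserves parity. If one of \<open>a\<close> and \<open>b\<close> has no partner outside the
      pair, the partner of the other becomes unmatched.\<close>
    define t' where "t' x = (if x = a \<or> x = b then x
        else if t x = a then (if t b = b \<or> t b = a then x else t b)
        else if t x = b then (if t a = a \<or> t a = b then x else t a) else t x)" for x
    have s's': "s' (s' x) = x" for x using ab ss[of x] unfolding s'_def by auto
    have t't': "t' (t' x) = x" for x
      using tt[of x] tt[of a] tt[of b] ab(1) unfolding t'_def by (auto split: if_splits)
    have sub: "{x. s' x \<noteq> x} \<subset> {x. s x \<noteq> x}" using a by (auto simp: s'_def)
    have "finite {x. s x \<noteq> x}" using less.prems finite_subset by blast
    then have "card {x. s' x \<noteq> x} < card {x. s x \<noteq> x}" using sub psubset_card_mono by blast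
    then obtain c :: "'a \<Rightarrow> bool" where c: "\<And>x. s' x \<noteq> x \<Longrightarrow> c (s' x) \<noteq> c x" "\<And>x. t' x \<noteq> x \<Longrightarrow> c (t' x) \<noteq> c x"
      using less.hyps[of s' t'] less.prems(1,4) s's' t't' sub by (metis (no_types, lifting) psubsetE subset_trans)
    \<comment> \<open>\<open>k\<close> is the colour of \<open>a\<close>. Partners of
      \<open>a\<close> and of \<open>b\<close> outside the pair each force it, and the new edge of
      \<open>t'\<close> makes the two demands agree; \<open>True\<close> is an arbitrary
      default.\<close>
    define k where "k = (if t a \<noteq> a \<and> t a \<noteq> b then \<not> c (t a) else if t b \<noteq> b \<and> t b \<noteq> a then c (t b) else True)"
    define d where "d x = (if x = a then k else if x = b then \<not> k else c x)" for x
    have "s x \<noteq> x \<longrightarrow> d (s x) \<noteq> d x" for x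
      using c(1)[of x] ab ss[of x] unfolding d_def s'_def by (auto split: if_splits)
    moreover have "t x \<noteq> x \<longrightarrow> d (t x) \<noteq> d x" for x
    proof (cases "t a = b")
      case True
      then have "t b = a" using tt by metis
      then show ?thesis using c(2)[of x] ab tt[of x] True unfolding d_def t'_def
        by (auto split: if_splits)
    next
      case False
      have key: "c (t a) \<noteq> c (t b)" if "t a \<noteq> a" "t b \<noteq> b"
      proof -
        have "t a \<noteq> b" "t b \<noteq> a" using False tt by metis+
        then have "t' (t a) = t b" using that tt unfolding t'_def by auto
        moreover have "t b \<noteq> t a" using tt ab by metis
        ultimately show ?thesis using c(2)[of "t a"] by auto
      qed
      have tb: "t b \<noteq> a" using False tt by metis
      have ka: "t a \<noteq> a \<Longrightarrow> k \<noteq> c (t a)" using False by (simp add: k_def)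
      have kb: "t b \<noteq> b \<Longrightarrow> k = c (t b)" using False tb key by (auto simp: k_def)
      consider "x = a" | "x = b" | "t x = a" "x \<noteq> a" "x \<noteq> b" | "t x = b" "x \<noteq> a" "x \<noteq> b" | "x \<noteq> a" "x \<noteq> b" "t x \<noteq> a" "t x \<noteq> b" by blast
      then show ?thesis
      proof cases
        case 1 then show ?thesis using ka False ab by (auto simp: d_def)
      next
        case 2 then show ?thesis using kb tb ab by (auto simp: d_def)
      next
        case 3 then have "x = t a" using tt[of x] by simp
        then show ?thesis using ka 3 by (auto simp: d_def)
      next
        case 4 then have "x = t b" using tt[of x] by simp
        then show ?thesis using kb 4 ab by (auto simp: d_def)
      next
        case 5 then show ?thesis using c(2)[of x] by (auto simp: d_def t'_def)
      qed
    qed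
    ultimately show ?thesis by blast
  qed
qed

lemma matching_involution:
  assumes "\<And>e. e \<in> M \<Longrightarrow> card e = 2" "\<And>e f x. e \<in> M \<Longrightarrow> f \<in> M \<Longrightarrow> x \<in> e \<Longrightarrow> x \<in> f \<Longrightarrow> e = f"
  obtains s where "\<And>x. s (s x) = x" "\<And>x. s x \<noteq> x \<Longrightarrow> {x, s x} \<in> M"
    "\<And>e. e \<in> M \<Longrightarrow> \<exists>x. e = {x, s x} \<and> s x \<noteq> x"
proof -
  define s where "s x = (if \<exists>y. {x, y} \<in> M then THE y. {x, y} \<in> M else x)" for x
  have ne: "x \<noteq> y" if "{x, y} \<in> M" for x y using assms(1)[OF that] by auto
  have s: "s x = y" if "{x, y} \<in> M" for x y
  proof -
    have "z = y" if "{x, z} \<in> M" for z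
      using assms(2)[OF \<open>{x, y} \<in> M\<close> that, of x] ne[OF that] ne[OF \<open>{x, y} \<in> M\<close>]
      by (auto simp: doubleton_eq_iff)
    then have "(THE y. {x, y} \<in> M) = y" using that by blast
    then show ?thesis using that unfolding s_def by auto
  qed
  show thesis
  proof
    show "{x, s x} \<in> M" if "s x \<noteq> x" for x using s that s_def by metis
    then show "s (s x) = x" for x using s insert_commute by metis
    show "\<exists>x. e = {x, s x} \<and> s x \<noteq> x" if "e \<in> M" for e
      using assms(1)[OF that] s ne that by (metis card_2_iff)
  qed
qed

lemma two_matchings_2_colourable:
  fixes M N :: "'a set set"
  assumes "finite M" "\<And>e. e \<in> M \<Longrightarrow> card e = 2" "\<And>e. e \<in> N \<Longrightarrow> card e = 2"
    and "\<And>e f x. e \<in> M \<Longrightarrow> f \<in> M \<Longrightarrow> x \<in> e \<Longrightarrow> x \<in> f \<Longrightarrow> e = f"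
    and "\<And>e f x. e \<in> N \<Longrightarrow> f \<in> N \<Longrightarrow> x \<in> e \<Longrightarrow> x \<in> f \<Longrightarrow> e = f"
  obtains c :: "'a \<Rightarrow> bool" where "\<And>e. e \<in> M \<union> N \<Longrightarrow> \<exists>x\<in>e. \<exists>y\<in>e. c x \<and> \<not> c y"
proof -
  obtain s where s: "\<And>x. s (s x) = x" "\<And>x. s x \<noteq> x \<Longrightarrow> {x, s x} \<in> M"
    "\<And>e. e \<in> M \<Longrightarrow> \<exists>x. e = {x, s x} \<and> s x \<noteq> x"
    using matching_involution[of M] assms(2,4) by blast
  obtain t where t: "\<And>x. t (t x) = x" "\<And>x. t x \<noteq> x \<Longrightarrow> {x, t x} \<in> N"
    "\<And>e. e \<in> N \<Longrightarrow> \<exists>x. e = {x, t x} \<and> t x \<noteq> x"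
    using matching_involution[of N] assms(3,5) by blast
  have fin: "finite (\<Union>M)" using assms(1,2) by (metis card.infinite finite_Union zero_neq_numeral)
  have "{x. s x \<noteq> x} \<subseteq> \<Union>M" using s(2) by blast
  from two_involutions_2_colourable[OF fin s(1) t(1) this]
  obtain c :: "'a \<Rightarrow> bool" where c: "\<And>x. s x \<noteq> x \<Longrightarrow> c (s x) \<noteq> c x" "\<And>x. t x \<noteq> x \<Longrightarrow> c (t x) \<noteq> c x"
    by blast
  have "\<exists>x\<in>e. \<exists>y\<in>e. c x \<and> \<not> c y" if "e \<in> M \<union> N" for e
  proof -
    obtain x r where e: "e = {x, r}" "c r \<noteq> c x"
    proof (cases "e \<in> M")
      case True
      then show ?thesis using s(3)[of e] c(1) that by blast
    next
      case False
      then show ?thesis using t(3)[of e] c(2) that \<open>e \<in> M \<union> N\<close> by blast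
    qed
    then show ?thesis by (cases "c x") auto
  qed
  then show thesis using that by blast
qed

text \<open>The points to be coloured are the literals \<open>(v, b)\<close>. One matching joins the
  two literals of each variable, the other consists of the clauses. Reading the colour as a truth
  value, the first makes the assignment consistent and the second satisfies every clause.\<close>

lemma linear_2_sat:
  fixes cl :: "'k \<Rightarrow> ('v \<times> bool) set"
  assumes "finite T" "\<And>k. k \<in> K \<Longrightarrow> card (cl k) = 2"
    and "\<And>k l x. k \<in> K \<Longrightarrow> l \<in> K \<Longrightarrow> x \<in> cl k \<Longrightarrow> x \<in> cl l \<Longrightarrow> k = l"
    and "\<And>k v b. k \<in> K \<Longrightarrow> (v, b) \<in> cl k \<Longrightarrow> v \<in> T"
  obtains T' where "T' \<subseteq> T" "\<And>k. k \<in> K \<Longrightarrow> \<exists>(v, b) \<in> cl k. (v \<in> T') = b"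
proof -
  let ?M = "(\<lambda>v. {(v, True), (v, False)}) ` T"
  obtain c where c: "\<And>e. e \<in> ?M \<union> cl ` K \<Longrightarrow> \<exists>x\<in>e. \<exists>y\<in>e. c x \<and> \<not> c y"
  proof (rule two_matchings_2_colourable[of ?M "cl ` K"])
    show "e = f" if "e \<in> cl ` K" "f \<in> cl ` K" "x \<in> e" "x \<in> f" for e f x
      using that assms(3) by blast
  qed (use assms(1,2) in auto)
  define T' where "T' = {v \<in> T. c (v, True)}"
  have "\<exists>(v, b) \<in> cl k. (v \<in> T') = b" if k: "k \<in> K" for k
  proof -
    obtain v b where vb: "(v, b) \<in> cl k" "c (v, b)" using c[of "cl k"] k by force
    then have v: "v \<in> T" using assms(4) k by blast
    have "c (v, True) \<noteq> c (v, False)" using c[of "{(v, True), (v, False)}"] v by auto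
    then have "(v \<in> T') = b" using v vb by (cases b) (auto simp: T'_def)
    then show ?thesis using vb by blast
  qed
  then show thesis using that[of T'] by (auto simp: T'_def)
qed

text \<open>What is coloured are the incidences \<open>(v, x)\<close>. One matching joins the two
  incidences of \<open>v\<close>, the other joins two incidences of the same class of
  \<open>\<kappa>\<close>; the colour says whether \<open>x\<close> becomes the head or the tail of
  \<open>v\<close>.\<close>

lemma orient_linear_multigraph:
  fixes A :: "'v \<Rightarrow> 'a set" and \<kappa> :: "'a \<Rightarrow> 'i"
  assumes "finite T" "\<And>v. v \<in> T \<Longrightarrow> card (A v) = 2"
    and "\<And>i. card {(v, x). v \<in> T \<and> x \<in> A v \<and> \<kappa> x = i} \<le> 2"
  obtains h t where "\<And>v. v \<in> T \<Longrightarrow> A v = {h v, t v}" "\<And>v. v \<in> T \<Longrightarrow> h v \<noteq> t v"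
    "\<And>v w. v \<in> T \<Longrightarrow> w \<in> T \<Longrightarrow> \<kappa> (h v) = \<kappa> (h w) \<Longrightarrow> v = w"
    "\<And>v w. v \<in> T \<Longrightarrow> w \<in> T \<Longrightarrow> \<kappa> (t v) = \<kappa> (t w) \<Longrightarrow> v = w"
proof -
  let ?M = "(\<lambda>v. {v} \<times> A v) ` T"
  define J where "J i = {(v, x). v \<in> T \<and> x \<in> A v \<and> \<kappa> x = i}" for i
  let ?N = "J ` {i. card (J i) = 2}"
  have finA: "finite (A v)" if "v \<in> T" for v using assms(2)[OF that] card.infinite by fastforce
  have J_fin: "finite (J i)" for i
    by (rule finite_subset[of _ "Sigma T A"]) (use assms(1) finA in \<open>auto simp: J_def\<close>)
  obtain c where c: "\<And>e. e \<in> ?M \<union> ?N \<Longrightarrow> \<exists>x\<in>e. \<exists>y\<in>e. c x \<and> \<not> c y"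
  proof (rule two_matchings_2_colourable[of ?M ?N])
    show "card e = 2" if "e \<in> ?M" for e using that assms(2) by (auto simp: card_cartesian_product)
  qed (use assms(1) in \<open>auto simp: J_def\<close>)
  have "\<exists>x y. A v = {x, y} \<and> x \<noteq> y \<and> c (v, x) \<and> \<not> c (v, y)" if v: "v \<in> T" for v
  proof -
    obtain x y where xy: "x \<in> A v" "y \<in> A v" "c (v, x)" "\<not> c (v, y)"
      using c[of "{v} \<times> A v"] v by fastforce
    then have "x \<noteq> y" by auto
    moreover have "A v = {x, y}"
      using card_seteq[of "A v" "{x, y}"] assms(2)[OF v] xy finA[OF v] \<open>x \<noteq> y\<close> by auto
    ultimately show ?thesis using xy by blast
  qed
  then obtain h t where ht: "\<And>v. v \<in> T \<Longrightarrow> A v = {h v, t v} \<and> h v \<noteq> t v \<and> c (v, h v) \<and> \<not> c (v, t v)"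
    by metis
  have sep: "v = w" if "(v, x) \<in> J i" "(w, y) \<in> J i" "c (v, x) = c (w, y)" for v w x y i
  proof (rule ccontr)
    assume vw: "v \<noteq> w"
    then have eq: "{(v, x), (w, y)} = J i"
      using card_seteq[OF J_fin[of i], of "{(v, x), (w, y)}"] that assms(3)[of i] by (auto simp: J_def)
    then have "card (J i) = 2" using vw by (metis card_2_iff prod.inject)
    then show False using c[of "J i"] eq that(3) by auto
  qed
  show thesis
  proof
    show "A v = {h v, t v}" "h v \<noteq> t v" if "v \<in> T" for v using ht that by auto
    show "v = w" if "v \<in> T" "w \<in> T" "\<kappa> (h v) = \<kappa> (h w)" for v w
      using sep[of v "h v" "\<kappa> (h v)" w "h w"] ht that by (auto simp: J_def)
    show "v = w" if "v \<in> T" "w \<in> T" "\<kappa> (t v) = \<kappa> (t w)" for v w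
      using sep[of v "t v" "\<kappa> (t v)" w "t w"] ht that by (auto simp: J_def)
  qed
qed

section \<open>Independent transversals\<close>

definition indep_transversal ::
    "('a \<Rightarrow> 'a \<Rightarrow> bool) \<Rightarrow> 'i set \<Rightarrow> ('i \<Rightarrow> 'a set) \<Rightarrow> ('i \<Rightarrow> 'a) \<Rightarrow> bool" where
  "indep_transversal E I B t \<longleftrightarrow> (\<forall>i\<in>I. t i \<in> B i) \<and> (\<forall>i\<in>I. \<forall>j\<in>I. i \<noteq> j \<longrightarrow> \<not> E (t i) (t j))"

text \<open>This is the induction behind Haxell's theorem. A vertex \<open>x\<close> of
  \<open>B i0\<close> is adjacent to some \<open>y\<close> of the partial transversal. If deleting
  the edge \<open>xy\<close> still leaves no transversal, it is deleted; otherwise the classes of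
  \<open>x\<close> and \<open>y\<close> are merged. Each merge adds one class to \<open>S\<close>
  and two dominating vertices to \<open>Z\<close>.\<close>

lemma no_indep_transversal_dominated:
  assumes "finite I" "finite {(x, y). E x y}" "symp E" "disjoint_family_on B I" "i0 \<in> I"
    and "\<nexists>t. indep_transversal E I B t"
    and "\<exists>t. indep_transversal E (I - {i0}) B t"
  shows "\<exists>S Z. S \<subseteq> I \<and> i0 \<in> S \<and> finite Z \<and> card Z \<le> 2 * (card S - 1) \<and>
    (\<forall>j\<in>S. \<forall>w\<in>B j. \<exists>z\<in>Z. E z w)"
  using assms
proof (induction "card I + card {(x, y). E x y}" arbitrary: I E B i0 rule: less_induct)
  case less
  note finI = less.prems(1) and finE = less.prems(2) and disj = less.prems(4) and i0 = less.prems(5)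
  have sym: "E y x" if "E x y" for x y using less.prems(3) that by (auto dest: sympD)
  show ?case
  proof (cases "B i0 = {}")
    case True
    then show ?thesis using i0 by (intro exI[of _ "{i0}"] exI[of _ "{}"]) auto
  next
    case False
    then obtain x where x: "x \<in> B i0" by blast
    obtain t where t: "indep_transversal E (I - {i0}) B t" using less.prems(7) by blast
    have "\<not> indep_transversal E I B (t(i0 := x))" using less.prems(6) by blast
    moreover have "(t(i0 := x)) k \<in> B k" if "k \<in> I" for k
      using t x that by (auto simp: indep_transversal_def)
    ultimately obtain k l where kl: "k \<in> I" "l \<in> I" "k \<noteq> l" "E ((t(i0 := x)) k) ((t(i0 := x)) l)"
      unfolding indep_transversal_def by blast
    have "k = i0 \<or> l = i0"
      using kl t unfolding indep_transversal_def by (metis DiffI fun_upd_other singletonD)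
    then obtain j where j: "j \<in> I" "j \<noteq> i0" "E x (t j)"
      using kl sym by (metis fun_upd_other fun_upd_same)
    define y where "y = t j"
    have y: "y \<in> B j" "E x y" using j t by (auto simp: y_def indep_transversal_def)
    define E' where "E' a b \<longleftrightarrow> E a b \<and> \<not> (a = x \<and> b = y) \<and> \<not> (a = y \<and> b = x)" for a b
    have sub: "{(a, b). E' a b} \<subset> {(a, b). E a b}" using y by (auto simp: E'_def)
    show ?thesis
    proof (cases "\<exists>t. indep_transversal E' I B t")
      case False
      have "\<exists>S Z. S \<subseteq> I \<and> i0 \<in> S \<and> finite Z \<and> card Z \<le> 2 * (card S - 1) \<and>
        (\<forall>j\<in>S. \<forall>w\<in>B j. \<exists>z\<in>Z. E' z w)"
      proof (rule less.hyps)
        show "card I + card {(x, y). E' x y} < card I + card {(x, y). E x y}"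
          using sub finE by (simp add: psubset_card_mono)
        show "finite {(x, y). E' x y}" using sub finE finite_subset by blast
        show "symp E'" using sym by (auto simp: E'_def intro!: sympI)
        show "\<exists>t. indep_transversal E' (I - {i0}) B t"
          using t by (auto simp: indep_transversal_def E'_def)
        show "finite I" "disjoint_family_on B I" "i0 \<in> I" by (fact finI disj i0)+
        show "\<nexists>t. indep_transversal E' I B t" by (fact False)
      qed
      moreover have "E' a b \<Longrightarrow> E a b" for a b by (simp add: E'_def)
      ultimately show ?thesis by meson
    next
      case True
      then obtain s where s: "indep_transversal E' I B s" by blast
      have "\<not> indep_transversal E I B s" using less.prems(6) by blast
      then obtain k l where kl: "k \<in> I" "l \<in> I" "k \<noteq> l" "E (s k) (s l)" "\<not> E' (s k) (s l)"
        using s unfolding indep_transversal_def by blast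
      have block: "k = l" if "k \<in> I" "l \<in> I" "z \<in> B k" "z \<in> B l" for k l z
        using disj that by (auto simp: disjoint_family_on_def)
      have sB: "s k \<in> B k" if "k \<in> I" for k using s that by (auto simp: indep_transversal_def)
      \<comment> \<open>\<open>E\<close> and \<open>E'\<close> differ only in the edge
        \<open>xy\<close>, so \<open>s\<close> can fail for \<open>E\<close> only by containing both
        \<open>x\<close> and \<open>y\<close>.\<close>
      have sxy: "s i0 = x" "s j = y"
        using kl block[OF _ _ sB] block[OF i0 _ x] block[OF j(1) _ y(1)] sB unfolding E'_def by metis+
      \<comment> \<open>\<open>i0\<close> and \<open>j\<close> are merged, and the neighbours of \<open>x\<close> and \<open>y\<close> are deleted everywhere\<close>
      define N where "N = {w. E x w \<or> E y w}"
      define B' where "B' k = (if k = i0 then B i0 \<union> B j else B k) - N" for k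
      let ?I = "I - {j}"
      have no: "\<not> indep_transversal E ?I B' r" for r
      proof
        assume r: "indep_transversal E ?I B' r"
        have rN: "r k \<notin> N" if "k \<in> ?I" for k
        proof -
          have "r k \<in> B' k" using r that by (simp add: indep_transversal_def)
          then show ?thesis by (simp add: B'_def)
        qed
        have "r i0 \<in> B' i0" using r i0 j(2) by (simp add: indep_transversal_def)
        then have ri: "r i0 \<in> B i0 \<union> B j" by (simp add: B'_def)
        have rk: "r k \<in> B k" if "k \<in> ?I" "k \<noteq> i0" for k
        proof -
          have "r k \<in> B' k" using r that by (simp add: indep_transversal_def)
          then show ?thesis using that by (simp add: B'_def)
        qed
        have ind: "\<not> E (r k) (r l)" if "k \<in> ?I" "l \<in> ?I" "k \<noteq> l" for k l
          using r that by (auto simp: indep_transversal_def)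
        \<comment> \<open>A transversal of the merged system takes a vertex from one of
          \<open>B i0\<close> and \<open>B j\<close>. The other class is represented by
          \<open>x\<close> or \<open>y\<close>, whose neighbours have been deleted.\<close>
        define r' where "r' = (if r i0 \<in> B i0 then r(j := y) else r(j := r i0, i0 := x))"
        have "r' k \<in> B k" if "k \<in> I" for k
          using that ri rk[of k] x y j by (auto simp: r'_def)
        moreover have "\<not> E (r' k) (r' l)" if kl: "k \<in> I" "l \<in> I" "k \<noteq> l" for k l
        proof (cases "r i0 \<in> B i0")
          case True
          then show ?thesis using kl ind[of k l] rN[of k] rN[of l] sym[of "r k" y]
            by (auto simp: r'_def N_def)
        next
          case False
          then show ?thesis
            using kl ind[of k l] ind[of i0 l] ind[of k i0] rN[of k] rN[of l] rN[of i0] i0 j(2)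
              sym[of "r k" x] sym[of "r i0" x]
            by (auto simp: r'_def N_def)
        qed
        ultimately have "indep_transversal E I B r'" by (auto simp: indep_transversal_def)
        then show False using less.prems(6) by blast
      qed
      have "\<exists>S Z. S \<subseteq> ?I \<and> i0 \<in> S \<and> finite Z \<and> card Z \<le> 2 * (card S - 1) \<and>
        (\<forall>j\<in>S. \<forall>w\<in>B' j. \<exists>z\<in>Z. E z w)"
      proof (rule less.hyps)
        show "card ?I + card {(x, y). E x y} < card I + card {(x, y). E x y}"
          using finI j(1) card_Diff1_less by (metis add_less_cancel_right)
        show "disjoint_family_on B' ?I"
          unfolding disjoint_family_on_def B'_def using block i0 j by auto
        show "\<nexists>t. indep_transversal E ?I B' t" using no by blast
        \<comment> \<open>Since \<open>s\<close> contains \<open>x\<close> and \<open>y\<close>, its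
          remaining members are not neighbours of them and survive the deletion.\<close>
        have "indep_transversal E (?I - {i0}) B' s"
          unfolding indep_transversal_def
        proof (intro conjI ballI impI)
          fix k assume k: "k \<in> ?I - {i0}"
          have "s k \<noteq> x" "s k \<noteq> y" using k block[OF _ _ sB] x y i0 j by blast+
          moreover have "\<not> E' x (s k)" "\<not> E' y (s k)"
            using s sxy k i0 j by (auto simp: indep_transversal_def)
          ultimately have "s k \<notin> N" by (auto simp: N_def E'_def)
          then show "s k \<in> B' k" using k sB by (auto simp: B'_def)
        next
          fix k l assume k: "k \<in> ?I - {i0}" "l \<in> ?I - {i0}" "k \<noteq> l"
          have "s k \<noteq> x" "s k \<noteq> y" using k block[OF _ _ sB] x y i0 j by blast+
          moreover have "\<not> E' (s k) (s l)" using s k by (auto simp: indep_transversal_def)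
          ultimately show "\<not> E (s k) (s l)" by (auto simp: E'_def)
        qed
        then show "\<exists>t. indep_transversal E (?I - {i0}) B' t" by blast
        show "i0 \<in> ?I" "finite ?I" using i0 j(2) finI by auto
        show "finite {(x, y). E x y}" "symp E" by (fact finE less.prems(3))+
      qed
      then obtain S Z where SZ: "S \<subseteq> ?I" "i0 \<in> S" "finite Z" "card Z \<le> 2 * (card S - 1)"
        "\<And>j w. j \<in> S \<Longrightarrow> w \<in> B' j \<Longrightarrow> \<exists>z\<in>Z. E z w" by blast
      have finS: "finite S" using SZ finI finite_subset by blast
      have cS: "card (insert j S) = Suc (card S)" using SZ finS by (subst card_insert_disjoint) auto
      have "card (insert x (insert y Z)) \<le> card Z + 2"
        using SZ(3) by (simp add: card_insert_if)
      moreover have "card S \<ge> 1" using SZ(2) finS by (metis One_nat_def Suc_leI card_gt_0_iff empty_iff)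
      ultimately have "card (insert x (insert y Z)) \<le> 2 * (card (insert j S) - 1)"
        using SZ(4) cS by auto
      moreover have "\<exists>z\<in>insert x (insert y Z). E z w" if "k \<in> insert j S" "w \<in> B k" for k w
      proof (cases "w \<in> N")
        case True
        then show ?thesis by (auto simp: N_def)
      next
        case False
        then have "w \<in> B' (if k = j then i0 else k)" using that by (auto simp: B'_def)
        then show ?thesis using SZ(2,5) that by (metis insertCI insertE)
      qed
      ultimately show ?thesis using SZ(1-3) j(1)
        by (intro exI[of _ "insert j S"] exI[of _ "insert x (insert y Z)"]) auto
    qed
  qed
qed

text \<open>The classes in \<open>S\<close> have at least \<open>2 * d * card S\<close> vertices in
  total, but \<open>2 * (card S - 1)\<close> vertices of degree at most \<open>d\<close> cannot
  dominate that many. Classes are added one by one, which supplies the partial transversal.\<close>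

theorem haxell_indep_transversal:
  assumes "finite I" "finite {(x, y). E x y}" "symp E" "disjoint_family_on B I"
    and "\<And>i. i \<in> I \<Longrightarrow> finite (B i) \<and> 2 * d \<le> card (B i)"
    and "\<And>x. card {y. E x y} \<le> d" "1 \<le> d"
  shows "\<exists>t. indep_transversal E I B t"
  using assms(1,4,5)
proof (induction I rule: finite_induct)
  case empty
  then show ?case by (auto simp: indep_transversal_def)
next
  case (insert i I)
  show ?case
  proof (rule ccontr)
    assume no: "\<nexists>t. indep_transversal E (insert i I) B t"
    have "\<exists>t. indep_transversal E I B t"
      using insert by (auto simp: disjoint_family_on_def)
    then obtain S Z where SZ: "S \<subseteq> insert i I" "i \<in> S" "finite Z" "card Z \<le> 2 * (card S - 1)"
        "\<And>j w. j \<in> S \<Longrightarrow> w \<in> B j \<Longrightarrow> \<exists>z\<in>Z. E z w"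
      using no_indep_transversal_dominated[of "insert i I" E B i] no insert assms(2,3) by force
    have finS: "finite S" using SZ insert finite_subset by blast
    have cS: "card S \<ge> 1" using SZ(2) finS by (metis One_nat_def Suc_leI card_gt_0_iff empty_iff)
    have finE: "finite {y. E x y}" for x
      by (rule finite_subset[OF _ finite_imageI[OF assms(2), of snd]]) force
    have "card S * (2 * d) = (\<Sum>j\<in>S. 2 * d)" by simp
    also have "\<dots> \<le> (\<Sum>j\<in>S. card (B j))" using SZ(1) insert.prems by (intro sum_mono) blast
    also have "\<dots> = card (\<Union>j\<in>S. B j)"
    proof (rule card_UN_disjoint[symmetric])
      show "\<forall>j\<in>S. finite (B j)" using SZ(1) insert.prems by blast
      show "\<forall>j\<in>S. \<forall>k\<in>S. j \<noteq> k \<longrightarrow> B j \<inter> B k = {}"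
        using SZ(1) insert.prems(1) unfolding disjoint_family_on_def by blast
    qed (rule finS)
    also have "\<dots> \<le> card (\<Union>z\<in>Z. {y. E z y})"
      using SZ(3,5) finE by (intro card_mono) auto
    also have "\<dots> \<le> (\<Sum>z\<in>Z. card {y. E z y})" using SZ(3) by (rule card_UN_le)
    also have "\<dots> \<le> (\<Sum>z\<in>Z. d)" using assms(6) by (intro sum_mono) auto
    also have "\<dots> \<le> 2 * (card S - 1) * d" using SZ(4) by simp
    finally have "card S * (2 * d) \<le> (card S - 1) * (2 * d)" by (simp add: algebra_simps)
    then show False using cS assms(7) by simp
  qed
qed

section \<open>Components of maximum degree two\<close>

text \<open>Component sizes are bounded by exhibiting small closed sets. Such a set may be a union
  of components, so the exact shape of a component need not be known.\<close>

definition closed_under :: "('a \<Rightarrow> 'a \<Rightarrow> bool) \<Rightarrow> 'a set \<Rightarrow> bool" where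
  "closed_under R S \<longleftrightarrow> (\<forall>x\<in>S. \<forall>y. R x y \<longrightarrow> y \<in> S)"

lemma closed_underD: "closed_under R S \<Longrightarrow> x \<in> S \<Longrightarrow> R x y \<Longrightarrow> y \<in> S"
  by (auto simp: closed_under_def)

lemma closed_under_rtranclp:
  assumes "closed_under R S" "R\<^sup>*\<^sup>* x y" "x \<in> S" shows "y \<in> S"
  using assms(2,3,1) by induction (auto simp: closed_under_def)

definition component :: "('a \<Rightarrow> 'a \<Rightarrow> bool) \<Rightarrow> 'a \<Rightarrow> 'a set" where
  "component R x = {y. R\<^sup>*\<^sup>* x y}"

lemma self_component [simp]: "x \<in> component R x"
  by (simp add: component_def)

lemma component_eq: assumes "symp R" "y \<in> component R x" shows "component R y = component R x"
proof -
  have "R\<^sup>*\<^sup>* y x" if "R\<^sup>*\<^sup>* x y" for x y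
    using that assms(1)
    by induction (auto intro: converse_rtranclp_into_rtranclp dest: sympD)
  then show ?thesis using assms(2) unfolding component_def by (auto intro: rtranclp_trans[of R])
qed

lemma component_step: "R x y \<Longrightarrow> x \<in> component R z \<Longrightarrow> y \<in> component R z"
  by (auto simp: component_def)

text \<open>Two facts in one: \<open>R\<close> does not lead out of the list, and its edges join
  only consecutive entries. Together with \<open>successively R p\<close> this says that the list is
  a whole component and that the component is a path rather than a cycle.\<close>

definition chordless :: "('a \<Rightarrow> 'a \<Rightarrow> bool) \<Rightarrow> 'a list \<Rightarrow> bool" where
  "chordless R p \<longleftrightarrow>
     (\<forall>i<length p. \<forall>y. R (p ! i) y \<longrightarrow> (\<exists>j<length p. y = p ! j \<and> (j = Suc i \<or> i = Suc j)))"

text \<open>Take a longest list of distinct successive vertices, starting at a vertex of degree at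
  most one if the component has one. An inner entry has no neighbours besides its list neighbours,
  and a new neighbour of an end would lengthen the list. A head of degree at most one also excludes
  a closing edge.\<close>

lemma component_list:
  fixes R :: "'a \<Rightarrow> 'a \<Rightarrow> bool"
  assumes "symp R" "irreflp R" "\<And>x. finite {y. R x y}" "\<And>x. card {y. R x y} \<le> 2"
    and "finite (component R a)"
  obtains p where "distinct p" "p \<noteq> []" "set p = component R a" "successively R p"
    "\<exists>x\<in>component R a. card {y. R x y} \<le> 1 \<Longrightarrow> chordless R p"
proof -
  note assms = assms[unfolded component_def]
  let ?C = "{y. R\<^sup>*\<^sup>* a y}" and ?low = "\<exists>x. R\<^sup>*\<^sup>* a x \<and> card {y. R x y} \<le> 1"
  define good where "good p \<longleftrightarrow> distinct p \<and> p \<noteq> [] \<and> set p \<subseteq> ?C \<and> successively R p \<and>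
    (?low \<longrightarrow> card {y. R (hd p) y} \<le> 1)" for p
  have sym: "R y x" if "R x y" for x y using assms(1) that by (auto dest: sympD)
  obtain x0 where "R\<^sup>*\<^sup>* a x0" "?low \<longrightarrow> card {y. R x0 y} \<le> 1" by blast
  then have "good [x0]" by (auto simp: good_def)
  moreover have "length p \<le> card ?C" if "good p" for p
    using that assms(5) by (metis (no_types, lifting) card_mono distinct_card good_def)
  ultimately obtain p where p: "good p" "\<And>r. good r \<Longrightarrow> length r \<le> length p"
    using Lattices_Big.ex_has_greatest_nat[of good "[x0]" length "Suc (card ?C)"] le_imp_less_Suc by metis
  have gp: "distinct p" "p \<noteq> []" "set p \<subseteq> ?C" "successively R p"
    "?low \<Longrightarrow> card {y. R (hd p) y} \<le> 1" using p(1) by (auto simp: good_def)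
  have step: "R (p ! i) (p ! Suc i)" if "Suc i < length p" for i
    using gp(4) that by (simp add: successively_conv_nth)
  have two: "y = b \<or> y = c" if "R x b" "R x c" "b \<noteq> c" "R x y" for x y b c
  proof (rule ccontr)
    assume "\<not> (y = b \<or> y = c)"
    then have "card {b, c, y} = 3" using that by auto
    moreover have "card {b, c, y} \<le> card {y. R x y}" using that assms(3) by (intro card_mono) auto
    ultimately show False using assms(4)[of x] by simp
  qed
  have one: "y = b" if "R x b" "card {y. R x y} \<le> 1" "R x y" for x y b
  proof (rule ccontr)
    assume "y \<noteq> b"
    then have "card {b, y} = 2" by auto
    moreover have "card {b, y} \<le> card {y. R x y}" using that assms(3) by (intro card_mono) auto
    ultimately show False using that by simp
  qed
  have inner: "y = p ! (i - 1) \<or> y = p ! Suc i" if "0 < i" "Suc i < length p" "R (p ! i) y" for i y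
  proof (rule two)
    show "R (p ! i) (p ! (i - 1))" using step[of "i - 1"] that sym by simp
    show "p ! (i - 1) \<noteq> p ! Suc i" using gp(1) that by (simp add: nth_eq_iff_index_eq)
  qed (use step that in auto)
  have inC: "y \<in> ?C" if "x \<in> ?C" "R x y" for x y using that by auto
  have hdp: "hd p = p ! 0" using gp(2) by (simp add: hd_conv_nth)
  have cl: "closed_under R (set p)"
    unfolding closed_under_def
  proof (intro ballI allI impI, rule ccontr)
    fix x y assume x: "x \<in> set p" "R x y" "y \<notin> set p"
    then obtain i where i: "i < length p" "x = p ! i" by (metis in_set_conv_nth)
    consider "0 < i" "Suc i < length p" | "Suc i = length p" | "i = 0" "Suc i < length p"
      using i by linarith
    then show False
    proof cases
      case 1
      then show False using inner[of i y] i x by auto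
    next
      case 2
      then have "last p = x" using i gp(2) by (metis diff_Suc_1 last_conv_nth)
      then have "good (p @ [y])"
        using gp x inC by (auto simp: good_def successively_append_iff)
      then show False using p(2) by fastforce
    next
      case 3
      have "\<not> ?low"
      proof
        assume ?low
        then have "y = p ! 1" using one[of "p ! 0" "p ! 1" y] step[of 0] 3 i x gp(5) hdp by simp
        then show False using x 3 by auto
      qed
      moreover have "R y (hd p)" using x i 3 sym hdp by simp
      ultimately have "good (y # p)"
        using gp x inC[of x y] by (auto simp: good_def successively_Cons)
      then show False using p(2) by fastforce
    qed
  qed
  have set_p: "set p = ?C"
  proof
    show "?C \<subseteq> set p"
    proof
      fix b assume b: "b \<in> ?C"
      have "R\<^sup>*\<^sup>* x a" if "R\<^sup>*\<^sup>* a x" for x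
        using that sym by (induction) (auto intro: converse_rtranclp_into_rtranclp)
      moreover have "R\<^sup>*\<^sup>* a (hd p)" using gp(2,3) hd_in_set by blast
      ultimately have "R\<^sup>*\<^sup>* (hd p) a" by blast
      then have "R\<^sup>*\<^sup>* (hd p) b" using b by auto
      then show "b \<in> set p" using closed_under_rtranclp[OF cl] gp(2) by simp
    qed
  qed (fact gp(3))
  have "chordless R p" if low: ?low
    unfolding chordless_def
  proof (intro allI impI)
    fix i y assume i: "i < length p" "R (p ! i) y"
    then have "y \<in> set p" using cl by (auto simp: closed_under_def)
    then obtain j where j: "j < length p" "y = p ! j" by (metis in_set_conv_nth)
    have "i \<noteq> j" using i j assms(2) by (auto dest: irreflpD)
    have main: "j = Suc i \<or> i = Suc j" if "i < j" "R (p ! i) (p ! j)" "j < length p" for i j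
    proof (cases "i = 0")
      case True
      then have "p ! j = p ! 1" using one[of "p ! 0" "p ! 1" "p ! j"] step[of 0] gp(5)[OF low] hdp that
        by simp
      then have "j = 1" using gp(1) that by (simp add: nth_eq_iff_index_eq)
      then show ?thesis using True by simp
    next
      case False
      then have "p ! j = p ! (i - 1) \<or> p ! j = p ! Suc i" using inner[of i "p ! j"] that by auto
      then have "j = i - 1 \<or> j = Suc i" using gp(1) that by (simp add: nth_eq_iff_index_eq)
      then show ?thesis using that by auto
    qed
    have "j = Suc i \<or> i = Suc j"
    proof (cases "i < j")
      case True
      then show ?thesis using main[of i j] i j by simp
    next
      case False
      then show ?thesis using main[of j i] i j sym \<open>i \<noteq> j\<close> by auto
    qed
    then show "\<exists>j<length p. y = p ! j \<and> (j = Suc i \<or> i = Suc j)" using j by blast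
  qed
  then show thesis using that[of p] gp set_p by (auto simp: component_def)
qed

lemma chordless_rev: "chordless R p \<Longrightarrow> chordless R (rev p)"
  unfolding chordless_def
proof (intro allI impI)
  fix i y
  assume p: "\<forall>i<length p. \<forall>y. R (p ! i) y \<longrightarrow> (\<exists>j<length p. y = p ! j \<and> (j = Suc i \<or> i = Suc j))"
    and i: "i < length (rev p)" "R (rev p ! i) y"
  let ?n = "length p"
  obtain j where j: "j < ?n" "y = p ! j" "j = Suc (?n - Suc i) \<or> ?n - Suc i = Suc j"
  proof -
    have "R (p ! (?n - Suc i)) y" "?n - Suc i < ?n" using i by (auto simp: rev_nth)
    then show thesis using p that by blast
  qed
  have "rev p ! (?n - Suc j) = y" using j by (simp add: rev_nth)
  moreover have "?n - Suc j = Suc i \<or> i = Suc (?n - Suc j)" using j i by auto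
  moreover have "?n - Suc j < length (rev p)" using j by simp
  ultimately show "\<exists>j<length (rev p). y = rev p ! j \<and> (j = Suc i \<or> i = Suc j)" by metis
qed

section \<open>Cutting and relinking paths\<close>

text \<open>
  Moving \<open>v \<in> T\<close> detaches it from its component and links it to the vertices \<open>h v\<close> and \<open>t v\<close>. The link is
  oriented: it enters the path of \<open>h v\<close> and leaves the path of \<open>t v\<close>, and \<open>P C\<close> lists a path \<open>C\<close> from
  the end where it is entered to the end where it is left. The list consists of a margin of length
  \<open>\<mu> C\<close>, then \<open>q C\<close> blocks of length \<open>2 * D\<close>, the \<open>j\<close>-th of which contains \<open>u C j \<in> T\<close>, and a margin
  of length at most \<open>\<nu> C\<close>.
\<close>

locale linkage =
  fixes R :: "'a \<Rightarrow> 'a \<Rightarrow> bool" and D :: nat and T :: "'a set" and h t :: "'a \<Rightarrow> 'a"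
    and path :: "'a set \<Rightarrow> bool" and P :: "'a set \<Rightarrow> 'a list"
    and q \<mu> \<nu> :: "'a set \<Rightarrow> nat" and u :: "'a set \<Rightarrow> nat \<Rightarrow> 'a"
  assumes D_pos: "1 \<le> D" and symR: "symp R" and finK: "finite (component R x)" and finT: "finite T"
    and path_list: "path (component R x) \<Longrightarrow> distinct (P (component R x)) \<and> set (P (component R x)) = component R x \<and>
      successively R (P (component R x)) \<and> chordless R (P (component R x))"
    and h_link: "v \<in> T \<Longrightarrow> h v \<notin> T \<and> path (component R (h v)) \<and> h v = hd (P (component R (h v)))"
    and t_link: "v \<in> T \<Longrightarrow> t v \<notin> T \<and> path (component R (t v)) \<and> t v = last (P (component R (t v)))"
    and h_inj: "v \<in> T \<Longrightarrow> w \<in> T \<Longrightarrow> component R (h v) = component R (h w) \<Longrightarrow> v = w"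
    and t_inj: "v \<in> T \<Longrightarrow> w \<in> T \<Longrightarrow> component R (t v) = component R (t w) \<Longrightarrow> v = w"
    and u_block: "path (component R x) \<Longrightarrow> j < q (component R x) \<Longrightarrow> \<exists>i<length (P (component R x)). u (component R x) j = P (component R x) ! i \<and>
      \<mu> (component R x) + 2 * D * j \<le> i \<and> i < \<mu> (component R x) + 2 * D * (j + 1)"
    and T_block: "path (component R x) \<Longrightarrow> T \<inter> component R x = u (component R x) ` {..<q (component R x)}"
    and margins: "path (component R x) \<Longrightarrow> \<mu> (component R x) \<le> D + 1 \<and> \<nu> (component R x) \<le> D + 1 \<and>
      length (P (component R x)) \<le> \<mu> (component R x) + 2 * D * q (component R x) + \<nu> (component R x)"
    and cycle_T: "\<not> path (component R x) \<Longrightarrow> 9 * D + 10 < card (component R x) \<Longrightarrow>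
      \<exists>y z. y \<noteq> z \<and> y \<in> T \<inter> component R x \<and> z \<in> T \<inter> component R x"
begin

lemma R_sym: "R x y \<Longrightarrow> R y x"
  using symR by (auto dest: sympD)

abbreviation K :: "'a \<Rightarrow> 'a set" where
  "K \<equiv> component R"

lemmas self_K = self_component[of _ R]

lemmas K_eq = component_eq[OF symR]

lemmas K_step = component_step[of R]

definition relink :: "'a set \<Rightarrow> 'a \<Rightarrow> 'a \<Rightarrow> bool" where
  "relink T' x y \<longleftrightarrow> x \<notin> T' \<and> y \<notin> T' \<and> R x y \<or> x \<in> T' \<and> y \<in> {h x, t x} \<or> y \<in> T' \<and> x \<in> {h y, t y}"

lemma u_mem: assumes "path (K x)" "j < q (K x)" shows "u (K x) j \<in> T" "u (K x) j \<in> K x"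
  using T_block[OF assms(1)] assms(2) by auto

lemma u_inj:
  assumes "path (K x)" "path (K y)" "i < q (K x)" "j < q (K y)" "u (K x) i = u (K y) j"
  shows "K x = K y" "i = j"
proof -
  show e: "K x = K y" using u_mem(2)[OF assms(1,3)] u_mem(2)[OF assms(2,4)] assms(5) K_eq by metis
  obtain a where a: "a < length (P (K x))" "u (K x) i = P (K x) ! a"
    "\<mu> (K x) + 2 * D * i \<le> a" "a < \<mu> (K x) + 2 * D * (i + 1)" using u_block[OF assms(1,3)] by blast
  obtain b where b: "b < length (P (K x))" "u (K x) j = P (K x) ! b"
    "\<mu> (K x) + 2 * D * j \<le> b" "b < \<mu> (K x) + 2 * D * (j + 1)" using u_block[OF assms(2,4)] e by metis
  have ab: "a = b" using path_list[OF assms(1)] a b assms(5) e by (simp add: nth_eq_iff_index_eq)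
  have "\<not> k < l" if "\<mu> (K x) + 2 * D * l \<le> a" "a < \<mu> (K x) + 2 * D * (k + 1)" for k l
  proof
    assume "k < l"
    then have "2 * D * (k + 1) \<le> 2 * D * l" by (intro mult_le_mono) auto
    then show False using that by linarith
  qed
  then show "i = j" using a b ab by (meson linorder_neqE_nat)
qed

end

text \<open>
  The set \<open>T' \<subseteq> T\<close> consists of the vertices that are really moved. A path that is entered by a moved vertex
  is cut in its first block, so only paths without blocks can be passed through. Chains of such paths
  are broken at the junctions \<open>(v, w) \<in> X\<close>, where the path entered by \<open>v\<close> is left by \<open>w\<close>. A path with
  at least two blocks is cut in its last block if it is left by a moved vertex that enters a path without
  blocks outside \<open>X\<close>; that block is then exempt from the pairing, which pairs the blocks from \<open>top\<close>
  downwards and cuts every pair.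
\<close>

locale linkage_cut = linkage +
  fixes T' :: "'a set" and X :: "('a \<times> 'a) set" and top :: "'a set \<Rightarrow> nat"
  assumes T'_sub: "T' \<subseteq> T"
    and c_in: "v \<in> T' \<Longrightarrow> 1 \<le> q (component R (h v)) \<Longrightarrow> u (component R (h v)) 0 \<in> T'"
    and X_not_both: "(v, w) \<in> X \<Longrightarrow> v \<notin> T' \<or> w \<notin> T'"
    and X_junction: "(v, w) \<in> X \<Longrightarrow> v \<in> T \<and> w \<in> T \<and> component R (h v) = component R (t w) \<and> q (component R (h v)) = 0"
    and X_maximal: "v \<in> T \<Longrightarrow> w \<in> T \<Longrightarrow> v \<noteq> w \<Longrightarrow> component R (h v) = component R (t w) \<Longrightarrow> q (component R (h v)) = 0 \<Longrightarrow>
      q (component R (h w)) = 0 \<Longrightarrow> \<exists>(v', w')\<in>X. {v, w} \<inter> {v', w'} \<noteq> {}"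
    and c_out: "v \<in> T' \<Longrightarrow> 2 \<le> q (component R (t v)) \<Longrightarrow> q (component R (h v)) = 0 \<Longrightarrow>
      \<forall>(v', w')\<in>X. component R (h v') \<noteq> component R (h v) \<Longrightarrow> u (component R (t v)) (q (component R (t v)) - 1) \<in> T'"
    and top_bounds: "path (component R x) \<Longrightarrow> top (component R x) \<le> q (component R x) - 1 \<and> q (component R x) \<le> top (component R x) + 2"
    and top_out: "v \<in> T' \<Longrightarrow> 3 \<le> q (component R (t v)) \<Longrightarrow> top (component R (t v)) \<noteq> q (component R (t v)) - 1 \<Longrightarrow>
      u (component R (t v)) (q (component R (t v)) - 1) \<in> T'"
    and c_pair: "path (component R x) \<Longrightarrow> 2 * i + 2 \<le> top (component R x) \<Longrightarrow>
      u (component R x) (top (component R x) - 2 * i) \<in> T' \<or> u (component R x) (top (component R x) - 2 * i - 1) \<in> T'"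
    and c_cycle: "\<not> path (component R x) \<Longrightarrow> 9 * D + 10 < card (component R x) \<Longrightarrow> component R x \<inter> T' \<noteq> {}"
begin

section \<open>Pieces of a cut path\<close>

definition in_piece :: "'a set \<Rightarrow> 'a set" where
  "in_piece C = {P C ! i |i. i < length (P C) \<and> (\<forall>j\<le>i. P C ! j \<notin> T')}"

text \<open>Links attach to a path only at its head or at its last vertex. \<open>in_piece\<close>
  and \<open>out_piece\<close> are the parts still connected to these two ends after the moves; what
  lies strictly between the first and the last moved vertex is out of reach of links.\<close>

definition out_piece :: "'a set \<Rightarrow> 'a set" where
  "out_piece C = {P C ! i |i. i < length (P C) \<and> (\<forall>j. i \<le> j \<and> j < length (P C) \<longrightarrow> P C ! j \<notin> T')}"

lemma nth_P_inj: "path (K x) \<Longrightarrow> i < length (P (K x)) \<Longrightarrow> j < length (P (K x)) \<Longrightarrow>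
    P (K x) ! i = P (K x) ! j \<longleftrightarrow> i = j"
  using path_list by (simp add: nth_eq_iff_index_eq)

lemma mem_P: assumes "path (K x)" "y \<in> K x" obtains i where "i < length (P (K x))" "y = P (K x) ! i"
  using assms path_list by (metis in_set_conv_nth)

lemma nth_mem_K: "path (K x) \<Longrightarrow> i < length (P (K x)) \<Longrightarrow> P (K x) ! i \<in> K x"
  using path_list nth_mem by blast

lemma P_ne: "path (K x) \<Longrightarrow> P (K x) \<noteq> []"
  using path_list[of x] self_K[of x] by force

lemma card_K: "path (K x) \<Longrightarrow> card (K x) = length (P (K x))"
  using path_list distinct_card by metis

lemma chordlessE:
  assumes "path (K x)" "i < length (P (K x))" "R (P (K x) ! i) y"
  obtains j where "j < length (P (K x))" "y = P (K x) ! j" "j = Suc i \<or> i = Suc j"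
  using path_list[OF assms(1)] assms(2,3) unfolding chordless_def by blast

lemma in_piece_sub: "path (K x) \<Longrightarrow> in_piece (K x) \<subseteq> K x - T'"
  using nth_mem_K by (auto simp: in_piece_def)

lemma out_piece_sub: "path (K x) \<Longrightarrow> out_piece (K x) \<subseteq> K x - T'"
  using nth_mem_K by (auto simp: out_piece_def)

lemma in_piece_step:
  assumes "path (K x)" "y \<in> in_piece (K x)" "R y z" "z \<notin> T'"
  shows "z \<in> in_piece (K x)"
proof -
  obtain i where i: "i < length (P (K x))" "y = P (K x) ! i" "\<And>j. j \<le> i \<Longrightarrow> P (K x) ! j \<notin> T'"
    using assms(2) by (auto simp: in_piece_def)
  obtain j where j: "j < length (P (K x))" "z = P (K x) ! j" "j = Suc i \<or> i = Suc j"
    using chordlessE[OF assms(1) i(1)] assms(3) i(2) by metis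
  have "P (K x) ! k \<notin> T'" if "k \<le> j" for k
    using that i(3)[of k] j assms(4) by (cases "k = j") auto
  then show ?thesis using j unfolding in_piece_def by blast
qed

lemma out_piece_step:
  assumes "path (K x)" "y \<in> out_piece (K x)" "R y z" "z \<notin> T'"
  shows "z \<in> out_piece (K x)"
proof -
  obtain i where i: "i < length (P (K x))" "y = P (K x) ! i"
    "\<And>j. i \<le> j \<Longrightarrow> j < length (P (K x)) \<Longrightarrow> P (K x) ! j \<notin> T'"
    using assms(2) by (auto simp: out_piece_def)
  obtain j where j: "j < length (P (K x))" "z = P (K x) ! j" "j = Suc i \<or> i = Suc j"
    using chordlessE[OF assms(1) i(1)] assms(3) i(2) by metis
  have "P (K x) ! k \<notin> T'" if "j \<le> k" "k < length (P (K x))" for k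
    using that i(3)[of k] j assms(4) by (cases "k = j") auto
  then show ?thesis using j unfolding out_piece_def by blast
qed

lemma uncut_pieces:
  assumes "path (K x)" "K x \<inter> T' = {}"
  shows "in_piece (K x) = K x" "out_piece (K x) = K x"
proof -
  have free: "P (K x) ! i \<notin> T'" if "i < length (P (K x))" for i
    using assms nth_mem_K that by blast
  have "P (K x) ! i \<in> in_piece (K x)" "P (K x) ! i \<in> out_piece (K x)" if "i < length (P (K x))" for i
    using that free unfolding in_piece_def out_piece_def by auto
  then have "K x \<subseteq> in_piece (K x)" "K x \<subseteq> out_piece (K x)"
    using mem_P[OF assms(1)] by blast+
  then show "in_piece (K x) = K x" "out_piece (K x) = K x"
    using in_piece_sub[OF assms(1)] out_piece_sub[OF assms(1)] by blast+
qed

text \<open>A chain of links can continue from one end of a path to the other only if the path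
  contains no moved vertex.\<close>

lemma last_in_piece:
  assumes "path (K x)" "last (P (K x)) \<in> in_piece (K x)" shows "K x \<inter> T' = {}"
proof -
  let ?p = "P (K x)"
  obtain i where i: "i < length ?p" "last ?p = ?p ! i" "\<And>j. j \<le> i \<Longrightarrow> ?p ! j \<notin> T'"
    using assms(2) by (auto simp: in_piece_def)
  have "i = length ?p - 1"
    using nth_P_inj[OF assms(1) i(1), of "length ?p - 1"] i P_ne[OF assms(1)] by (simp add: last_conv_nth)
  then show ?thesis using i(3) mem_P[OF assms(1)]
    by (metis Suc_pred' disjoint_iff gr_zeroI less_Suc_eq_le not_less_zero i(1))
qed

lemma hd_out_piece:
  assumes "path (K x)" "hd (P (K x)) \<in> out_piece (K x)" shows "K x \<inter> T' = {}"
proof -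
  let ?p = "P (K x)"
  obtain i where i: "i < length ?p" "hd ?p = ?p ! i"
    "\<And>j. i \<le> j \<Longrightarrow> j < length ?p \<Longrightarrow> ?p ! j \<notin> T'"
    using assms(2) by (auto simp: out_piece_def)
  have "i = 0"
    using nth_P_inj[OF assms(1) i(1), of 0] i P_ne[OF assms(1)] by (simp add: hd_conv_nth)
  then show ?thesis using i(3) mem_P[OF assms(1)] by (metis disjoint_iff le0)
qed

lemma hd_in_piece: "v \<in> T \<Longrightarrow> h v \<in> in_piece (K (h v))"
  using h_link[of v] P_ne[of "h v"] T'_sub unfolding in_piece_def by (auto simp: hd_conv_nth)

lemma last_out_piece: assumes "v \<in> T" shows "t v \<in> out_piece (K (t v))"
proof -
  let ?p = "P (K (t v))"
  have "?p \<noteq> []" "t v = ?p ! (length ?p - 1)" "t v \<notin> T'"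
    using t_link[OF assms] P_ne[of "t v"] T'_sub last_conv_nth[of ?p] by auto
  moreover have "\<forall>j. length ?p - 1 \<le> j \<and> j < length ?p \<longrightarrow> j = length ?p - 1" by auto
  ultimately have "\<forall>j. length ?p - 1 \<le> j \<and> j < length ?p \<longrightarrow> ?p ! j \<notin> T'" by metis
  then show ?thesis using \<open>?p \<noteq> []\<close> \<open>t v = ?p ! (length ?p - 1)\<close> unfolding out_piece_def
    by (intro CollectI exI[of _ "length ?p - 1"]) simp
qed

lemma card_in_piece:
  assumes "path (K x)" "i < length (P (K x))" "P (K x) ! i \<in> T'"
  shows "card (in_piece (K x)) \<le> i"
proof -
  have "in_piece (K x) \<subseteq> (!) (P (K x)) ` {..<i}"
    using assms unfolding in_piece_def by (auto, metis imageI lessThan_iff not_le)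
  then have "card (in_piece (K x)) \<le> card ((!) (P (K x)) ` {..<i})" by (intro card_mono) auto
  also have "\<dots> \<le> i" using card_image_le[of "{..<i}" "(!) (P (K x))"] by simp
  finally show ?thesis .
qed

lemma card_out_piece:
  assumes "path (K x)" "i < length (P (K x))" "P (K x) ! i \<in> T'"
  shows "card (out_piece (K x)) \<le> length (P (K x)) - Suc i"
proof -
  have "out_piece (K x) \<subseteq> (!) (P (K x)) ` {Suc i..<length (P (K x))}"
    using assms unfolding out_piece_def
    by (auto, metis atLeastLessThan_iff imageI not_less_eq_eq)
  then have "card (out_piece (K x)) \<le> card ((!) (P (K x)) ` {Suc i..<length (P (K x))})"
    by (intro card_mono) auto
  also have "\<dots> \<le> length (P (K x)) - Suc i"
    using card_image_le[of "{Suc i..<length (P (K x))}" "(!) (P (K x))"] by simp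
  finally show ?thesis .
qed

lemma length_P_le: "path (K x) \<Longrightarrow> length (P (K x)) \<le> 2 * D * q (K x) + 2 * D + 2"
  using margins[of x] by linarith

lemma card_piece_le: assumes "path (K x)"
  shows "card (in_piece (K x)) \<le> length (P (K x))" "card (out_piece (K x)) \<le> length (P (K x))"
  using in_piece_sub[OF assms] out_piece_sub[OF assms] finK card_K[OF assms]
  by (metis Diff_subset card_mono order_trans)+

text \<open>The margin has at most \<open>D + 1\<close> entries and the first block contributes at
  most \<open>2 * D - 1\<close> entries before its moved vertex.\<close>

lemma cut_first_block:
  assumes "path (K x)" "1 \<le> q (K x)" "u (K x) 0 \<in> T'"
  shows "card (in_piece (K x)) \<le> 3 * D"
proof -
  obtain i where i: "i < length (P (K x))" "u (K x) 0 = P (K x) ! i" "i < \<mu> (K x) + 2 * D * (0 + 1)"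
    using u_block[OF assms(1), of 0] assms(2) by auto
  then show ?thesis using card_in_piece[OF assms(1) i(1)] assms(3) margins[OF assms(1)] by auto
qed

text \<open>Behind the moved vertex lie at most \<open>2 * D - 1\<close> entries of its own block,
  \<open>j\<close> full blocks and a margin of at most \<open>D + 1\<close>.\<close>

lemma cut_last_blocks:
  assumes "path (K x)" "Suc j \<le> q (K x)" "u (K x) (q (K x) - Suc j) \<in> T'"
  shows "card (out_piece (K x)) \<le> 2 * D * j + 3 * D"
proof -
  obtain k where k: "q (K x) = Suc (j + k)" using assms(2) by (metis add_Suc le_Suc_ex)
  obtain i where i: "i < length (P (K x))" "u (K x) k = P (K x) ! i" "\<mu> (K x) + 2 * D * k \<le> i"
    using u_block[OF assms(1), of k] k by auto
  have "length (P (K x)) \<le> \<mu> (K x) + 2 * D * Suc (j + k) + (D + 1)"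
    using margins[OF assms(1)] k by simp
  then have "length (P (K x)) - Suc i \<le> 2 * D * j + 3 * D"
    using i(3) by (simp add: algebra_simps)
  moreover have "card (out_piece (K x)) \<le> length (P (K x)) - Suc i"
    using card_out_piece[OF assms(1) i(1)] i(2) assms(3) k by simp
  ultimately show ?thesis by linarith
qed

text \<open>An interval of \<open>9 * D + 2\<close> positions would contain both blocks of some
  pair, one of which has a moved vertex. If \<open>top\<close> is too small for a pair to exist, the
  whole path has at most \<open>8 * D + 2\<close> vertices.\<close>

lemma free_interval:
  assumes "path (K x)" "b \<le> length (P (K x))" "\<And>i. a \<le> i \<Longrightarrow> i < b \<Longrightarrow> P (K x) ! i \<notin> T'"
  shows "b - a \<le> 9 * D + 1"
proof (rule ccontr)
  assume "\<not> ?thesis"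
  then have long: "a + 9 * D + 2 \<le> b" by linarith
  let ?C = "K x"
  have m: "\<mu> ?C \<le> D + 1" "\<nu> ?C \<le> D + 1" "length (P ?C) \<le> \<mu> ?C + 2 * D * q ?C + \<nu> ?C"
    using margins[OF assms(1)] by auto
  have q: "q ?C \<le> top ?C + 2" "top ?C \<le> q ?C - 1" using top_bounds[OF assms(1)] by auto
  have len: "length (P ?C) \<le> \<mu> ?C + 2 * D * top ?C + 5 * D + 1"
  proof -
    have "2 * D * q ?C \<le> 2 * D * (top ?C + 2)" using q(1) by (intro mult_le_mono) auto
    then show ?thesis using m by (simp add: algebra_simps)
  qed
  have top2: "2 \<le> top ?C"
  proof (rule ccontr)
    assume "\<not> 2 \<le> top ?C"
    then have "2 * D * top ?C \<le> 2 * D * 1" by (intro mult_le_mono) auto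
    then have "length (P ?C) \<le> 8 * D + 2" using len m by linarith
    then show False using long assms(2) D_pos by linarith
  qed
  \<comment> \<open>\<open>l0\<close> is the first block starting inside the interval.
    \<open>l\<close> is the next admissible lower index of a pair: at least 1, since block 0 belongs
    to no pair, and of the parity of \<open>top - 1\<close>.\<close>
  define l0 where "l0 = (LEAST l. a \<le> \<mu> ?C + 2 * D * l)"
  have ex: "a \<le> \<mu> ?C + 2 * D * a" using D_pos by (simp add: trans_le_add2)
  then have l0: "a \<le> \<mu> ?C + 2 * D * l0" unfolding l0_def by (rule LeastI)
  have l0_min: "\<mu> ?C + 2 * D * (l0 - 1) < a" if "1 \<le> l0"
    using not_less_Least[of "l0 - 1" "\<lambda>l. a \<le> \<mu> ?C + 2 * D * l"] that unfolding l0_def by simp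
  obtain l where l: "l0 \<le> l" "l \<le> max l0 1 + 1" "1 \<le> l" "even (top ?C + l + 1)"
  proof (cases "even (top ?C + max l0 1 + 1)")
    case True
    then show ?thesis using that[of "max l0 1"] by auto
  next
    case False
    then show ?thesis using that[of "max l0 1 + 1"] by auto
  qed
  have start: "a \<le> \<mu> ?C + 2 * D * l"
    using l0 l(1) by (meson add_left_mono le_trans mult_le_mono2)
  have fin: "\<mu> ?C + 2 * D * l + 4 * D \<le> b \<and> l < top ?C"
  proof (cases "1 \<le> l0")
    case True
    then obtain m where m: "l0 = Suc m" by (metis Suc_le_D One_nat_def)
    have "2 * D * l \<le> 2 * D * (m + 2)" using l(2) m by (intro mult_le_mono) auto
    then have *: "\<mu> ?C + 2 * D * l < a + 4 * D" using l0_min[OF True] m by (simp add: algebra_simps)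
    have "l < top ?C"
    proof (rule ccontr)
      assume "\<not> l < top ?C"
      then have "2 * D * top ?C \<le> 2 * D * l" by (intro mult_le_mono) auto
      then show False using * len long assms(2) by linarith
    qed
    then show ?thesis using * long by linarith
  next
    \<comment> \<open>The interval starts within the first margin, the case that dictates the
      constant: a margin \<open>D + 1\<close>, two unpaired blocks and one pair add up to
      \<open>9 * D + 1\<close>.\<close>
    case False
    then have "l \<le> 2" using l by simp
    then have "2 * D * l \<le> 2 * D * 2" by (intro mult_le_mono) auto
    moreover have "l < top ?C"
    proof (rule ccontr)
      assume "\<not> l < top ?C"
      then have "l = top ?C" using top2 \<open>l \<le> 2\<close> by simp
      then show False using l(4) by simp
    qed
    ultimately show ?thesis using m long by linarith
  qed
  obtain i where i: "top ?C = l + 1 + 2 * i"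
  proof -
    obtain k where k: "top ?C = l + 1 + k" using fin by (metis less_iff_Suc_add add_Suc Suc_eq_plus1)
    then have "even k" using l(4) by (simp, argo)
    then show thesis using that k by (metis evenE)
  qed
  have blk: False if "j = l \<or> j = Suc l" "u ?C j \<in> T'" for j
  proof -
    have "j < q ?C" using that(1) fin q(2) top2 by linarith
    then obtain k where k: "k < length (P ?C)" "u ?C j = P ?C ! k"
      "\<mu> ?C + 2 * D * j \<le> k" "k < \<mu> ?C + 2 * D * (j + 1)"
      using u_block[OF assms(1)] by blast
    have "2 * D * l \<le> 2 * D * j" "2 * D * (j + 1) \<le> 2 * D * (l + 2)"
      using that(1) by (auto intro!: mult_le_mono)
    moreover have "2 * D * (l + 2) = 2 * D * l + 4 * D" by (simp add: algebra_simps)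
    ultimately have "a \<le> k" "k < b" using k start fin by linarith+
    then show False using assms(3)[of k] k(2) that(2) by simp
  qed
  have "u ?C (top ?C - 2 * i) \<in> T' \<or> u ?C (top ?C - 2 * i - 1) \<in> T'"
    using c_pair[OF assms(1), of i] i l(3) by linarith
  then show False using blk i by auto
qed

end

section \<open>Components after relinking\<close>

context linkage_cut
begin

lemma in_piece_subset_closed:
  assumes "path (K x)" "closed_under (relink T') S" "hd (P (K x)) \<in> S"
  shows "in_piece (K x) \<subseteq> S"
proof
  fix y assume "y \<in> in_piece (K x)"
  then obtain i where i: "i < length (P (K x))" "y = P (K x) ! i" "\<And>j. j \<le> i \<Longrightarrow> P (K x) ! j \<notin> T'"
    by (auto simp: in_piece_def)
  have "P (K x) ! k \<in> S" if "k \<le> i" for k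
    using that
  proof (induction k)
    case 0
    then show ?case using assms(3) P_ne[OF assms(1)] by (simp add: hd_conv_nth)
  next
    case (Suc k)
    then have "R (P (K x) ! k) (P (K x) ! Suc k)"
      using path_list[OF assms(1)] i(1) by (simp add: successively_conv_nth)
    then have "relink T' (P (K x) ! k) (P (K x) ! Suc k)"
      using i(3) Suc by (simp add: relink_def)
    then show ?case using closed_underD[OF assms(2)] Suc by simp
  qed
  then show "y \<in> S" using i by blast
qed

lemma closed_relinkI:
  assumes "\<And>x y. x \<in> S \<Longrightarrow> x \<notin> T' \<Longrightarrow> R x y \<Longrightarrow> y \<notin> T' \<Longrightarrow> y \<in> S"
    and "\<And>v. v \<in> T' \<Longrightarrow> h v \<in> S \<Longrightarrow> v \<in> S" "\<And>v. v \<in> T' \<Longrightarrow> t v \<in> S \<Longrightarrow> v \<in> S"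
    and "\<And>v. v \<in> T' \<Longrightarrow> v \<in> S \<Longrightarrow> h v \<in> S \<and> t v \<in> S"
  shows "closed_under (relink T') S"
  using assms unfolding closed_under_def relink_def by blast

definition free_component :: "'a \<Rightarrow> 'a set" where
  "free_component a = {y. (\<lambda>x y. R x y \<and> x \<notin> T' \<and> y \<notin> T')\<^sup>*\<^sup>* a y}"

lemma free_component_step:
  "y \<in> free_component a \<Longrightarrow> y \<notin> T' \<Longrightarrow> R y z \<Longrightarrow> z \<notin> T' \<Longrightarrow> z \<in> free_component a"
  unfolding free_component_def mem_Collect_eq by (rule rtranclp.rtrancl_into_rtrancl) auto

lemma self_free_component [simp]: "a \<in> free_component a"
  by (simp add: free_component_def)

lemma free_component_subset:
  assumes "a \<in> S" "\<And>x y. x \<in> S \<Longrightarrow> R x y \<Longrightarrow> x \<notin> T' \<Longrightarrow> y \<notin> T' \<Longrightarrow> y \<in> S"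
  shows "free_component a \<subseteq> S"
proof -
  have "closed_under (\<lambda>x y. R x y \<and> x \<notin> T' \<and> y \<notin> T') S"
    using assms(2) by (auto simp: closed_under_def)
  then show ?thesis using closed_under_rtranclp[OF _ _ assms(1)] by (auto simp: free_component_def)
qed

lemma free_component_no_T': "a \<notin> T' \<Longrightarrow> y \<in> free_component a \<Longrightarrow> y \<notin> T'"
  using free_component_subset[of a "- T'"] by auto

lemma free_component_sym: assumes "y \<in> free_component a" shows "a \<in> free_component y"
proof -
  have "symp (\<lambda>x y. R x y \<and> x \<notin> T' \<and> y \<notin> T')" using R_sym by (auto intro: sympI)
  then show ?thesis using assms sympD[OF symp_rtranclp] by (fastforce simp: free_component_def)
qed

lemma card_free_component:
  assumes "path (K a)" "a \<notin> T'"
  shows "finite (free_component a)" "card (free_component a) \<le> 9 * D + 1"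
proof -
  let ?p = "P (K a)"
  obtain k where k: "k < length ?p" "a = ?p ! k" using mem_P[OF assms(1) self_K] .
  \<comment> \<open>\<open>lo\<close> and \<open>hi\<close> delimit the maximal run of unmoved
    positions around \<open>k\<close>; \<open>hi\<close> is exclusive and takes the length of the
    list when no moved vertex follows.\<close>
  define lo where "lo = (LEAST x. \<forall>i. x \<le> i \<and> i \<le> k \<longrightarrow> ?p ! i \<notin> T')"
  define hi where "hi = (LEAST y. k < y \<and> (y = length ?p \<or> ?p ! y \<in> T'))"
  have "\<forall>i. k \<le> i \<and> i \<le> k \<longrightarrow> ?p ! i \<notin> T'" using assms(2) k by auto
  then have lo: "\<forall>i. lo \<le> i \<and> i \<le> k \<longrightarrow> ?p ! i \<notin> T'" "lo \<le> k"
    unfolding lo_def by (rule LeastI[where k = k], rule Least_le)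
  have lo_min: "\<exists>i. l \<le> i \<and> i \<le> k \<and> ?p ! i \<in> T'" if "l < lo" for l
    using not_less_Least[OF that[unfolded lo_def]] by blast
  have "k < length ?p \<and> (length ?p = length ?p \<or> ?p ! length ?p \<in> T')" using k by simp
  then have hi: "k < hi \<and> (hi = length ?p \<or> ?p ! hi \<in> T')" "hi \<le> length ?p"
    unfolding hi_def by (rule LeastI[where k = "length ?p"], rule Least_le)
  have hi_min: "l \<noteq> length ?p \<and> ?p ! l \<notin> T'" if "k < l" "l < hi" for l
    using not_less_Least[OF that(2)[unfolded hi_def]] that(1) by blast
  have free: "?p ! i \<notin> T'" if "lo \<le> i" "i < hi" for i
    using that lo hi_min[of i] by (cases "i \<le> k") auto
  have "free_component a \<subseteq> (!) ?p ` {lo..<hi}"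
  proof (rule free_component_subset)
    show "a \<in> (!) ?p ` {lo..<hi}" using k lo(2) hi(1) by auto
    fix x y assume x: "x \<in> (!) ?p ` {lo..<hi}" "R x y" "y \<notin> T'"
    then obtain i where i: "x = ?p ! i" "lo \<le> i" "i < hi" by auto
    then obtain j where j: "j < length ?p" "y = ?p ! j" "j = Suc i \<or> i = Suc j"
      using chordlessE[OF assms(1), of i y] x hi(2) by (metis less_le_trans)
    have "j \<noteq> hi" using hi(1) j x(3) by auto
    moreover have "lo \<le> j"
    proof (rule ccontr)
      assume "\<not> lo \<le> j"
      then have "lo = Suc j" using i j by auto
      then have "\<exists>i. j \<le> i \<and> i \<le> k \<and> ?p ! i \<in> T'" using lo_min[of j] by simp
      then show False using lo(1) \<open>lo = Suc j\<close> j x(3) by (metis Suc_leI le_neq_implies_less)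
    qed
    ultimately show "y \<in> (!) ?p ` {lo..<hi}" using i j by auto
  qed
  moreover have "card ((!) ?p ` {lo..<hi}) \<le> 9 * D + 1"
  proof -
    have "hi - lo \<le> 9 * D + 1" by (rule free_interval[OF assms(1) hi(2)]) (rule free)
    then show ?thesis using card_image_le[of "{lo..<hi}" "(!) ?p"] by simp
  qed
  ultimately show "finite (free_component a)" "card (free_component a) \<le> 9 * D + 1"
    by (auto intro: finite_subset, meson card_mono finite_atLeastLessThan finite_imageI le_trans)
qed

section \<open>Chains of moved vertices\<close>

definition through :: "'a \<Rightarrow> 'a \<Rightarrow> bool" where
  "through v w \<longleftrightarrow> v \<in> T' \<and> w \<in> T' \<and> K (h v) = K (t w) \<and> K (h v) \<inter> T' = {}"

lemma T'_links: assumes "v \<in> T'"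
  shows "path (K (h v))" "path (K (t v))" "h v = hd (P (K (h v)))" "t v = last (P (K (t v)))"
    "h v \<notin> T'" "t v \<notin> T'"
  using assms T'_sub h_link t_link by blast+

lemma h_inj': "v \<in> T' \<Longrightarrow> w \<in> T' \<Longrightarrow> K (h v) = K (h w) \<Longrightarrow> v = w"
  using h_inj T'_sub by blast

lemma t_inj': "v \<in> T' \<Longrightarrow> w \<in> T' \<Longrightarrow> K (t v) = K (t w) \<Longrightarrow> v = w"
  using t_inj T'_sub by blast

text \<open>By \<open>c_in\<close>, entering a path that has a block forces a cut in its first
  block.\<close>

lemma through_tiny: assumes "through v w" shows "q (K (h v)) = 0"
proof (rule ccontr)
  assume "q (K (h v)) \<noteq> 0"
  moreover have v: "v \<in> T'" using assms by (simp add: through_def)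
  ultimately have "u (K (h v)) 0 \<in> T'" "u (K (h v)) 0 \<in> K (h v)"
    using c_in u_block[OF T'_links(1)[OF v], of 0] nth_mem_K[OF T'_links(1)[OF v]] by auto
  then show False using assms by (auto simp: through_def)
qed

text \<open>A path is entered by at most one vertex of \<open>T\<close> and left by at most one, so
  a junction of \<open>X\<close> at this path would be \<open>(v, w)\<close> itself; but
  \<open>X\<close> contains no pair of moved vertices.\<close>

lemma through_not_X: assumes "through v w" "(v', w') \<in> X" shows "K (h v') \<noteq> K (h v)"
proof
  assume "K (h v') = K (h v)"
  then have "v' = v" "w' = w"
    using assms X_junction[OF assms(2)] h_inj t_inj T'_sub unfolding through_def by (metis subsetD)+
  then show False using X_not_both[OF assms(2)] assms(1) by (auto simp: through_def)
qed

text \<open>By maximality a member of \<open>X\<close> meets \<open>{v, w}\<close>. It cannot be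
  located at either of the two paths passed through, which leaves only a junction whose leaving
  vertex is \<open>v\<close>.\<close>

lemma through_X:
  assumes "through v w" "through w x" "v \<noteq> w"
  obtains u' where "(u', v) \<in> X"
proof -
  have T: "v \<in> T" "w \<in> T" "K (h v) = K (t w)" using assms T'_sub by (auto simp: through_def)
  obtain v' w' where X: "(v', w') \<in> X" "{v, w} \<inter> {v', w'} \<noteq> {}"
    using X_maximal[OF T(1,2) assms(3) T(3) through_tiny[OF assms(1)] through_tiny[OF assms(2)]] by blast
  have "v' \<noteq> v" "v' \<noteq> w" using through_not_X[OF _ X(1)] assms by blast+
  moreover have "w' \<noteq> w"
  proof
    assume "w' = w"
    then have "K (h v') = K (h v)" using X_junction[OF X(1)] T by simp
    then show False using through_not_X[OF assms(1) X(1)] by blast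
  qed
  ultimately show thesis using that X by blast
qed

text \<open>The last two passages force a junction of \<open>X\<close> at the path entered by
  \<open>v\<close>, although that path is itself passed through. The condition
  \<open>w \<noteq> x\<close> sets aside a vertex both of whose links attach to the same
  path.\<close>

lemma no_three_through:
  assumes "through v w" "through w x" "through x y" "w \<noteq> x"
  shows False
proof -
  obtain u' where u': "(u', w) \<in> X" using through_X[OF assms(2-4)] .
  then have "K (h u') = K (h v)" using X_junction[OF u'] assms(1) by (simp add: through_def)
  then show False using through_not_X[OF assms(1) u'] by blast
qed

lemma tiny_length: "path (K x) \<Longrightarrow> q (K x) = 0 \<Longrightarrow> length (P (K x)) \<le> 2 * D + 2"
  using length_P_le[of x] by simp

lemma card_in_piece_head: assumes "v \<in> T'" shows "card (in_piece (K (h v))) \<le> 3 * D + 1"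
proof (cases "q (K (h v)) = 0")
  case True
  then show ?thesis
    using tiny_length[OF T'_links(1)[OF assms]] card_piece_le(1)[OF T'_links(1)[OF assms]] D_pos by linarith
next
  case False
  then show ?thesis using cut_first_block[OF T'_links(1)[OF assms]] c_in[OF assms] by simp
qed

text \<open>Two blocks with their margins have at most \<open>6 * D + 2\<close> vertices. With three
  or more blocks, one of the last two is cut, by pairing or by an outgoing clause, which leaves at
  most \<open>5 * D\<close>.\<close>

lemma card_out_piece_tail: assumes "v \<in> T'" shows "card (out_piece (K (t v))) \<le> 6 * D + 2"
proof -
  let ?C = "K (t v)"
  note p = T'_links(2)[OF assms]
  consider "q ?C \<le> 2" | "3 \<le> q ?C" "u ?C (q ?C - 1) \<in> T'" | "3 \<le> q ?C" "top ?C = q ?C - 1"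
    using top_out[OF assms] by linarith
  then show ?thesis
  proof cases
    case 1
    then have "2 * D * q ?C \<le> 2 * D * 2" by (intro mult_le_mono) auto
    then show ?thesis using length_P_le[OF p] card_piece_le(2)[OF p] by linarith
  next
    case 2
    then show ?thesis using cut_last_blocks[OF p, of 0] by simp
  next
    case 3
    then have "u ?C (q ?C - 1) \<in> T' \<or> u ?C (q ?C - 2) \<in> T'"
      using c_pair[OF p, of 0] by (simp add: numeral_2_eq_2)
    then show ?thesis
    proof
      assume "u ?C (q ?C - 1) \<in> T'"
      then show ?thesis using cut_last_blocks[OF p, of 0] 3(1) by simp
    next
      assume "u ?C (q ?C - 2) \<in> T'"
      moreover have "q ?C - Suc 1 = q ?C - 2" by simp
      ultimately have "card (out_piece ?C) \<le> 2 * D * 1 + 3 * D"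
        using cut_last_blocks[OF p, of 1] 3(1) by simp
      then show ?thesis by simp
    qed
  qed
qed

text \<open>The path entered by \<open>v\<close> is uncut, so no junction of \<open>X\<close> lies
  there and the negative literal of \<open>v\<close> is free for the outgoing clause. It cuts the
  last block as soon as there are two; one block with its margins has at most
  \<open>4 * D + 2\<close> vertices.\<close>

lemma card_out_piece_tail_through: assumes "through v w" shows "card (out_piece (K (t v))) \<le> 4 * D + 2"
proof -
  let ?C = "K (t v)"
  have v: "v \<in> T'" using assms by (simp add: through_def)
  note p = T'_links(2)[OF v]
  show ?thesis
  proof (cases "2 \<le> q ?C")
    case True
    have "\<forall>(v', w')\<in>X. K (h v') \<noteq> K (h v)" using through_not_X[OF assms] by blast
    then have "u ?C (q ?C - 1) \<in> T'" using c_out[OF v True through_tiny[OF assms]] by blast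
    then show ?thesis using cut_last_blocks[OF p, of 0] True by simp
  next
    case False
    then have "2 * D * q ?C \<le> 2 * D * 1" by (intro mult_le_mono) auto
    then show ?thesis using length_P_le[OF p] card_piece_le(2)[OF p] by linarith
  qed
qed

text \<open>A second passage forces a junction of \<open>X\<close> at the path that \<open>v\<close>
  leaves, and such a path consists of margins alone.\<close>

lemma card_out_piece_tail_through2:
  assumes "through v w" "through w x" "v \<noteq> w" shows "card (out_piece (K (t v))) \<le> 2 * D + 2"
proof -
  obtain u' where "(u', v) \<in> X" using through_X[OF assms] .
  then have "q (K (t v)) = 0" using X_junction by metis
  moreover have "path (K (t v))" using assms T'_links(2) by (auto simp: through_def)
  ultimately show ?thesis using tiny_length card_piece_le(2) le_trans by blast
qed

lemma card_through: assumes "through v w" shows "card (K (h v)) \<le> 2 * D + 2"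
proof -
  have "path (K (h v))" using assms T'_links by (auto simp: through_def)
  then show ?thesis using tiny_length[OF _ through_tiny[OF assms]] card_K by metis
qed

text \<open>For a maximal chain this collects all that its links hold together. As \<open>h\<close>
  and \<open>t\<close> are injective on paths, \<open>through\<close> is a partial injection, so a
  chain can be given as a list.\<close>

definition chain_set :: "'a list \<Rightarrow> 'a set" where
  "chain_set vs = out_piece (K (t (hd vs))) \<union> set vs \<union> (\<Union>v\<in>set (butlast vs). K (h v)) \<union>
     in_piece (K (h (last vs)))"

text \<open>Injectivity of \<open>h\<close> and \<open>t\<close> shows that a link meeting an inner
  path belongs to the chain. A foreign link at one of the outer pieces would sit at the opposite end
  of an uncut path and so prolong the chain, against maximality.\<close>

lemma closed_chain_set:
  assumes "vs \<noteq> []" "set vs \<subseteq> T'" "successively through vs"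
    and "\<And>v. \<not> through v (hd vs)" "\<And>w. \<not> through (last vs) w"
  shows "closed_under (relink T') (chain_set vs)"
proof (rule closed_relinkI)
  have hdT: "hd vs \<in> T'" and laT: "last vs \<in> T'" using assms(1,2) by auto
  note pt = T'_links(2)[OF hdT] and ph = T'_links(1)[OF laT]
  have KT: "x \<in> T' \<Longrightarrow> x \<notin> out_piece (K (t (hd vs)))" "x \<in> T' \<Longrightarrow> x \<notin> in_piece (K (h (last vs)))" for x
    using out_piece_sub[OF pt] in_piece_sub[OF ph] by blast+
  have mid: "\<exists>w\<in>set vs. through v w" if v: "v \<in> set (butlast vs)" for v
  proof -
    obtain i where i: "i < length (butlast vs)" "butlast vs ! i = v"
      using v unfolding in_set_conv_nth by blast
    have "Suc i < length vs" using i(1) by simp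
    moreover have "v = vs ! i" using nth_butlast[OF i(1)] i(2) by simp
    ultimately have "through v (vs ! Suc i)" "vs ! Suc i \<in> set vs"
      using assms(3)[unfolded successively_conv_nth] by auto
    then show ?thesis by blast
  qed
  have mid_hd: "K (h v) \<subseteq> chain_set vs" if "v \<in> set (butlast vs)" for v
    using that by (auto simp: chain_set_def)
  have mid2: "\<exists>v\<in>set (butlast vs). through v w" if w: "w \<in> set vs" "w \<noteq> hd vs" for w
  proof -
    obtain i where i: "i < length vs" "w = vs ! i" using w(1) by (metis in_set_conv_nth)
    then obtain j where j: "i = Suc j" using w(2) assms(1) by (cases i) (auto simp: hd_conv_nth)
    then have "through (vs ! j) w" using assms(3)[unfolded successively_conv_nth] i by auto
    moreover have "vs ! j \<in> set (butlast vs)"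
      using i j by (metis length_butlast nth_butlast nth_mem less_diff_conv Suc_eq_plus1)
    ultimately show ?thesis by blast
  qed
  have last_or: "v = last vs \<or> v \<in> set (butlast vs)" if "v \<in> set vs" for v
    using that assms(1) by (metis append_butlast_last_id rotate1.simps(2) set_ConsD set_rotate1)
  show "y \<in> chain_set vs" if x: "x \<in> chain_set vs" "x \<notin> T'" "R x y" "y \<notin> T'" for x y
  proof -
    consider "x \<in> out_piece (K (t (hd vs)))" | v where "v \<in> set (butlast vs)" "x \<in> K (h v)"
      | "x \<in> in_piece (K (h (last vs)))"
      using x assms(2) by (auto simp: chain_set_def)
    then show ?thesis
    proof cases
      case 1
      then show ?thesis using out_piece_step[OF pt _ x(3,4)] by (auto simp: chain_set_def)
    next
      case 2
      then show ?thesis using K_step[OF x(3)] mid_hd by blast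
    next
      case 3
      then show ?thesis using in_piece_step[OF ph _ x(3,4)] by (auto simp: chain_set_def)
    qed
  qed
  show "v \<in> chain_set vs" if v: "v \<in> T'" "h v \<in> chain_set vs" for v
  proof -
    have "h v \<notin> set vs" using T'_links(5)[OF v(1)] assms(2) by blast
    then consider "h v \<in> out_piece (K (t (hd vs)))" | w where "w \<in> set (butlast vs)" "h v \<in> K (h w)"
      | "h v \<in> in_piece (K (h (last vs)))"
      using v(2) by (auto simp: chain_set_def)
    then show ?thesis
    proof cases
      case 1
      then have e: "K (h v) = K (t (hd vs))" using out_piece_sub[OF pt] K_eq by blast
      then have "K (h v) \<inter> T' = {}" using hd_out_piece[OF pt] 1 T'_links(3)[OF v(1)] by metis
      then show ?thesis using assms(4)[of v] v e hdT by (auto simp: through_def)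
    next
      case 2
      then have "v = w" using K_eq h_inj' v(1) assms(2) by (metis in_mono in_set_butlastD)
      then show ?thesis using 2 by (auto simp: chain_set_def dest: in_set_butlastD)
    next
      case 3
      then have "K (h v) = K (h (last vs))" using in_piece_sub[OF ph] K_eq by blast
      then show ?thesis using h_inj'[OF v(1) laT] assms(1) by (auto simp: chain_set_def)
    qed
  qed
  show "v \<in> chain_set vs" if v: "v \<in> T'" "t v \<in> chain_set vs" for v
  proof -
    have "t v \<notin> set vs" using T'_links(6)[OF v(1)] assms(2) by blast
    then consider "t v \<in> out_piece (K (t (hd vs)))" | w where "w \<in> set (butlast vs)" "t v \<in> K (h w)"
      | "t v \<in> in_piece (K (h (last vs)))"
      using v(2) by (auto simp: chain_set_def)
    then show ?thesis
    proof cases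
      case 1
      then have "K (t v) = K (t (hd vs))" using out_piece_sub[OF pt] K_eq by blast
      then show ?thesis using t_inj'[OF v(1) hdT] assms(1) by (auto simp: chain_set_def)
    next
      case 2
      then obtain x where x: "x \<in> set vs" "through w x" using mid by blast
      have "K (t v) = K (t x)" using 2 K_eq x(2) by (metis through_def)
      then have "v = x" using t_inj' v(1) x(1) assms(2) by blast
      then show ?thesis using x by (auto simp: chain_set_def)
    next
      case 3
      then have e: "K (t v) = K (h (last vs))" using in_piece_sub[OF ph] K_eq by blast
      then have "K (h (last vs)) \<inter> T' = {}" using last_in_piece[OF ph] 3 T'_links(4)[OF v(1)] by metis
      then show ?thesis using assms(5)[of v] v e laT by (auto simp: through_def)
    qed
  qed
  show "h v \<in> chain_set vs \<and> t v \<in> chain_set vs" if v: "v \<in> T'" "v \<in> chain_set vs" for v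
  proof -
    have "v \<in> set vs"
    proof -
      have "v \<notin> K (h w)" if "w \<in> set (butlast vs)" for w
        using mid[OF that] v(1) by (auto simp: through_def)
      then show ?thesis using v KT[OF v(1)] by (auto simp: chain_set_def)
    qed
    have "h v \<in> chain_set vs"
    proof (cases "v = last vs")
      case True
      then show ?thesis using hd_in_piece T'_sub v(1) by (auto simp: chain_set_def)
    next
      case False
      then show ?thesis using last_or[OF \<open>v \<in> set vs\<close>] mid_hd self_K[of "h v"] by blast
    qed
    moreover have "t v \<in> chain_set vs"
    proof (cases "v = hd vs")
      case True
      then show ?thesis using last_out_piece T'_sub v(1) by (auto simp: chain_set_def)
    next
      case False
      then obtain w where "w \<in> set (butlast vs)" "through w v" using mid2[OF \<open>v \<in> set vs\<close>] by blast
      moreover have "t v \<in> K (t v)" by simp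
      ultimately show ?thesis using mid_hd by (metis in_mono through_def)
    qed
    ultimately show ?thesis by blast
  qed
qed

lemma finite_chain_set: assumes "vs \<noteq> []" "set vs \<subseteq> T'" shows "finite (chain_set vs)"
proof -
  have "hd vs \<in> T'" "last vs \<in> T'" using assms by auto
  then have "finite (out_piece (K (t (hd vs))))" "finite (in_piece (K (h (last vs))))"
    using out_piece_sub in_piece_sub T'_links(1,2) finK by (meson finite_Diff finite_subset)+
  then show ?thesis using finK by (simp add: chain_set_def)
qed

lemma through_inj: "through v w \<Longrightarrow> through v w' \<Longrightarrow> w = w'" "through v w \<Longrightarrow> through v' w \<Longrightarrow> v = v'"
  using t_inj' h_inj' by (metis through_def)+

text \<open>The piece at the tail, the moved vertices, the paths passed through and the piece at the
  head sum to \<open>(6 * D + 2) + 1 + (3 * D + 1)\<close>,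
  \<open>(4 * D + 2) + 2 + (2 * D + 2) + (3 * D + 1)\<close> or
  \<open>(2 * D + 2) + 3 + 2 * (2 * D + 2) + (3 * D + 1)\<close> for one, two or three moved
  vertices. The last sum is the bound.\<close>

lemma closed_around_source:
  assumes "v \<in> T'" "\<And>w. \<not> through w v"
  obtains S where "closed_under (relink T') S" "finite S" "card S \<le> 9 * D + 10" "v \<in> S"
proof -
  have ne: "a \<noteq> b" if "through a b" "a = v \<or> through v a" for a b
    using that assms(2) through_inj(2) by metis
  have inT: "a \<in> T' \<and> b \<in> T'" if "through a b" for a b using that by (simp add: through_def)
  note cin = card_in_piece_head and un = card_Un_le
  consider "\<And>w. \<not> through v w" | w where "through v w" "\<And>x. \<not> through w x"
    | w x where "through v w" "through w x" by blast
  then show thesis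
  proof cases
    case 1
    have "card (chain_set [v]) \<le> card (out_piece (K (t v))) + 1 + card (in_piece (K (h v)))"
      unfolding chain_set_def
      using un[of "out_piece (K (t v)) \<union> {v}" "in_piece (K (h v))"] un[of "out_piece (K (t v))" "{v}"] by simp
    also have "\<dots> \<le> 9 * D + 10" using card_out_piece_tail[OF assms(1)] cin[OF assms(1)] by linarith
    finally show thesis
      using that[of "chain_set [v]"] closed_chain_set[of "[v]"] finite_chain_set[of "[v]"] 1 assms
      by (auto simp: chain_set_def)
  next
    case 2
    have w: "w \<in> T'" using 2 inT by blast
    have "card (chain_set [v, w]) \<le> card (out_piece (K (t v))) + 2 + card (K (h v)) + card (in_piece (K (h w)))"
      unfolding chain_set_def
      using un[of "out_piece (K (t v)) \<union> {v, w} \<union> K (h v)" "in_piece (K (h w))"]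
        un[of "out_piece (K (t v)) \<union> {v, w}" "K (h v)"] un[of "out_piece (K (t v))" "{v, w}"]
        card_insert_le_m1[of 2 "{w}" v] by simp
    also have "\<dots> \<le> 9 * D + 10"
      using card_out_piece_tail_through[OF 2(1)] cin[OF w] card_through[OF 2(1)] by linarith
    finally show thesis
      using that[of "chain_set [v, w]"] closed_chain_set[of "[v, w]"] finite_chain_set[of "[v, w]"] 2 assms w
      by (auto simp: chain_set_def)
  next
    case 3
    have T: "w \<in> T'" "x \<in> T'" using 3 inT by blast+
    have vw: "v \<noteq> w" "w \<noteq> x" using ne 3 by blast+
    have nx: "\<not> through x y" for y using no_three_through[OF 3] vw by blast
    have "card {v, w, x} \<le> 3" by (simp add: card_insert_if)
    then have "card (chain_set [v, w, x]) \<le>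
        card (out_piece (K (t v))) + 3 + card (K (h v)) + card (K (h w)) + card (in_piece (K (h x)))"
      unfolding chain_set_def
      using un[of "out_piece (K (t v)) \<union> {v, w, x} \<union> (K (h v) \<union> K (h w))" "in_piece (K (h x))"]
        un[of "out_piece (K (t v)) \<union> {v, w, x}" "K (h v) \<union> K (h w)"] un[of "K (h v)" "K (h w)"]
        un[of "out_piece (K (t v))" "{v, w, x}"] by simp
    also have "\<dots> \<le> 9 * D + 10"
      using card_out_piece_tail_through2[OF 3 vw(1)] cin[OF T(2)] card_through[OF 3(1)] card_through[OF 3(2)]
      by linarith
    finally show thesis
      using that[of "chain_set [v, w, x]"] closed_chain_set[of "[v, w, x]"] finite_chain_set[of "[v, w, x]"]
        3 assms T nx
      by (auto simp: chain_set_def)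
  qed
qed

text \<open>A vertex linked twice to the same uncut path closes a cycle and is treated separately.
  Otherwise a source is reached after at most two steps backwards, and the closed set around it
  contains the rest of its chain.\<close>

lemma closed_around_T':
  assumes "v \<in> T'"
  obtains S where "closed_under (relink T') S" "finite S" "card S \<le> 9 * D + 10" "v \<in> S"
proof (cases "through v v")
  case True
  let ?S = "insert v (K (h v))"
  have e: "K (h v) = K (t v)" "K (h v) \<inter> T' = {}" using True by (auto simp: through_def)
  have "closed_under (relink T') ?S"
  proof (rule closed_relinkI)
    show "y \<in> ?S" if "x \<in> ?S" "x \<notin> T'" "R x y" "y \<notin> T'" for x y
      using that K_step assms by blast
    show "w \<in> ?S" if "w \<in> T'" "h w \<in> ?S" for w
      using that h_inj'[OF that(1) assms] K_eq T'_links(5)[OF that(1)] assms by blast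
    show "w \<in> ?S" if "w \<in> T'" "t w \<in> ?S" for w
      using that t_inj'[OF that(1) assms] K_eq T'_links(6)[OF that(1)] assms e(1) by (metis insertE insertI1)
    show "h w \<in> ?S \<and> t w \<in> ?S" if "w \<in> T'" "w \<in> ?S" for w
      using that e self_K[of "t v"] by auto
  qed
  moreover have "card ?S \<le> 9 * D + 10"
    using card_through[OF True] card_insert_le_m1[of "2 * D + 3" "K (h v)" v] by simp
  ultimately show ?thesis using that[of ?S] finK by simp
next
  case False
  have pass: "w \<in> S" if S: "closed_under (relink T') S" "x \<in> S" "through x w" for x w S
  proof -
    have x: "x \<in> T'" and w: "w \<in> T'" using S(3) by (auto simp: through_def)
    have "h x \<in> S" using closed_underD[OF S(1,2)] x by (auto simp: relink_def)
    then have "in_piece (K (h x)) \<subseteq> S"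
      using in_piece_subset_closed[OF T'_links(1)[OF x] S(1)] T'_links(3)[OF x] by simp
    moreover have "K (h x) \<inter> T' = {}" using S(3) unfolding through_def by blast
    ultimately have "K (h x) \<subseteq> S" using uncut_pieces(1)[OF T'_links(1)[OF x]] by simp
    then have "t w \<in> S" using S(3) self_K[of "t w"] by (auto simp: through_def)
    then show ?thesis using closed_underD[OF S(1), of "t w" w] w by (auto simp: relink_def)
  qed
  consider "\<And>w. \<not> through w v" | w where "through w v" "\<And>x. \<not> through x w"
    | w x where "through w v" "through x w" by blast
  then show ?thesis
  proof cases
    case 1
    then show ?thesis using closed_around_source[OF assms] that by blast
  next
    case 2
    then have "w \<in> T'" by (simp add: through_def)
    then show ?thesis using closed_around_source[of w] 2 pass that by metis
  next
    case 3
    have "x \<in> T'" using 3 by (simp add: through_def)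
    moreover have "\<not> through y x" for y
    proof
      assume "through y x"
      then have "x = w" using no_three_through 3 by blast
      then show False using 3 through_inj(1) False by metis
    qed
    ultimately obtain S where S: "closed_under (relink T') S" "finite S" "card S \<le> 9 * D + 10" "x \<in> S"
      using closed_around_source[of x] by blast
    then show ?thesis using that[OF S(1-3)] pass 3 by blast
  qed
qed

text \<open>On a path, either the uncut stretch of \<open>a\<close> carries a link, and the closed
  set around that moved vertex absorbs it, or the stretch is itself closed. Links attach to paths
  only, so a cycle merely loses its moved vertices; the second alternative records what is needed to
  recognise the remainder of a long cycle as paths.\<close>

theorem relink_components:
  "(\<exists>S. closed_under (relink T') S \<and> finite S \<and> card S \<le> 9 * D + 10 \<and> a \<in> S) \<or>
   \<not> path (K a) \<and> 9 * D + 10 < card (K a) \<and> K a \<inter> T' \<noteq> {} \<and> a \<notin> T' \<and> closed_under (relink T') (K a - T')"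
proof (cases "a \<in> T'")
  case True
  then show ?thesis using closed_around_T' by metis
next
  case aT: False
  show ?thesis
  proof (cases "path (K a)")
    case True
    note p = True
    show ?thesis
    proof (cases "\<exists>v\<in>T'. h v \<in> free_component a \<or> t v \<in> free_component a")
      case True
      then obtain v where v: "v \<in> T'" "h v \<in> free_component a \<or> t v \<in> free_component a" by blast
      obtain S where S: "closed_under (relink T') S" "finite S" "card S \<le> 9 * D + 10" "v \<in> S"
        using closed_around_T'[OF v(1)] .
      have "h v \<in> S" "t v \<in> S" using closed_underD[OF S(1,4)] v(1) by (auto simp: relink_def)
      moreover have "free_component y \<subseteq> S" if "y \<in> S" for y
        using free_component_subset[OF that] closed_underD[OF S(1)] by (auto simp: relink_def)
      ultimately have "a \<in> S" using v(2) free_component_sym by blast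
      then show ?thesis using S by blast
    next
      case False
      have "closed_under (relink T') (free_component a)"
        by (rule closed_relinkI)
          (use False free_component_step free_component_no_T'[OF aT] in blast)+
      then show ?thesis using card_free_component[OF p aT] self_free_component[of a]
        by (intro disjI1 exI[of _ "free_component a"]) auto
    qed
  next
    case False
    have no: "h v \<notin> K a" "t v \<notin> K a" if "v \<in> T'" for v
      using T'_links(1,2)[OF that] False K_eq by metis+
    have closed: "closed_under (relink T') (K a - T')"
      by (rule closed_relinkI) (use no K_step in blast)+
    show ?thesis
    proof (cases "card (K a) \<le> 9 * D + 10")
      case True
      then have "card (K a - T') \<le> 9 * D + 10" using finK card_mono[of "K a" "K a - T'"] by auto
      then show ?thesis using closed aT finK by (intro disjI1 exI[of _ "K a - T'"]) auto
    next
      case big: False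
      then show ?thesis using c_cycle[OF False] closed aT False by auto
    qed
  qed
qed

end

section \<open>The choice of the vertices to move\<close>

text \<open>Clauses are indexed by keys so that the linearity condition, that no literal lies in two
  clauses, becomes an equality of keys.\<close>

datatype 'a clause_key =
  In 'a | Out 'a | Junction 'a 'a | Blocks "'a set" nat | Cycle "'a set"

context linkage
begin

text \<open>The members of \<open>X\<close> have to be disjoint because each consumes the negative
  literals of both its vertices. Maximality ensures that every remaining junction of this kind
  shares a vertex with a member of \<open>X\<close>.\<close>

lemma maximal_junctions:
  obtains X where "\<And>v w. (v, w) \<in> X \<Longrightarrow> v \<in> T \<and> w \<in> T \<and> v \<noteq> w \<and> K (h v) = K (t w) \<and>
      q (K (h v)) = 0 \<and> q (K (h w)) = 0"
    "\<And>a b v w. (a, b) \<in> X \<Longrightarrow> (v, w) \<in> X \<Longrightarrow> {a, b} \<inter> {v, w} \<noteq> {} \<Longrightarrow> a = v \<and> b = w"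
    "\<And>v w. v \<in> T \<Longrightarrow> w \<in> T \<Longrightarrow> v \<noteq> w \<Longrightarrow> K (h v) = K (t w) \<Longrightarrow> q (K (h v)) = 0 \<Longrightarrow>
      q (K (h w)) = 0 \<Longrightarrow> \<exists>(v', w')\<in>X. {v, w} \<inter> {v', w'} \<noteq> {}"
proof -
  define Junc where "Junc = {(v, w). v \<in> T \<and> w \<in> T \<and> v \<noteq> w \<and> K (h v) = K (t w) \<and>
      q (K (h v)) = 0 \<and> q (K (h w)) = 0}"
  define ok where "ok X \<longleftrightarrow> X \<subseteq> Junc \<and>
    (\<forall>a b v w. (a, b) \<in> X \<longrightarrow> (v, w) \<in> X \<longrightarrow> {a, b} \<inter> {v, w} \<noteq> {} \<longrightarrow> a = v \<and> b = w)" for X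
  have "finite Junc" by (rule finite_subset[of _ "T \<times> T"]) (auto simp: Junc_def finT)
  moreover have "{X. ok X} \<subseteq> Pow Junc" unfolding ok_def by blast
  ultimately have "finite {X. ok X}" by (simp add: finite_subset)
  moreover have "{} \<in> {X. ok X}" by (simp add: ok_def)
  ultimately obtain X where X: "ok X" "\<And>Y. ok Y \<Longrightarrow> X \<subseteq> Y \<Longrightarrow> X = Y"
    using finite_has_maximal[of "{X. ok X}"] by blast
  show thesis
  proof
    show "v \<in> T \<and> w \<in> T \<and> v \<noteq> w \<and> K (h v) = K (t w) \<and> q (K (h v)) = 0 \<and> q (K (h w)) = 0"
      if "(v, w) \<in> X" for v w using X(1) that by (auto simp: ok_def Junc_def)
    show "a = v \<and> b = w" if "(a, b) \<in> X" "(v, w) \<in> X" "{a, b} \<inter> {v, w} \<noteq> {}" for a b v w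
      using X(1) that unfolding ok_def by blast
    show "\<exists>(v', w')\<in>X. {v, w} \<inter> {v', w'} \<noteq> {}"
      if j: "v \<in> T" "w \<in> T" "v \<noteq> w" "K (h v) = K (t w)" "q (K (h v)) = 0" "q (K (h w)) = 0" for v w
    proof (rule ccontr)
      assume no: "\<not> ?thesis"
      have "(v, w) \<in> Junc" using j by (simp add: Junc_def)
      then have "ok (insert (v, w) X)" using X(1) no unfolding ok_def by blast
      then have "(v, w) \<in> X" using X(2) by blast
      then show False using no by blast
    qed
  qed
qed

text \<open>A vertex spends its negative literal on \<open>In\<close> if it enters a path with
  blocks, and otherwise on \<open>Junction\<close> or \<open>Out\<close>, which exclude each other.
  Positive literals are kept apart by position: block 0 serves \<open>In\<close>, the last block
  serves \<open>Out\<close> if claimed, pairs use the indices from 1 to \<open>top\<close>, and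
  \<open>Cycle\<close> concerns components of the other kind.\<close>

lemma exists_linkage_cut:
  obtains T' X top where "linkage_cut R D T h t path P q \<mu> \<nu> u T' X top"
proof -
  obtain X where X: "\<And>v w. (v, w) \<in> X \<Longrightarrow> v \<in> T \<and> w \<in> T \<and> v \<noteq> w \<and> K (h v) = K (t w) \<and>
      q (K (h v)) = 0 \<and> q (K (h w)) = 0"
    and X_disj: "\<And>a b v w. (a, b) \<in> X \<Longrightarrow> (v, w) \<in> X \<Longrightarrow> {a, b} \<inter> {v, w} \<noteq> {} \<Longrightarrow> a = v \<and> b = w"
    and X_max: "\<And>v w. v \<in> T \<Longrightarrow> w \<in> T \<Longrightarrow> v \<noteq> w \<Longrightarrow> K (h v) = K (t w) \<Longrightarrow> q (K (h v)) = 0 \<Longrightarrow>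
      q (K (h w)) = 0 \<Longrightarrow> \<exists>(v', w')\<in>X. {v, w} \<inter> {v', w'} \<noteq> {}"
    using maximal_junctions by blast
  define out where "out v \<longleftrightarrow> v \<in> T \<and> 2 \<le> q (K (t v)) \<and> q (K (h v)) = 0 \<and>
    (\<forall>(v', w')\<in>X. K (h v') \<noteq> K (h v))" for v
  \<comment> \<open>A last block claimed by an \<open>Out\<close> clause leaves the pairing, as its
    positive literal is then used up.\<close>
  define top where "top U = (if \<exists>v. out v \<and> K (t v) = U then q U - 2 else q U - 1)" for U
  have "\<forall>x. \<exists>y z. \<not> path (K x) \<and> 9 * D + 10 < card (K x) \<longrightarrow> y \<noteq> z \<and> y \<in> T \<inter> K x \<and> z \<in> T \<inter> K x"
    using cycle_T by blast
  then obtain Y Z where YZ: "\<And>x. \<not> path (K x) \<Longrightarrow> 9 * D + 10 < card (K x) \<Longrightarrow>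
      Y x \<noteq> Z x \<and> Y x \<in> T \<inter> K x \<and> Z x \<in> T \<inter> K x"
    by metis
  define cyc where "cyc C \<longleftrightarrow> (\<exists>x. C = K x) \<and> \<not> path C \<and> 9 * D + 10 < card C" for C
  \<comment> \<open>The two chosen vertices must depend on the cycle as a set, hence the fixed
    representative.\<close>
  define y where "y C = Y (SOME x. C = K x)" for C
  define z where "z C = Z (SOME x. C = K x)" for C
  have yz: "y C \<noteq> z C \<and> y C \<in> T \<inter> C \<and> z C \<in> T \<inter> C" if "cyc C" for C
  proof -
    have "C = K (SOME x. C = K x)" using that unfolding cyc_def by (metis (mono_tags, lifting) someI_ex)
    then show ?thesis using YZ[of "SOME x. C = K x"] that unfolding cyc_def y_def z_def by simp
  qed
  define cl where "cl k = (case k of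
      In v \<Rightarrow> {(u (K (h v)) 0, True), (v, False)}
    | Out v \<Rightarrow> {(u (K (t v)) (q (K (t v)) - 1), True), (v, False)}
    | Junction v w \<Rightarrow> {(v, False), (w, False)}
    | Blocks U i \<Rightarrow> {(u U (top U - 2 * i), True), (u U (top U - 2 * i - 1), True)}
    | Cycle C \<Rightarrow> {(y C, True), (z C, True)})" for k
  define Keys where "Keys = {In v |v. v \<in> T \<and> 1 \<le> q (K (h v))} \<union> {Out v |v. out v} \<union>
    {Junction v w |v w. (v, w) \<in> X} \<union>
    {Blocks U i |U i. (\<exists>x. U = K x) \<and> path U \<and> 2 * i + 2 \<le> top U} \<union> {Cycle C |C. cyc C}"
  have top_less: "top U \<le> q U - 1" for U unfolding top_def by (rule order_trans[of _ "q U - 1"]) auto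
  have pairE: thesis if "2 * i + 2 \<le> top U" "j \<in> {top U - 2 * i, top U - 2 * i - 1}"
    "j < q U \<Longrightarrow> 1 \<le> j \<Longrightarrow> j \<le> top U \<Longrightarrow> thesis" for U i j thesis
    using that top_less[of U] by auto
  have pos: "(\<exists>v. k = In v \<and> v \<in> T \<and> 1 \<le> q (K (h v)) \<and> x = u (K (h v)) 0) \<or>
      (\<exists>v. k = Out v \<and> out v \<and> x = u (K (t v)) (q (K (t v)) - 1)) \<or>
      (\<exists>a i j. k = Blocks (K a) i \<and> path (K a) \<and> 2 * i + 2 \<le> top (K a) \<and>
        j \<in> {top (K a) - 2 * i, top (K a) - 2 * i - 1} \<and> x = u (K a) j) \<or>
      (\<exists>C. k = Cycle C \<and> cyc C \<and> x \<in> C)" if "k \<in> Keys" "(x, True) \<in> cl k" for x k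
    using that yz unfolding Keys_def cl_def by fastforce
  have neg: "(k = In x \<and> x \<in> T \<and> 1 \<le> q (K (h x))) \<or> (k = Out x \<and> out x) \<or>
      (\<exists>v w. k = Junction v w \<and> (v, w) \<in> X \<and> x \<in> {v, w})" if "k \<in> Keys" "(x, False) \<in> cl k" for x k
    using that unfolding Keys_def cl_def by auto
  \<comment> \<open>the clause containing a positive literal is determined by component and block index\<close>
  have key: "k = In v" if "k \<in> Keys" "v \<in> T" "1 \<le> q (K (h v))" "(u (K (h v)) 0, True) \<in> cl k" for k v
    using pos[OF that(1,4)]
  proof (elim disjE exE conjE)
    fix w assume w: "k = In w" "w \<in> T" "1 \<le> q (K (h w))" "u (K (h v)) 0 = u (K (h w)) 0"
    then show ?thesis using u_inj(1)[of "h v" "h w" 0 0] h_link h_inj that by auto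
  next
    fix w assume w: "k = Out w" "out w" "u (K (h v)) 0 = u (K (t w)) (q (K (t w)) - 1)"
    then show ?thesis using u_inj(2)[of "h v" "t w" 0 "q (K (t w)) - 1"] h_link t_link that
      by (auto simp: out_def)
  next
    fix a i j assume a: "k = Blocks (K a) i" "path (K a)" "2 * i + 2 \<le> top (K a)"
      "j \<in> {top (K a) - 2 * i, top (K a) - 2 * i - 1}" "u (K (h v)) 0 = u (K a) j"
    then have "j < q (K a)" "1 \<le> j" using pairE[OF a(3,4)] by blast+
    then show ?thesis using u_inj(2)[of "h v" a 0 j] h_link that a by auto
  next
    fix C assume C: "k = Cycle C" "cyc C" "u (K (h v)) 0 \<in> C"
    then show ?thesis using u_mem(2)[of "h v" 0] h_link[of v] that K_eq unfolding cyc_def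
      by (metis One_nat_def Suc_le_eq)
  qed
  have key_out: "k = Out v" if "k \<in> Keys" "out v" "(u (K (t v)) (q (K (t v)) - 1), True) \<in> cl k" for k v
  proof -
    have v: "v \<in> T" "path (K (t v))" "q (K (t v)) - 1 < q (K (t v))" "2 \<le> q (K (t v))"
      using that(2) t_link[of v] by (auto simp: out_def)
    show ?thesis using pos[OF that(1,3)]
    proof (elim disjE exE conjE)
      fix w assume w: "k = In w" "w \<in> T" "1 \<le> q (K (h w))" "u (K (t v)) (q (K (t v)) - 1) = u (K (h w)) 0"
      then show ?thesis using key[OF that(1) w(2,3)] u_inj(2)[OF v(2) _ v(3), of "h w" 0] h_link[of w] v by auto
    next
      fix w assume w: "k = Out w" "out w" "u (K (t v)) (q (K (t v)) - 1) = u (K (t w)) (q (K (t w)) - 1)"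
      then have "K (t v) = K (t w)"
        using u_inj(1)[OF v(2) _ v(3), of "t w" "q (K (t w)) - 1"] t_link[of w] by (auto simp: out_def)
      then show ?thesis using w t_inj v(1) by (auto simp: out_def)
    next
      fix a i j assume a: "k = Blocks (K a) i" "path (K a)" "2 * i + 2 \<le> top (K a)"
        "j \<in> {top (K a) - 2 * i, top (K a) - 2 * i - 1}" "u (K (t v)) (q (K (t v)) - 1) = u (K a) j"
      then have j: "j < q (K a)" "1 \<le> j" "j \<le> top (K a)" using pairE[OF a(3,4)] by blast+
      then have "K (t v) = K a" "q (K (t v)) - 1 = j" using u_inj[OF v(2) a(2) v(3) j(1) a(5)] by auto
      moreover have "top (K (t v)) = q (K (t v)) - 2" using that(2) by (auto simp: top_def)
      ultimately show ?thesis using j(3) v(4) by auto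
    next
      fix C assume C: "k = Cycle C" "cyc C" "u (K (t v)) (q (K (t v)) - 1) \<in> C"
      then show ?thesis using u_mem(2)[OF v(2,3)] v(2) K_eq unfolding cyc_def by metis
    qed
  qed
  have key_pair: "k = Blocks (K a) i" if "k \<in> Keys" "path (K a)" "2 * i + 2 \<le> top (K a)"
      "j \<in> {top (K a) - 2 * i, top (K a) - 2 * i - 1}" "(u (K a) j, True) \<in> cl k"
      "\<nexists>v. k = In v" "\<nexists>v. k = Out v" for k a i j
  proof -
    have j: "j < q (K a)" using pairE[OF that(3,4)] by blast
    show ?thesis using pos[OF that(1,5)]
    proof (elim disjE exE conjE)
      fix b i' j' assume b: "k = Blocks (K b) i'" "path (K b)" "2 * i' + 2 \<le> top (K b)"
        "j' \<in> {top (K b) - 2 * i', top (K b) - 2 * i' - 1}" "u (K a) j = u (K b) j'"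
      then have "j' < q (K b)" using pairE[OF b(3,4)] by blast
      then have "K a = K b" "j = j'" using u_inj[OF that(2) b(2) j _ b(5)] by auto
      moreover have "i = i'" if "2 * i + 2 \<le> n" "2 * i' + 2 \<le> n" "j \<in> {n - 2 * i, n - 2 * i - 1}"
        "j \<in> {n - 2 * i', n - 2 * i' - 1}" for n using that by auto
      ultimately show ?thesis using that(3,4) b(1,3,4) by metis
    next
      fix C assume C: "k = Cycle C" "cyc C" "u (K a) j \<in> C"
      then show ?thesis using u_mem(2)[OF that(2) j] that(2) K_eq unfolding cyc_def by metis
    qed (use that in blast)+
  qed
  have uniq: "k = l" if kl: "k \<in> Keys" "l \<in> Keys" "x \<in> cl k" "x \<in> cl l" for k l x
  proof (cases x)
    case (Pair w b)
    show ?thesis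
    proof (cases b)
      case True
      then have wk: "(w, True) \<in> cl k" and wl: "(w, True) \<in> cl l" using kl Pair by auto
      have sameI: "k = In v" if "l = In v" for v
      proof -
        have "v \<in> T \<and> 1 \<le> q (K (h v))" "w = u (K (h v)) 0" using kl(2) wl that by (auto simp: Keys_def cl_def)
        then show ?thesis using key[OF kl(1)] wk by simp
      qed
      have sameO: "k = Out v" if "l = Out v" for v
      proof -
        have "out v" "w = u (K (t v)) (q (K (t v)) - 1)" using kl(2) wl that by (auto simp: Keys_def cl_def)
        then show ?thesis using key_out[OF kl(1)] wk by simp
      qed
      show ?thesis using pos[OF kl(1) wk]
      proof (elim disjE exE conjE)
        fix v assume "k = In v" "v \<in> T" "1 \<le> q (K (h v))" "w = u (K (h v)) 0"
        then show ?thesis using key[OF kl(2)] wl by simp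
      next
        fix v assume "k = Out v" "out v" "w = u (K (t v)) (q (K (t v)) - 1)"
        then show ?thesis using key_out[OF kl(2)] wl by simp
      next
        fix a i j assume a: "k = Blocks (K a) i" "path (K a)" "2 * i + 2 \<le> top (K a)"
          "j \<in> {top (K a) - 2 * i, top (K a) - 2 * i - 1}" "w = u (K a) j"
        have "\<nexists>v. l = In v" using sameI a(1) by auto
        moreover have "\<nexists>v. l = Out v" using sameO a(1) by auto
        ultimately show ?thesis using key_pair[OF kl(2) a(2-4)] wl a by blast
      next
        fix C assume C: "k = Cycle C" "cyc C" "w \<in> C"
        have l: "\<nexists>v. l = In v" "\<nexists>v. l = Out v"
          using sameI sameO C(1) by auto
        show ?thesis using pos[OF kl(2) wl]
        proof (elim disjE exE conjE)
          fix a i j assume a: "l = Blocks (K a) i" "path (K a)" "2 * i + 2 \<le> top (K a)"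
            "j \<in> {top (K a) - 2 * i, top (K a) - 2 * i - 1}" "w = u (K a) j"
          then have "k = Blocks (K a) i" using key_pair[OF kl(1) a(2-4)] wk C(1) by auto
          then show ?thesis using C by simp
        next
          fix C' assume C': "l = Cycle C'" "cyc C'" "w \<in> C'"
          then have "C = C'" using C K_eq unfolding cyc_def by metis
          then show ?thesis using C C' by simp
        qed (use l in blast)+
      qed
    next
      case False
      then have wk: "(w, False) \<in> cl k" and wl: "(w, False) \<in> cl l" using kl Pair by auto
      \<comment> \<open>The first vertex of a junction enters a path belonging to \<open>X\<close>
        and the second leaves a path without blocks; either fact rules out
        \<open>out\<close>.\<close>
      have ex: "q (K (h w)) = 0" "\<not> out w" if "(a, b) \<in> X" "w \<in> {a, b}" for a b
        using that X[OF that(1)] by (auto simp: out_def)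
      have no: "\<not> out w" if "1 \<le> q (K (h w))" using that by (simp add: out_def)
      consider "1 \<le> q (K (h w))" | "out w" | a b where "(a, b) \<in> X" "w \<in> {a, b}"
        using neg[OF kl(1) wk] by blast
      then show ?thesis
      proof cases
        case 1
        then have "k = In w" using neg[OF kl(1) wk] ex no by force
        moreover have "l = In w" using neg[OF kl(2) wl] ex no 1 by force
        ultimately show ?thesis by simp
      next
        case 2
        then have "k = Out w" using neg[OF kl(1) wk] ex no by blast
        moreover have "l = Out w" using neg[OF kl(2) wl] ex no 2 by blast
        ultimately show ?thesis by simp
      next
        case 3
        then obtain a' b' where k: "k = Junction a' b'" "(a', b') \<in> X" "w \<in> {a', b'}"
          using neg[OF kl(1) wk] ex[OF 3] by force
        obtain a'' b'' where l: "l = Junction a'' b''" "(a'', b'') \<in> X" "w \<in> {a'', b''}"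
          using neg[OF kl(2) wl] ex[OF 3] by force
        show ?thesis using X_disj[OF k(2) l(2)] k l by blast
      qed
    qed
  qed
  have two: "card (cl k) = 2" if "k \<in> Keys" for k
  proof -
    have ne: "u (K a) j \<noteq> u (K a) (j - 1)" if "path (K a)" "j < q (K a)" "1 \<le> j" for a j
      using u_inj(2)[of a a j "j - 1"] that by (cases j) auto
    have "u (K a) (top (K a) - 2 * i) \<noteq> u (K a) (top (K a) - 2 * i - 1)"
      if a: "path (K a)" "2 * i + 2 \<le> top (K a)" for a i
    proof -
      have "top (K a) - 2 * i < q (K a)" "1 \<le> top (K a) - 2 * i"
        using pairE[OF a(2), of "top (K a) - 2 * i"] by blast+
      then show ?thesis using ne[OF a(1)] by blast
    qed
    then show ?thesis using that yz X unfolding Keys_def cl_def by (auto simp: card_2_iff')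
  qed
  have inT: "v \<in> T" if "k \<in> Keys" "(v, b) \<in> cl k" for k v b
  proof (cases b)
    case True
    then have vb: "(v, True) \<in> cl k" using that(2) by simp
    show ?thesis using pos[OF that(1) vb]
    proof (elim disjE exE conjE)
      fix w assume "w \<in> T" "1 \<le> q (K (h w))" "v = u (K (h w)) 0"
      then show ?thesis using u_mem(1)[of "h w" 0] h_link[of w] by auto
    next
      fix w assume "out w" "v = u (K (t w)) (q (K (t w)) - 1)"
      then show ?thesis using u_mem(1)[of "t w" "q (K (t w)) - 1"] t_link[of w] by (auto simp: out_def)
    next
      fix a i j assume a: "path (K a)" "2 * i + 2 \<le> top (K a)"
        "j \<in> {top (K a) - 2 * i, top (K a) - 2 * i - 1}" "v = u (K a) j"
      then have "j < q (K a)" using pairE[OF a(2,3)] by blast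
      then show ?thesis using u_mem(1)[OF a(1)] a(4) by simp
    next
      fix C assume "k = Cycle C" "cyc C" "v \<in> C"
      then show ?thesis using yz[of C] vb by (auto simp: cl_def)
    qed
  next
    case False
    then show ?thesis using neg[of k v] that X by (auto simp: out_def)
  qed
  obtain T' where T': "T' \<subseteq> T" "\<And>k. k \<in> Keys \<Longrightarrow> \<exists>(v, b)\<in>cl k. (v \<in> T') = b"
  proof (rule linear_2_sat[OF finT, of Keys cl, OF two uniq inT])
    fix S assume "S \<subseteq> T" "\<And>k. k \<in> Keys \<Longrightarrow> \<exists>(v, b)\<in>cl k. (v \<in> S) = b"
    then show thesis by (rule that)
  qed
  have "linkage_cut R D T h t path P q \<mu> \<nu> u T' X top"
  proof unfold_locales
    show "T' \<subseteq> T" by (fact T')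
    show "u (K (h v)) 0 \<in> T'" if "v \<in> T'" "1 \<le> q (K (h v))" for v
      using T'(2)[of "In v"] that T'(1) by (auto simp: Keys_def cl_def)
    show "v \<notin> T' \<or> w \<notin> T'" if "(v, w) \<in> X" for v w
      using T'(2)[of "Junction v w"] that by (auto simp: Keys_def cl_def)
    show "v \<in> T \<and> w \<in> T \<and> K (h v) = K (t w) \<and> q (K (h v)) = 0" if "(v, w) \<in> X" for v w
      using X[OF that] by blast
    show out_cut: "u (K (t v)) (q (K (t v)) - 1) \<in> T'"
      if "v \<in> T'" "2 \<le> q (K (t v))" "q (K (h v)) = 0" "\<forall>(v', w')\<in>X. K (h v') \<noteq> K (h v)" for v
    proof -
      have "out v" using that T'(1) by (auto simp: out_def)
      then show ?thesis using T'(2)[of "Out v"] that(1) by (auto simp: Keys_def cl_def)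
    qed
    show "top (K x) \<le> q (K x) - 1 \<and> q (K x) \<le> top (K x) + 2" for x by (auto simp: top_def)
    show "u (K (t v)) (q (K (t v)) - 1) \<in> T'"
      if v: "v \<in> T'" "3 \<le> q (K (t v))" "top (K (t v)) \<noteq> q (K (t v)) - 1" for v
    proof -
      obtain w where w: "out w" "K (t w) = K (t v)" using v(3) by (auto simp: top_def split: if_splits)
      then have "w = v" using t_inj v(1) T'(1) by (auto simp: out_def)
      then show ?thesis using out_cut v(1) w(1) by (auto simp: out_def)
    qed
    show "u (K x) (top (K x) - 2 * i) \<in> T' \<or> u (K x) (top (K x) - 2 * i - 1) \<in> T'"
      if "path (K x)" "2 * i + 2 \<le> top (K x)" for x i
      using T'(2)[of "Blocks (K x) i"] that by (auto simp: Keys_def cl_def)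
    show "K x \<inter> T' \<noteq> {}" if "\<not> path (K x)" "9 * D + 10 < card (K x)" for x
    proof -
      have "cyc (K x)" using that by (auto simp: cyc_def)
      then show ?thesis using T'(2)[of "Cycle (K x)"] yz[of "K x"] by (auto simp: Keys_def cl_def)
    qed
  qed (fact X_max)
  then show thesis by (rule that)
qed

end

section \<open>Colourings with the fewest monochromatic edges\<close>

locale simple_graph =
  fixes V :: "'a set" and E :: "'a \<Rightarrow> 'a \<Rightarrow> bool"
  assumes finV: "finite V" and symE: "symp E" and irreflE: "irreflp E"
    and EV: "E x y \<Longrightarrow> x \<in> V \<and> y \<in> V"
begin

definition mono_adj :: "('a \<Rightarrow> 'c) \<Rightarrow> 'a \<Rightarrow> 'a \<Rightarrow> bool" where
  "mono_adj f x y \<longleftrightarrow> E x y \<and> f x = f y"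

definition col_degree :: "('a \<Rightarrow> 'c) \<Rightarrow> 'a \<Rightarrow> 'c \<Rightarrow> nat" where
  "col_degree f v c = card {w. E v w \<and> f w = c}"

definition mono_arcs :: "('a \<Rightarrow> 'c) \<Rightarrow> nat" where
  "mono_arcs f = card {(x, y). mono_adj f x y}"

definition list_col :: "('a \<Rightarrow> 'c set) \<Rightarrow> ('a \<Rightarrow> 'c) \<Rightarrow> bool" where
  "list_col L f \<longleftrightarrow> (\<forall>v\<in>V. f v \<in> L v)"

definition optimal :: "('a \<Rightarrow> 'c set) \<Rightarrow> ('a \<Rightarrow> 'c) \<Rightarrow> bool" where
  "optimal L f \<longleftrightarrow> list_col L f \<and> (\<forall>g. list_col L g \<longrightarrow> mono_arcs f \<le> mono_arcs g)"

lemma E_sym: "E x y \<Longrightarrow> E y x"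
  using symE by (auto dest: sympD)

lemma E_irrefl [simp]: "\<not> E x x"
  using irreflE by (auto dest: irreflpD)

lemma fin_nbrs [simp]: "finite {w. E v w \<and> Q w}"
  by (rule finite_subset[OF _ finV]) (auto dest: EV)

lemma fin_nbrs' [simp]: "finite {w. E v w}"
  by (rule finite_subset[OF _ finV]) (auto dest: EV)

lemma fin_arcs [simp]: "finite {(x, y). E x y \<and> Q x y}"
  by (rule finite_subset[of _ "V \<times> V"]) (auto dest: EV simp: finV)

lemma symp_mono_adj: "symp (mono_adj f)"
  by (auto simp: mono_adj_def intro!: sympI dest: E_sym)

lemma irreflp_mono_adj: "irreflp (mono_adj f)"
  by (auto simp: mono_adj_def intro!: irreflpI)

lemma mono_nbrs: "{y. mono_adj f x y} = {y. E x y \<and> f y = f x}"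
  by (auto simp: mono_adj_def)

lemma card_mono_nbrs: "card {y. mono_adj f x y} = col_degree f x (f x)"
  by (simp add: mono_nbrs col_degree_def)

lemma finite_component: "finite (component (mono_adj f) x)"
proof -
  have "closed_under (mono_adj f) (insert x V)"
    by (auto simp: closed_under_def mono_adj_def dest: EV)
  then have "component (mono_adj f) x \<subseteq> insert x V"
    using closed_under_rtranclp[of "mono_adj f" "insert x V" x] by (auto simp: component_def)
  then show ?thesis using finV finite_subset by blast
qed

lemma mono_arcs_split:
  "mono_arcs f = card {(x, y). mono_adj f x y \<and> x \<noteq> v \<and> y \<noteq> v} + 2 * col_degree f v (f v)"
proof -
  let ?A = "{(x, y). mono_adj f x y \<and> x \<noteq> v \<and> y \<noteq> v}" and ?N = "{w. E v w \<and> f w = f v}"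
  have 1: "{(x, y). mono_adj f x y} = ?A \<union> (Pair v ` ?N \<union> (\<lambda>w. (w, v)) ` ?N)"
    by (auto simp: mono_adj_def dest: E_sym)
  have "card (Pair v ` ?N \<union> (\<lambda>w. (w, v)) ` ?N) = card (Pair v ` ?N) + card ((\<lambda>w. (w, v)) ` ?N)"
    by (rule card_Un_disjoint) auto
  also have "\<dots> = 2 * card ?N"
    by (simp add: card_image inj_on_def)
  finally have 2: "card (Pair v ` ?N \<union> (\<lambda>w. (w, v)) ` ?N) = 2 * card ?N" .
  have "finite ?A" by (rule finite_subset[of _ "V \<times> V"]) (auto simp: mono_adj_def finV dest: EV)
  then have "card {(x, y). mono_adj f x y} = card ?A + card (Pair v ` ?N \<union> (\<lambda>w. (w, v)) ` ?N)"
    unfolding 1 by (intro card_Un_disjoint) auto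
  then show ?thesis using 2 by (simp add: mono_arcs_def col_degree_def)
qed

text \<open>Only edges at \<open>v\<close> change, and each is counted in both directions. Both
  degrees are added rather than subtracted because subtraction on naturals truncates.\<close>

lemma mono_arcs_upd:
  "mono_arcs (f(v := c)) + 2 * col_degree f v (f v) = mono_arcs f + 2 * col_degree f v c"
proof -
  have "{(x, y). mono_adj (f(v := c)) x y \<and> x \<noteq> v \<and> y \<noteq> v} = {(x, y). mono_adj f x y \<and> x \<noteq> v \<and> y \<noteq> v}"
    by (auto simp: mono_adj_def)
  moreover have "{w. E v w \<and> (f(v := c)) w = c} = {w. E v w \<and> f w = c}"
    by auto
  ultimately show ?thesis
    using mono_arcs_split[of f v] mono_arcs_split[of "f(v := c)" v] by (simp add: col_degree_def)
qed

lemma optimal_cnt_le: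
  assumes "optimal L f" "v \<in> V" "c \<in> L v"
  shows "col_degree f v (f v) \<le> col_degree f v c"
proof -
  have "list_col L (f(v := c))" using assms by (auto simp: optimal_def list_col_def)
  then have "mono_arcs f \<le> mono_arcs (f(v := c))" using assms(1) by (simp add: optimal_def)
  then show ?thesis using mono_arcs_upd[of f v c] by simp
qed

lemma optimal_upd:
  assumes "optimal L f" "v \<in> V" "c \<in> L v" "col_degree f v c \<le> col_degree f v (f v)"
  shows "optimal L (f(v := c))"
proof -
  have "mono_arcs (f(v := c)) \<le> mono_arcs f" using mono_arcs_upd[of f v c] assms(4) by simp
  moreover have "list_col L (f(v := c))" using assms by (auto simp: optimal_def list_col_def)
  ultimately show ?thesis using assms(1) unfolding optimal_def by (meson le_trans)
qed

lemma exists_optimal: assumes "\<And>v. v \<in> V \<Longrightarrow> L v \<noteq> {}" obtains f where "optimal L f"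
proof -
  have "list_col L (\<lambda>v. SOME c. c \<in> L v)" using assms by (simp add: list_col_def some_in_eq)
  then obtain f where "list_col L f" "\<And>g. list_col L g \<Longrightarrow> mono_arcs f \<le> mono_arcs g"
    using ex_has_least_nat[of "list_col L" _ mono_arcs] by metis
  then show thesis using that by (auto simp: optimal_def)
qed

end

section \<open>Counting neighbours over the colours of a list\<close>

locale list_graph = simple_graph V E for V :: "'a set" and E +
  fixes \<Delta> k :: nat and L :: "'a \<Rightarrow> 'c set"
  assumes degree: "card {w. E v w} \<le> \<Delta>"
    and k_le: "\<Delta> + 2 \<le> 3 * k"
    and lists: "v \<in> V \<Longrightarrow> infinite (L v) \<or> k \<le> card (L v)"
begin

text \<open>Lists may be longer than \<open>k\<close> or infinite; the counting arguments run over
  exactly \<open>k\<close> colours including the current one.\<close>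

lemma colour_set:
  assumes "v \<in> V" "c \<in> L v"
  obtains F where "finite F" "F \<subseteq> L v" "card F = k" "c \<in> F"
proof -
  have "\<exists>F. finite F \<and> F \<subseteq> L v - {c} \<and> card F = k - 1"
  proof (cases "finite (L v)")
    case True
    then have "k - 1 \<le> card (L v - {c})" using lists[OF assms(1)] assms(2) by simp
    then show ?thesis by (metis obtain_subset_with_card_n)
  next
    case False
    then show ?thesis using infinite_arbitrarily_large[of "L v - {c}" "k - 1"] by auto
  qed
  then obtain F where "finite F" "F \<subseteq> L v - {c}" "card F = k - 1" by blast
  then have "finite (insert c F)" "insert c F \<subseteq> L v" "card (insert c F) = k" "c \<in> insert c F"
    using assms(2) k_le by (auto simp: card_insert_if)
  then show thesis by (rule that)
qed

lemma sum_cnt_le: assumes "finite F" shows "(\<Sum>c\<in>F. col_degree f v c) \<le> \<Delta>"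
proof -
  have "(\<Sum>c\<in>F. col_degree f v c) = card (\<Union>c\<in>F. {w. E v w \<and> f w = c})"
    unfolding col_degree_def using assms by (intro card_UN_disjoint[symmetric]) auto
  also have "\<dots> \<le> card {w. E v w}" by (intro card_mono) auto
  finally show ?thesis using degree[of v] by simp
qed

lemma optimal_colour: "optimal L f \<Longrightarrow> v \<in> V \<Longrightarrow> f v \<in> L v"
  by (auto simp: optimal_def list_col_def)

text \<open>By optimality every colour of the list occurs around \<open>v\<close> at least as often
  as \<open>f v\<close>. Degree 3 would then require \<open>3 * k\<close> neighbours, more than
  \<open>\<Delta>\<close>.\<close>

lemma mono_degree_le_2: assumes "optimal L f" shows "col_degree f v (f v) \<le> 2"
proof (cases "v \<in> V")
  case True
  obtain F where F: "finite F" "F \<subseteq> L v" "card F = k" "f v \<in> F"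
    using colour_set[OF True optimal_colour[OF assms True]] .
  have "k * col_degree f v (f v) = (\<Sum>c\<in>F. col_degree f v (f v))" using F by simp
  also have "\<dots> \<le> (\<Sum>c\<in>F. col_degree f v c)" using F optimal_cnt_le[OF assms True] by (intro sum_mono) auto
  also have "\<dots> \<le> \<Delta>" using sum_cnt_le F(1) .
  finally have *: "k * col_degree f v (f v) \<le> \<Delta>" .
  show ?thesis
  proof (rule ccontr)
    assume "\<not> ?thesis"
    then have "k * 3 \<le> k * col_degree f v (f v)" by (intro mult_le_mono) auto
    then show False using * k_le by linarith
  qed
next
  case False
  then have "{w. E v w \<and> f w = f v} = {}" using EV by auto
  then show ?thesis unfolding col_degree_def by (metis card.empty zero_le)
qed

text \<open>Otherwise each of the \<open>k - 1\<close> other colours occurs at least three times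
  around \<open>v\<close>, making \<open>3 * (k - 1) + 2\<close> neighbours, which is at least
  \<open>\<Delta> + 1\<close>.\<close>

lemma alternative_colour:
  assumes "optimal L f" "v \<in> V" "col_degree f v (f v) = 2"
  obtains c where "c \<in> L v" "c \<noteq> f v" "col_degree f v c = 2"
proof (rule ccontr)
  assume not: "\<not> thesis"
  note witness = that
  have no: "col_degree f v c \<noteq> 2" if "c \<in> L v" "c \<noteq> f v" for c using not witness that by blast
  obtain F where F: "finite F" "F \<subseteq> L v" "card F = k" "f v \<in> F"
    using colour_set[OF assms(2) optimal_colour[OF assms(1,2)]] .
  have ge: "3 \<le> col_degree f v c" if "c \<in> F - {f v}" for c
    using optimal_cnt_le[OF assms(1,2), of c] assms(3) no[of c] that F(2) by fastforce
  have "3 * (k - 1) + 2 = (\<Sum>c\<in>F - {f v}. 3) + 2" using F by simp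
  also have "\<dots> \<le> (\<Sum>c\<in>F - {f v}. col_degree f v c) + col_degree f v (f v)"
  proof -
    have "(\<Sum>c\<in>F - {f v}. 3) \<le> (\<Sum>c\<in>F - {f v}. col_degree f v c)" using ge by (rule sum_mono)
    then show ?thesis using assms(3) by linarith
  qed
  also have "\<dots> = (\<Sum>c\<in>F. col_degree f v c)" using F by (subst sum.remove[of F "f v"]) auto
  also have "\<dots> \<le> \<Delta>" using sum_cnt_le F(1) .
  finally show False using k_le by linarith
qed

end

section \<open>Blocks of consecutive interior vertices\<close>

text \<open>Subtracting 2 from the length keeps both ends of the list out of the blocks, so every
  block vertex has two list neighbours. The remainder is shared between the two margins.\<close>

lemma window_bounds:
  fixes n d m j i :: nat
  assumes "j < (n - 2) div d" "m = 1 + ((n - 2) mod d) div 2" "m + d * j \<le> i" "i < m + d * (j + 1)"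
  shows "1 \<le> i" "Suc i < n"
proof -
  have "d * (j + 1) \<le> d * ((n - 2) div d)" using assms(1) by (intro mult_le_mono) auto
  moreover have "n - 2 = d * ((n - 2) div d) + (n - 2) mod d" by simp
  moreover have "0 < n - 2"
  proof (rule ccontr)
    assume "\<not> 0 < n - 2"
    then have "n - 2 = 0" by simp
    then show False using assms(1) by (simp only: div_0)
  qed
  ultimately show "Suc i < n" using assms(2,4) by linarith
  show "1 \<le> i" using assms(2,3) by simp
qed

locale recolouring = list_graph V E \<Delta> k L
  for V :: "'a set" and E and \<Delta> k :: nat and L :: "'a \<Rightarrow> 'c set" +
  fixes f b :: "'a \<Rightarrow> 'c" and lst :: "'a set \<Rightarrow> 'a list"
  assumes opt: "optimal L f"
    and b_alt: "v \<in> V \<Longrightarrow> col_degree f v (f v) = 2 \<Longrightarrow> b v \<in> L v \<and> b v \<noteq> f v \<and> col_degree f v (b v) = 2"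
    and deg4: "4 \<le> \<Delta>"
    and lst: "distinct (lst (component (mono_adj f) x)) \<and> lst (component (mono_adj f) x) \<noteq> [] \<and>
      set (lst (component (mono_adj f) x)) = component (mono_adj f) x \<and>
      successively (mono_adj f) (lst (component (mono_adj f) x)) \<and>
      ((\<exists>y\<in>component (mono_adj f) x. col_degree f y (f y) \<le> 1) \<longrightarrow> chordless (mono_adj f) (lst (component (mono_adj f) x)))"
begin

abbreviation K :: "'a \<Rightarrow> 'a set" where "K \<equiv> component (mono_adj f)"

abbreviation D :: nat where "D \<equiv> \<Delta> - 3"

definition movable :: "'a set" where "movable = {v \<in> V. col_degree f v (f v) = 2}"

definition targets :: "'a \<Rightarrow> 'a set" where "targets v = {w. E v w \<and> f w = b v}"

lemma card_targets: "v \<in> movable \<Longrightarrow> card (targets v) = 2"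
  using b_alt by (auto simp: movable_def targets_def col_degree_def)

text \<open>Moving \<open>v\<close> alone keeps the colouring optimal and gives \<open>w\<close> the
  additional monochromatic neighbour \<open>v\<close>; its new degree is at most 2.\<close>

lemma targets_low:
  assumes "v \<in> movable" "w \<in> targets v" shows "col_degree f w (f w) \<le> 1"
proof -
  have v: "v \<in> V" "col_degree f v (f v) = 2" using assms(1) by (auto simp: movable_def)
  note bv = b_alt[OF v]
  have "optimal L (f(v := b v))" using optimal_upd[OF opt v(1)] bv v(2) by simp
  then have le: "col_degree (f(v := b v)) w ((f(v := b v)) w) \<le> 2" by (rule mono_degree_le_2)
  have w: "w \<noteq> v" "f w = b v" "E w v" using assms(2) by (auto simp: targets_def dest: E_sym)
  have "{y. E w y \<and> (f(v := b v)) y = (f(v := b v)) w} = insert v {y. E w y \<and> f y = f w}"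
    using w by auto
  moreover have "v \<notin> {y. E w y \<and> f y = f w}" using w bv by auto
  ultimately have "col_degree (f(v := b v)) w ((f(v := b v)) w) = Suc (col_degree f w (f w))"
    by (simp add: col_degree_def)
  then show ?thesis using le by simp
qed

lemma b_ne: "v \<in> movable \<Longrightarrow> b v \<noteq> f v"
  using b_alt by (auto simp: movable_def)

lemma targets_not_movable: "v \<in> movable \<Longrightarrow> w \<in> targets v \<Longrightarrow> w \<notin> movable"
  using targets_low by (fastforce simp: movable_def)

text \<open>As all monochromatic degrees are at most 2, the low components are the paths and the
  others are cycles.\<close>

definition low :: "'a set \<Rightarrow> bool" where "low C \<longleftrightarrow> (\<exists>y\<in>C. col_degree f y (f y) \<le> 1)"

definition nblocks :: "'a set \<Rightarrow> nat" where "nblocks C = (length (lst C) - 2) div (2 * D)"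

definition margin :: "'a set \<Rightarrow> nat" where "margin C = 1 + ((length (lst C) - 2) mod (2 * D)) div 2"

definition block :: "'a set \<times> nat \<Rightarrow> 'a set" where
  "block = (\<lambda>(C, j). {lst C ! i |i. margin C + 2 * D * j \<le> i \<and> i < margin C + 2 * D * (j + 1)})"

definition blocks :: "('a set \<times> nat) set" where
  "blocks = {(K x, j) |x j. x \<in> V \<and> j < nblocks (K x)}"

lemma blockE:
  assumes "e \<in> blocks" "v \<in> block e"
  obtains x j i where "e = (K x, j)" "x \<in> V" "j < nblocks (K x)" "v = lst (K x) ! i"
    "margin (K x) + 2 * D * j \<le> i" "i < margin (K x) + 2 * D * (j + 1)" "1 \<le> i" "Suc i < length (lst (K x))"
proof -
  obtain x j where e: "e = (K x, j)" "x \<in> V" "j < nblocks (K x)" using assms(1) by (auto simp: blocks_def)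
  obtain i where i: "v = lst (K x) ! i" "margin (K x) + 2 * D * j \<le> i" "i < margin (K x) + 2 * D * (j + 1)"
    using assms(2) e(1) by (auto simp: block_def)
  show thesis using that[OF e i] window_bounds[OF e(3)[unfolded nblocks_def] margin_def i(2,3)] by blast
qed

lemma step_pl: "Suc i < length (lst (K x)) \<Longrightarrow> mono_adj f (lst (K x) ! i) (lst (K x) ! Suc i)"
  using lst[of x] successively_nth by blast

lemma pl_inj: "i < length (lst (K x)) \<Longrightarrow> j < length (lst (K x)) \<Longrightarrow> lst (K x) ! i = lst (K x) ! j \<longleftrightarrow> i = j"
  using lst[of x] by (simp add: nth_eq_iff_index_eq)

lemma pl_mem: "i < length (lst (K x)) \<Longrightarrow> lst (K x) ! i \<in> K x"
  using lst[of x] nth_mem by blast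

lemma component_mono_V: assumes "x \<in> V" shows "K x \<subseteq> V"
proof -
  have "closed_under (mono_adj f) V" by (auto simp: closed_under_def mono_adj_def dest: EV)
  then show ?thesis using closed_under_rtranclp[of "mono_adj f" V x] assms by (auto simp: component_def)
qed

lemma interior_cnt:
  assumes "1 \<le> i" "Suc i < length (lst (K x))"
  shows "col_degree f (lst (K x) ! i) (f (lst (K x) ! i)) = 2"
proof -
  let ?v = "lst (K x) ! i"
  have "mono_adj f (lst (K x) ! (i - 1)) ?v" "mono_adj f ?v (lst (K x) ! Suc i)"
    using step_pl[of "i - 1" x] step_pl[of i x] assms by auto
  then have "{lst (K x) ! (i - 1), lst (K x) ! Suc i} \<subseteq> {w. E ?v w \<and> f w = f ?v}"
    by (auto simp: mono_adj_def dest: E_sym)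
  then have "card {lst (K x) ! (i - 1), lst (K x) ! Suc i} \<le> col_degree f ?v (f ?v)"
    unfolding col_degree_def by (intro card_mono) auto
  moreover have "lst (K x) ! (i - 1) \<noteq> lst (K x) ! Suc i" using assms by (simp add: pl_inj)
  ultimately show ?thesis using mono_degree_le_2[OF opt, of ?v] by simp
qed

lemma block_movable: "e \<in> blocks \<Longrightarrow> block e \<subseteq> movable"
proof
  fix v assume e: "e \<in> blocks" "v \<in> block e"
  obtain x i where "x \<in> V" "v = lst (K x) ! i" "1 \<le> i" "Suc i < length (lst (K x))"
    using blockE[OF e] by metis
  then show "v \<in> movable"
    using interior_cnt pl_mem[of i x] component_mono_V by (auto simp: movable_def)
qed

lemma block_disjoint:
  assumes "e \<in> blocks" "e' \<in> blocks" "v \<in> block e" "v \<in> block e'" shows "e = e'"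
proof -
  obtain x j i where e: "e = (K x, j)" "v = lst (K x) ! i" "margin (K x) + 2 * D * j \<le> i"
    "i < margin (K x) + 2 * D * (j + 1)" "Suc i < length (lst (K x))" using blockE[OF assms(1,3)] by metis
  obtain y l m where e': "e' = (K y, l)" "v = lst (K y) ! m" "margin (K y) + 2 * D * l \<le> m"
    "m < margin (K y) + 2 * D * (l + 1)" "Suc m < length (lst (K y))" using blockE[OF assms(2,4)] by metis
  have "K x = K y" using e e' pl_mem[of i x] pl_mem[of m y] component_eq[OF symp_mono_adj] by (metis Suc_lessD)
  then have im: "i = m" using e e' by (metis Suc_lessD pl_inj)
  have "\<not> p < r" if "margin (K x) + 2 * D * r \<le> i" "i < margin (K x) + 2 * D * (p + 1)" for p r
  proof
    assume "p < r"
    then have "2 * D * (p + 1) \<le> 2 * D * r" by (intro mult_le_mono) auto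
    then show False using that by linarith
  qed
  then have "j = l" using e e' im \<open>K x = K y\<close> by (metis linorder_neqE_nat)
  then show ?thesis using e e' \<open>K x = K y\<close> by simp
qed

lemma card_block: assumes "e \<in> blocks" shows "finite (block e)" "card (block e) = 2 * D"
proof -
  obtain x j where e: "e = (K x, j)" "j < nblocks (K x)" using assms by (auto simp: blocks_def)
  let ?I = "{margin (K x) + 2 * D * j ..< margin (K x) + 2 * D * (j + 1)}"
  have eq: "block e = (!) (lst (K x)) ` ?I" using e by (auto simp: block_def)
  have "i < length (lst (K x))" if "i \<in> ?I" for i
    using window_bounds(2)[OF e(2)[unfolded nblocks_def] margin_def, of i] that by auto
  then have "inj_on ((!) (lst (K x))) ?I" by (auto simp: inj_on_def pl_inj)
  then show "finite (block e)" "card (block e) = 2 * D" unfolding eq by (auto simp: card_image)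
qed

text \<open>These edges obstruct simultaneous moves. If \<open>f x = f y\<close>, one move takes a
  neighbour away from the other vertex, whose move then no longer balances; if
  \<open>b x = b y\<close>, both moves create a monochromatic edge. The case
  \<open>f y = b x\<close> does not arise, because targets are not movable.\<close>

definition clash :: "'a \<Rightarrow> 'a \<Rightarrow> bool" where
  "clash x y \<longleftrightarrow> E x y \<and> (f x = f y \<or> b x = b y) \<and>
     (\<exists>e\<in>blocks. \<exists>e'\<in>blocks. e \<noteq> e' \<and> x \<in> block e \<and> y \<in> block e')"

text \<open>
  Besides its two targets, a chosen vertex has a neighbour inside its own block, which does not count.
\<close>

lemma clash_degree: "card {y. clash x y} \<le> D"
proof (cases "\<exists>e\<in>blocks. x \<in> block e")
  case True
  then obtain e where e: "e \<in> blocks" "x \<in> block e" by blast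
  have xm: "x \<in> movable" using block_movable e by blast
  obtain y j i where i: "e = (K y, j)" "y \<in> V" "j < nblocks (K y)" "x = lst (K y) ! i"
    "margin (K y) + 2 * D * j \<le> i" "i < margin (K y) + 2 * D * (j + 1)" "1 \<le> i" "Suc i < length (lst (K y))"
    using blockE[OF e] .
  \<comment> \<open>A block consists of \<open>2 * D\<close>, hence at least two, consecutive
    vertices, so the predecessor or the successor of \<open>x\<close> lies in the same
    block.\<close>
  have "\<exists>z. z \<in> block e \<and> mono_adj f x z"
  proof (cases "i = margin (K y) + 2 * D * j")
    case True
    then have "Suc i < margin (K y) + 2 * D * (j + 1)" using deg4 by simp
    then have "lst (K y) ! Suc i \<in> block e" using i(1,5) by (auto simp: block_def)
    then show ?thesis using step_pl[OF i(8)] i(4) by blast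
  next
    case False
    then have "margin (K y) + 2 * D * j \<le> i - 1 \<and> i - 1 < margin (K y) + 2 * D * (j + 1)" using i by linarith
    then have "lst (K y) ! (i - 1) \<in> block e" using i(1) by (auto simp: block_def)
    moreover have "mono_adj f x (lst (K y) ! (i - 1))"
      using step_pl[of "i - 1" y] i(4,7,8) symp_mono_adj[of f] by (auto dest: sympD)
    ultimately show ?thesis by blast
  qed
  then obtain z where z: "z \<in> block e" "E x z" "f x = f z" by (auto simp: mono_adj_def)
  have "{y. clash x y} \<subseteq> {w. E x w} - insert z (targets x)"
  proof
    fix y assume "y \<in> {y. clash x y}"
    then obtain e1 e2 where y: "E x y" "f x = f y \<or> b x = b y" "e1 \<in> blocks" "e2 \<in> blocks" "e1 \<noteq> e2"
      "x \<in> block e1" "y \<in> block e2" by (auto simp: clash_def)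
    have "y \<noteq> z" using block_disjoint e z(1) y by metis
    moreover have "y \<notin> targets x" using targets_not_movable[OF xm] block_movable y by blast
    ultimately show "y \<in> {w. E x w} - insert z (targets x)" using y by simp
  qed
  then have "card {y. clash x y} \<le> card ({w. E x w} - insert z (targets x))" by (intro card_mono) auto
  also have "\<dots> = card {w. E x w} - card (insert z (targets x))"
    using z by (intro card_Diff_subset) (auto simp: targets_def)
  also have "card (insert z (targets x)) = 3"
  proof -
    have "z \<notin> targets x" using z(3) b_ne[OF xm] by (auto simp: targets_def)
    then show ?thesis using card_targets[OF xm] by (simp add: targets_def)
  qed
  finally show ?thesis using degree[of x] by linarith
next
  case False
  then have "{y. clash x y} = {}" by (auto simp: clash_def)
  then show ?thesis by simp
qed

lemma transversal:
  obtains \<tau> where "\<And>e. e \<in> blocks \<Longrightarrow> \<tau> e \<in> block e"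
    "\<And>x y. x \<in> \<tau> ` blocks \<Longrightarrow> y \<in> \<tau> ` blocks \<Longrightarrow> E x y \<Longrightarrow> f x \<noteq> f y \<and> b x \<noteq> b y"
proof -
  have "blocks \<subseteq> (\<Union>x\<in>V. {K x} \<times> {..<nblocks (K x)})" by (auto simp: blocks_def)
  then have "finite blocks" by (rule finite_subset) (use finV in auto)
  moreover have "finite {(x, y). clash x y}" by (simp add: clash_def)
  moreover have "symp clash"
    unfolding clash_def using E_sym by (intro sympI) metis
  moreover have "disjoint_family_on block blocks"
    using block_disjoint by (fastforce simp: disjoint_family_on_def)
  ultimately have "\<exists>\<tau>. indep_transversal clash blocks block \<tau>"
    by (rule haxell_indep_transversal[of blocks clash block D])
      (use card_block clash_degree deg4 in auto)
  then obtain \<tau> where \<tau>: "indep_transversal clash blocks block \<tau>" by blast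
  show thesis
  proof
    show mem: "\<tau> e \<in> block e" if "e \<in> blocks" for e using \<tau> that by (auto simp: indep_transversal_def)
    show "f x \<noteq> f y \<and> b x \<noteq> b y" if x: "x \<in> \<tau> ` blocks" and y: "y \<in> \<tau> ` blocks" and xy: "E x y" for x y
    proof -
      obtain e e' where e: "e \<in> blocks" "x = \<tau> e" "e' \<in> blocks" "y = \<tau> e'" using x y by blast
      moreover have "e \<noteq> e'" using xy e by auto
      ultimately have "\<not> clash x y" using \<tau> by (auto simp: indep_transversal_def)
      then show ?thesis using mem e xy \<open>e \<noteq> e'\<close> unfolding clash_def by blast
    qed
  qed
qed

end

section \<open>Moving an independent set simultaneously\<close>

locale independent_moves = recolouring V E \<Delta> k L f b lst
  for V :: "'a set" and E and \<Delta> k :: nat and L :: "'a \<Rightarrow> 'c set" and f b lst +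
  fixes T :: "'a set"
  assumes T_movable: "T \<subseteq> movable"
    and T_indep: "x \<in> T \<Longrightarrow> y \<in> T \<Longrightarrow> E x y \<Longrightarrow> f x \<noteq> f y \<and> b x \<noteq> b y"
begin

definition moved :: "'a set \<Rightarrow> 'a \<Rightarrow> 'c" where "moved S x = (if x \<in> S then b x else f x)"

lemma finite_T: "finite T"
  using T_movable finV by (auto simp: movable_def intro: finite_subset)

lemma targets_not_T: "v \<in> T \<Longrightarrow> w \<in> targets v \<Longrightarrow> w \<notin> T"
  using targets_not_movable T_movable by blast

text \<open>The vertices move one at a time. By independence, earlier moves have neither removed
  neighbours of colour \<open>f v\<close> nor created neighbours of colour \<open>b v\<close>, so
  the exchange at \<open>v\<close> is still free of cost.\<close>

lemma optimal_moved: assumes "S \<subseteq> T" shows "optimal L (moved S)"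
proof -
  have "finite S" using assms finite_T finite_subset by blast
  then show ?thesis using assms
  proof (induction S rule: finite_induct)
    case empty
    then show ?case using opt by (simp add: moved_def)
  next
    case (insert v S)
    have v: "v \<in> T" "v \<in> V" "col_degree f v (f v) = 2" using insert T_movable by (auto simp: movable_def)
    have nb: "f w \<noteq> f v \<and> b w \<noteq> b v" if "w \<in> S" "E v w" for w
      using T_indep[of v w] insert.prems that v(1) by auto
    have "col_degree f v (f v) \<le> col_degree (moved S) v (moved S v)"
      unfolding col_degree_def using insert.hyps(2) nb by (intro card_mono) (auto simp: moved_def)
    moreover have "col_degree (moved S) v (b v) \<le> col_degree f v (b v)"
      unfolding col_degree_def using nb by (intro card_mono) (auto simp: moved_def)
    ultimately have "optimal L ((moved S)(v := b v))"
      using insert v b_alt by (intro optimal_upd) auto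
    moreover have "(moved S)(v := b v) = moved (insert v S)" by (auto simp: moved_def)
    ultimately show ?case by simp
  qed
qed

text \<open>Move exactly the vertices that have \<open>x\<close> as a target. They join the old
  monochromatic neighbours of \<open>x\<close>, and the resulting colouring is still optimal, so
  together they number at most 2.\<close>

lemma card_attached: "card {v \<in> T. x \<in> targets v} + col_degree f x (f x) \<le> 2"
proof (cases "\<exists>v\<in>T. x \<in> targets v")
  case True
  let ?S = "{v \<in> T. x \<in> targets v}"
  have xT: "x \<notin> T" using True targets_not_T by blast
  have "?S \<union> {w. E x w \<and> f w = f x} \<subseteq> {w. E x w \<and> moved ?S w = moved ?S x}"
    using xT by (auto simp: moved_def targets_def dest: E_sym)
  then have "card (?S \<union> {w. E x w \<and> f w = f x}) \<le> col_degree (moved ?S) x (moved ?S x)"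
    unfolding col_degree_def by (intro card_mono) auto
  also have "\<dots> \<le> 2" by (intro mono_degree_le_2 optimal_moved) auto
  also have "card (?S \<union> {w. E x w \<and> f w = f x}) = card ?S + card {w. E x w \<and> f w = f x}"
  proof (rule card_Un_disjoint)
    have "f v \<noteq> b v" if "v \<in> T" for v using b_ne[of v] T_movable that by force
    then show "?S \<inter> {w. E x w \<and> f w = f x} = {}" by (fastforce simp: targets_def)
  qed (use finite_T in auto)
  finally show ?thesis by (simp add: col_degree_def)
next
  case False
  then have "{v \<in> T. x \<in> targets v} = {}" by auto
  then show ?thesis using mono_degree_le_2[OF opt, of x] by (metis add_0 card.empty)
qed

lemma attached_end:
  assumes "v \<in> T" "x \<in> targets v"
  shows "low (K x)" "x = hd (lst (K x)) \<or> x = last (lst (K x))"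
proof -
  have c: "col_degree f x (f x) \<le> 1" using targets_low assms T_movable by blast
  then show "low (K x)" by (auto simp: low_def intro!: bexI[of _ x])
  have "x \<in> set (lst (K x))" using lst[of x] by simp
  then obtain i where i: "i < length (lst (K x))" "x = lst (K x) ! i" by (metis in_set_conv_nth)
  have "\<not> (1 \<le> i \<and> Suc i < length (lst (K x)))" using interior_cnt[of i x] i c by auto
  then have "i = 0 \<or> i = length (lst (K x)) - 1" using i by linarith
  then show "x = hd (lst (K x)) \<or> x = last (lst (K x))"
    using i lst[of x] by (auto simp: hd_conv_nth last_conv_nth)
qed

lemma attached_unique:
  assumes "2 \<le> length (lst (K x))" "v \<in> T" "w \<in> T" "x \<in> targets v" "x \<in> targets w"
  shows "v = w"
proof (rule ccontr)
  assume "v \<noteq> w"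
  then have "card {v, w} = 2" by simp
  moreover have "card {v, w} \<le> card {v \<in> T. x \<in> targets v}"
    using assms finite_T by (intro card_mono) auto
  ultimately have c: "col_degree f x (f x) = 0" using card_attached[of x] by simp
  let ?p = "lst (K x)"
  have p: "?p \<noteq> []" using assms(1) by auto
  have "\<exists>z. mono_adj f x z"
  proof (cases "x = hd ?p")
    case True
    then show ?thesis using step_pl[of 0 x] assms(1) p by (auto simp: hd_conv_nth)
  next
    case False
    then have "x = ?p ! (length ?p - 1)" using attached_end(2)[OF assms(2,4)] p by (simp add: last_conv_nth)
    moreover have "mono_adj f (?p ! (length ?p - 2)) (?p ! Suc (length ?p - 2))"
      using assms(1) by (intro step_pl) auto
    moreover have "Suc (length ?p - 2) = length ?p - 1" using assms(1) by simp
    ultimately show ?thesis using symp_mono_adj[of f] by (metis sympD)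
  qed
  then have "{w. E x w \<and> f w = f x} \<noteq> {}" by (auto simp: mono_adj_def)
  then show False using c by (auto simp: col_degree_def)
qed

text \<open>A path receives at most two links: a path with one vertex by
  \<open>card_attached\<close>, a longer one because each of its ends has a monochromatic neighbour
  and room for one link only.\<close>

lemma orientation:
  obtains h t where "\<And>v. v \<in> T \<Longrightarrow> targets v = {h v, t v}" "\<And>v. v \<in> T \<Longrightarrow> h v \<noteq> t v"
    "\<And>v w. v \<in> T \<Longrightarrow> w \<in> T \<Longrightarrow> K (h v) = K (h w) \<Longrightarrow> v = w"
    "\<And>v w. v \<in> T \<Longrightarrow> w \<in> T \<Longrightarrow> K (t v) = K (t w) \<Longrightarrow> v = w"
proof (rule orient_linear_multigraph[OF finite_T, of targets K])
  show "card (targets v) = 2" if "v \<in> T" for v using card_targets T_movable that by blast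
  show "card {(v, x). v \<in> T \<and> x \<in> targets v \<and> K x = C} \<le> 2" for C
  proof (cases "\<exists>x. K x = C")
    case False
    then have "{(v, x). v \<in> T \<and> x \<in> targets v \<and> K x = C} = {}" by auto
    then show ?thesis by (metis card.empty zero_le)
  next
    case True
    then obtain y where y: "C = K y" by blast
    let ?a = "hd (lst C)" and ?z = "last (lst C)"
    let ?At = "\<lambda>x. {v \<in> T. x \<in> targets v}"
    have fin: "finite (?At x)" for x using finite_T by simp
    have sub: "{(v, x). v \<in> T \<and> x \<in> targets v \<and> K x = C} \<subseteq> (\<lambda>v. (v, ?a)) ` ?At ?a \<union> (\<lambda>v. (v, ?z)) ` ?At ?z"
      using attached_end(2) by fastforce
    have le: "card {(v, x). v \<in> T \<and> x \<in> targets v \<and> K x = C} \<le> card (?At ?a \<union> ?At ?z)"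
      if "?a = ?z"
    proof -
      have "card {(v, x). v \<in> T \<and> x \<in> targets v \<and> K x = C} \<le> card ((\<lambda>v. (v, ?a)) ` (?At ?a \<union> ?At ?z))"
        using sub that fin by (intro card_mono) (auto simp: image_Un)
      also have "\<dots> \<le> card (?At ?a \<union> ?At ?z)" using fin by (intro card_image_le) auto
      finally show ?thesis .
    qed
    show ?thesis
    proof (cases "2 \<le> length (lst C)")
      case False
      then have az: "?a = ?z" using lst[of y] y by (cases "lst C") (auto simp: neq_Nil_conv)
      then show ?thesis using le card_attached[of ?a] by simp
    next
      case True
      have "card (?At x) \<le> 1" if "K x = C" for x
        using attached_unique[of x] True that by (auto simp: card_le_Suc0_iff_eq[OF fin])
      moreover have "K ?a = C" "K ?z = C"
        using y lst[of y] component_eq[OF symp_mono_adj, of _ f y] by (metis hd_in_set, metis last_in_set)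
      ultimately have "card (?At ?a) \<le> 1" "card (?At ?z) \<le> 1" by blast+
      moreover have "card {(v, x). v \<in> T \<and> x \<in> targets v \<and> K x = C} \<le>
          card ((\<lambda>v. (v, ?a)) ` ?At ?a \<union> (\<lambda>v. (v, ?z)) ` ?At ?z)"
        using sub fin by (intro card_mono) auto
      moreover have "\<dots> \<le> card ((\<lambda>v. (v, ?a)) ` ?At ?a) + card ((\<lambda>v. (v, ?z)) ` ?At ?z)" by (rule card_Un_le)
      moreover have "card ((\<lambda>v. (v, ?a)) ` ?At ?a) \<le> card (?At ?a)" "card ((\<lambda>v. (v, ?z)) ` ?At ?z) \<le> card (?At ?z)"
        using fin by (auto intro: card_image_le)
      ultimately show ?thesis by linarith
    qed
  qed
qed (rule that)

end

section \<open>One recolouring pass\<close>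

lemma margin_arith:
  fixes n Q r d :: nat
  assumes "n - 2 = Q + r" "r < 2 * d"
  shows "n - (1 + r div 2) - Q \<le> d + 1" "1 + r div 2 \<le> d + 1"
    "n \<le> (1 + r div 2) + Q + (n - (1 + r div 2) - Q)"
  using assms by linarith+

context recolouring
begin

lemma recolouring_step:
  obtains f' where "optimal L f'"
    "\<And>a. (\<exists>S. closed_under (mono_adj f') S \<and> finite S \<and> card S \<le> 9 * D + 10 \<and> a \<in> S) \<or>
      \<not> low (K a) \<and> 9 * D + 10 < card (K a) \<and> (\<exists>y\<in>component (mono_adj f') a. col_degree f' y (f' y) \<le> 1)"
proof -
  obtain \<tau> where \<tau>: "\<And>e. e \<in> blocks \<Longrightarrow> \<tau> e \<in> block e"
    and \<tau>_indep: "\<And>x y. x \<in> \<tau> ` blocks \<Longrightarrow> y \<in> \<tau> ` blocks \<Longrightarrow> E x y \<Longrightarrow> f x \<noteq> f y \<and> b x \<noteq> b y"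
    using transversal by blast
  define T where "T = \<tau> ` blocks"
  have "T \<subseteq> movable" using \<tau> block_movable unfolding T_def by blast
  then interpret M: independent_moves V E \<Delta> k L f b lst T
    by unfold_locales (use \<tau>_indep in \<open>auto simp: T_def\<close>)
  obtain h t where ht: "\<And>v. v \<in> T \<Longrightarrow> targets v = {h v, t v}" "\<And>v. v \<in> T \<Longrightarrow> h v \<noteq> t v"
    and h_inj: "\<And>v w. v \<in> T \<Longrightarrow> w \<in> T \<Longrightarrow> K (h v) = K (h w) \<Longrightarrow> v = w"
    and t_inj: "\<And>v w. v \<in> T \<Longrightarrow> w \<in> T \<Longrightarrow> K (t v) = K (t w) \<Longrightarrow> v = w"
    using M.orientation by blast
  \<comment> \<open>The list of a component is reversed if some link disagrees with its direction.
    This satisfies all links at once: on a path with two or more vertices each end has at most one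
    link, and on a single vertex the direction is immaterial.\<close>
  define rv where "rv C \<longleftrightarrow> (\<exists>v\<in>T. K (h v) = C \<and> h v \<noteq> hd (lst C)) \<or> (\<exists>v\<in>T. K (t v) = C \<and> t v \<noteq> last (lst C))" for C
  define P where "P C = (if rv C then rev (lst C) else lst C)" for C
  \<comment> \<open>\<open>slack\<close> is the margin behind the last block. Reversing the list
    exchanges it with \<open>margin\<close> and reverses the block indices.\<close>
  define slack where "slack C = length (lst C) - margin C - 2 * D * nblocks C" for C
  define \<mu> where "\<mu> C = (if rv C then slack C else margin C)" for C
  define \<nu> where "\<nu> C = (if rv C then margin C else slack C)" for C
  define u where "u C j = \<tau> (C, if rv C then nblocks C - Suc j else j)" for C j
  have D_pos: "1 \<le> D" using deg4 by simp
  have ends: "v \<in> T \<Longrightarrow> h v = hd (P (K (h v)))" "v \<in> T \<Longrightarrow> t v = last (P (K (t v)))" for v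
  proof -
    have two: "h v \<noteq> t w" if "v \<in> T" "w \<in> T" "2 \<le> length (lst (K (h v)))" for v w
    proof
      assume e: "h v = t w"
      then have "v = w" using M.attached_unique[of "h v" v w] that ht by auto
      then show False using e ht(2) that by simp
    qed
    have one: "hd (lst C) = last (lst C)" if "C = K x" "\<not> 2 \<le> length (lst C)" for C x
      using that lst[of x] by (cases "lst C") (auto simp: neq_Nil_conv)
    have hx: "h v = hd (lst (K (h v))) \<or> h v = last (lst (K (h v)))" if "v \<in> T" for v
      using M.attached_end(2)[of v "h v"] ht(1) that by blast
    have tx: "t v = hd (lst (K (t v))) \<or> t v = last (lst (K (t v)))" if "v \<in> T" for v
      using M.attached_end(2)[of v "t v"] ht(1) that by blast
    have rvD: "K (h v) = C \<longrightarrow> h v = last (lst C)" "K (t v) = C \<longrightarrow> t v = hd (lst C)"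
      if v: "v \<in> T" "rv C" for v C
    proof -
      from v(2) consider w where "w \<in> T" "K (h w) = C" "h w \<noteq> hd (lst C)"
        | w where "w \<in> T" "K (t w) = C" "t w \<noteq> last (lst C)" by (auto simp: rv_def)
      then have "(K (h v) = C \<longrightarrow> h v = last (lst C)) \<and> (K (t v) = C \<longrightarrow> t v = hd (lst C))"
      proof cases
        case 1
        then have l: "2 \<le> length (lst C)" using hx[of w] one[of C "h w"] by metis
        have hw: "h w = last (lst C)" using 1 hx by metis
        have "h v = last (lst C)" if "K (h v) = C" using h_inj[OF v(1) 1(1)] 1(2) that hw by simp
        moreover have "t v = hd (lst C)" if "K (t v) = C" using two[OF 1(1) v(1)] tx[OF v(1)] that l hw 1(2) by metis
        ultimately show ?thesis by blast
      next
        case 2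
        then have l: "2 \<le> length (lst C)" using tx[of w] one[of C "t w"] by metis
        have tw: "t w = hd (lst C)" using 2 tx by metis
        have "t v = hd (lst C)" if "K (t v) = C" using t_inj[OF v(1) 2(1)] 2(2) that tw by simp
        moreover have "h v = last (lst C)" if "K (h v) = C" using two[OF v(1) 2(1)] hx[OF v(1)] that l tw by metis
        ultimately show ?thesis by blast
      qed
      then show "K (h v) = C \<longrightarrow> h v = last (lst C)" "K (t v) = C \<longrightarrow> t v = hd (lst C)" by blast+
    qed
    show "h v = hd (P (K (h v)))" if "v \<in> T"
      using rvD(1)[OF that, of "K (h v)"] that by (auto simp: P_def rv_def hd_rev)
    show "t v = last (P (K (t v)))" if "v \<in> T"
      using rvD(2)[OF that, of "K (t v)"] that by (auto simp: P_def rv_def last_rev)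
  qed
  have low_K: "low (K (h v)) \<and> low (K (t v)) \<and> h v \<notin> T \<and> t v \<notin> T" if "v \<in> T" for v
    using that M.attached_end(1)[of v] M.targets_not_T[of v] ht(1)[of v] by auto
  have mem_blocks: "(K x, j) \<in> blocks" if "j < nblocks (K x)" for x j
  proof -
    have "2 \<le> length (lst (K x))"
    proof (rule ccontr)
      assume "\<not> 2 \<le> length (lst (K x))"
      then have "nblocks (K x) = 0" by (simp add: nblocks_def)
      then show False using that by simp
    qed
    then have "mono_adj f (lst (K x) ! 0) (lst (K x) ! Suc 0)" by (intro step_pl) auto
    then have "lst (K x) ! 0 \<in> V" by (auto simp: mono_adj_def dest: EV)
    moreover have "K (lst (K x) ! 0) = K x" using component_eq[OF symp_mono_adj] pl_mem[of 0 x] lst[of x] by auto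
    ultimately show ?thesis using that by (auto simp: blocks_def)
  qed
  have \<tau>_K: "\<tau> (K x, j) \<in> T \<inter> K x" if j: "j < nblocks (K x)" for x j
  proof -
    have "\<tau> (K x, j) \<in> block (K x, j)" using \<tau> mem_blocks j by blast
    then obtain y j' i where "(K x, j) = (K y, j')" "\<tau> (K x, j) = lst (K y) ! i" "Suc i < length (lst (K y))"
      using blockE[OF mem_blocks[OF j]] by metis
    then have "\<tau> (K x, j) \<in> K x" using pl_mem[of i y] by simp
    then show ?thesis using mem_blocks[OF j] by (simp add: T_def)
  qed
  have \<tau>_only: "\<exists>j<nblocks (K x). v = \<tau> (K x, j)" if v: "v \<in> T" "v \<in> K x" for v x
  proof -
    obtain y j where y: "v = \<tau> (K y, j)" "j < nblocks (K y)" using v(1) by (auto simp: T_def blocks_def)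
    then have "K y = K x" using \<tau>_K[OF y(2)] v(2) component_eq[OF symp_mono_adj] by (metis IntD2)
    then show ?thesis using y by metis
  qed
  have slack: "slack C \<le> D + 1" "length (lst C) \<le> margin C + 2 * D * nblocks C + slack C" "margin C \<le> D + 1" for C
  proof -
    have "length (lst C) - 2 = 2 * D * nblocks C + (length (lst C) - 2) mod (2 * D)"
      by (simp add: nblocks_def)
    moreover have "(length (lst C) - 2) mod (2 * D) < 2 * D" using D_pos by simp
    ultimately show "slack C \<le> D + 1" "length (lst C) \<le> margin C + 2 * D * nblocks C + slack C"
        "margin C \<le> D + 1"
      unfolding slack_def margin_def by (rule margin_arith(1), rule margin_arith(3), rule margin_arith(2))
  qed
  interpret LK: linkage "mono_adj f" D T h t low P nblocks \<mu> \<nu> u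
  proof unfold_locales
    show "1 \<le> D" by (fact D_pos)
    show "symp (mono_adj f)" by (rule symp_mono_adj)
    show "finite (K x)" for x by (rule finite_component)
    show "finite T" by (rule M.finite_T)
    show "distinct (P (K x)) \<and> set (P (K x)) = K x \<and> successively (mono_adj f) (P (K x)) \<and> chordless (mono_adj f) (P (K x))"
      if "low (K x)" for x
    proof -
      have "(\<lambda>x y. mono_adj f y x) = mono_adj f" by (intro ext) (auto simp: mono_adj_def dest: E_sym)
      then have "successively (\<lambda>x y. mono_adj f y x) (lst (K x))" using lst[of x] by metis
      then show ?thesis using lst[of x] that chordless_rev by (auto simp: P_def low_def)
    qed
    show "h v \<notin> T \<and> low (K (h v)) \<and> h v = hd (P (K (h v)))" if "v \<in> T" for v
      using low_K[OF that] ends(1)[OF that] by blast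
    show "t v \<notin> T \<and> low (K (t v)) \<and> t v = last (P (K (t v)))" if "v \<in> T" for v
      using low_K[OF that] ends(2)[OF that] by blast
    show "v = w" if "v \<in> T" "w \<in> T" "K (h v) = K (h w)" for v w using h_inj that .
    show "v = w" if "v \<in> T" "w \<in> T" "K (t v) = K (t w)" for v w using t_inj that .
    show "\<exists>i<length (P (K x)). u (K x) j = P (K x) ! i \<and> \<mu> (K x) + 2 * D * j \<le> i \<and> i < \<mu> (K x) + 2 * D * (j + 1)"
      if j: "j < nblocks (K x)" for x j
    proof -
      define l where "l = (if rv (K x) then nblocks (K x) - Suc j else j)"
      have l: "l < nblocks (K x)" using j by (auto simp: l_def)
      obtain i where i: "\<tau> (K x, l) = lst (K x) ! i" "margin (K x) + 2 * D * l \<le> i"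
        "i < margin (K x) + 2 * D * (l + 1)" "Suc i < length (lst (K x))"
        using blockE[OF mem_blocks[OF l] \<tau>[OF mem_blocks[OF l]]] by (metis prod.inject)
      show ?thesis
      proof (cases "rv (K x)")
        case False
        then show ?thesis using i by (intro exI[of _ i]) (auto simp: u_def P_def \<mu>_def l_def)
      next
        case True
        let ?n = "length (lst (K x))"
        have m: "nblocks (K x) = Suc (l + j)" using True j by (simp add: l_def)
        have "slack (K x) + 2 * D * j \<le> ?n - Suc i" "?n - Suc i < slack (K x) + 2 * D * (j + 1)"
        proof -
          have dist: "d * Suc (l + j) = d * l + d * j + d" "d * (l + 1) = d * l + d" "d * (j + 1) = d * j + d"
            for d :: nat by (simp_all add: add_mult_distrib2)
          have q: "2 * D * nblocks (K x) = 2 * D * l + 2 * D * j + 2 * D"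
            unfolding m by (rule dist(1))
          have "length (lst (K x)) - 2 = 2 * D * nblocks (K x) + (length (lst (K x)) - 2) mod (2 * D)"
            by (simp add: nblocks_def)
          then have "margin (K x) + 2 * D * nblocks (K x) \<le> length (lst (K x))"
            using i(4) unfolding margin_def by linarith
          note this dist(2,3)[of "2 * D"]
          then show "slack (K x) + 2 * D * j \<le> ?n - Suc i" "?n - Suc i < slack (K x) + 2 * D * (j + 1)"
            using i(2-4) q unfolding slack_def by linarith+
        qed
        moreover have "rev (lst (K x)) ! (?n - Suc i) = lst (K x) ! i" using i(4) by (simp add: rev_nth)
        ultimately show ?thesis using True i(1,4) unfolding u_def P_def \<mu>_def l_def
          by (intro exI[of _ "?n - Suc i"]) auto
      qed
    qed
    show "T \<inter> K x = u (K x) ` {..<nblocks (K x)}" for x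
    proof
      show "u (K x) ` {..<nblocks (K x)} \<subseteq> T \<inter> K x"
        using \<tau>_K[of _ x] by (auto simp: u_def)
      show "T \<inter> K x \<subseteq> u (K x) ` {..<nblocks (K x)}"
      proof
        fix v assume "v \<in> T \<inter> K x"
        then obtain j where j: "j < nblocks (K x)" "v = \<tau> (K x, j)" using \<tau>_only by blast
        let ?j = "if rv (K x) then nblocks (K x) - Suc j else j"
        have "?j < nblocks (K x)" "u (K x) ?j = v" using j by (auto simp: u_def Suc_diff_Suc)
        then show "v \<in> u (K x) ` {..<nblocks (K x)}" by blast
      qed
    qed
    show "\<mu> (K x) \<le> D + 1 \<and> \<nu> (K x) \<le> D + 1 \<and> length (P (K x)) \<le> \<mu> (K x) + 2 * D * nblocks (K x) + \<nu> (K x)" for x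
      using slack[of "K x"] by (auto simp: \<mu>_def \<nu>_def P_def)
    show "\<exists>y z. y \<noteq> z \<and> y \<in> T \<inter> K x \<and> z \<in> T \<inter> K x" if "9 * D + 10 < card (K x)" for x
    proof -
      have "card (K x) = length (lst (K x))" using lst[of x] distinct_card by metis
      then have "2 * (2 * D) \<le> length (lst (K x)) - 2" using that by linarith
      then have "2 \<le> nblocks (K x)" unfolding nblocks_def using D_pos
        by (metis div_le_mono nonzero_mult_div_cancel_right mult_is_0 not_one_le_zero zero_neq_numeral)
      then have "0 < nblocks (K x)" "1 < nblocks (K x)" by linarith+
      moreover have "\<tau> (K x, 0) \<noteq> \<tau> (K x, 1)"
        using block_disjoint[OF mem_blocks mem_blocks] \<tau>[OF mem_blocks] calculation
        by (metis prod.inject zero_neq_one)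
      ultimately show ?thesis using \<tau>_K by blast
    qed
  qed
  obtain T' X top where "linkage_cut (mono_adj f) D T h t low P nblocks \<mu> \<nu> u T' X top"
    using LK.exists_linkage_cut by blast
  then interpret CUT: linkage_cut "mono_adj f" D T h t low P nblocks \<mu> \<nu> u T' X top .
  let ?f = "M.moved T'"
  have opt': "optimal L ?f" using M.optimal_moved CUT.T'_sub by blast
  \<comment> \<open>Adjacent moved vertices get different new colours by independence, and an
    unmoved neighbour carrying the new colour of a moved vertex is one of its two targets.\<close>
  have relink: "LK.relink T' x y" if xy: "mono_adj ?f x y" for x y
  proof -
    have E: "E x y" "?f x = ?f y" using xy by (auto simp: mono_adj_def)
    have tg: "w \<in> {h v, t v}" if "v \<in> T'" "E v w" "f w = b v" for v w
      using ht(1)[of v] CUT.T'_sub that by (auto simp: targets_def)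
    show ?thesis
    proof (cases "x \<in> T'"; cases "y \<in> T'")
      assume "x \<in> T'" "y \<in> T'"
      then show ?thesis using M.T_indep[of x y] CUT.T'_sub E by (auto simp: M.moved_def)
    next
      assume "x \<in> T'" "y \<notin> T'"
      then show ?thesis using tg[of x y] E by (auto simp: M.moved_def LK.relink_def)
    next
      assume "x \<notin> T'" "y \<in> T'"
      then show ?thesis using tg[of y x] E E_sym[of x y] by (auto simp: M.moved_def LK.relink_def)
    next
      assume "x \<notin> T'" "y \<notin> T'"
      then show ?thesis using E by (auto simp: M.moved_def LK.relink_def mono_adj_def)
    qed
  qed
  have closed: "closed_under (mono_adj ?f) S" if "closed_under (LK.relink T') S" for S
    using that relink by (auto simp: closed_under_def)
  \<comment> \<open>If every vertex of the new component still had degree 2, none would have lost a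
    neighbour. The component would then be closed under the old adjacency and be the whole cycle,
    but it misses a moved vertex.\<close>
  have cut_cycle: "\<exists>y\<in>component (mono_adj ?f) a. col_degree ?f y (?f y) \<le> 1"
    if a: "K a \<inter> T' \<noteq> {}" "a \<notin> T'" "closed_under (LK.relink T') (K a - T')" for a
  proof (rule ccontr)
    assume "\<not> ?thesis"
    then have deg: "2 \<le> col_degree ?f y (?f y)" if "y \<in> component (mono_adj ?f) a" for y using that by fastforce
    let ?Y = "component (mono_adj ?f) a"
    have sub: "?Y \<subseteq> K a - T'"
      using closed_under_rtranclp[OF closed[OF a(3)]] a(2) by (auto simp: component_def)
    have "closed_under (mono_adj f) ?Y"
      unfolding closed_under_def
    proof (intro ballI allI impI)
      fix y z assume y: "y \<in> ?Y" "mono_adj f y z"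
      have "{w. mono_adj ?f y w} \<subseteq> {w. mono_adj f y w}"
      proof
        fix w assume w: "w \<in> {w. mono_adj ?f y w}"
        then have "w \<in> ?Y" using y(1) component_step[of "mono_adj ?f" y w a] by simp
        then have "y \<notin> T'" "w \<notin> T'" using y(1) sub by auto
        then show "w \<in> {w. mono_adj f y w}" using w by (simp add: mono_adj_def M.moved_def)
      qed
      moreover have "card {w. mono_adj f y w} \<le> card {w. mono_adj ?f y w}"
        using deg[OF y(1)] mono_degree_le_2[OF opt, of y] by (simp add: card_mono_nbrs)
      moreover have "finite {w. mono_adj f y w}" by (simp add: mono_nbrs)
      ultimately have "{w. mono_adj ?f y w} = {w. mono_adj f y w}" by (intro card_seteq)
      then have "mono_adj ?f y z" using y(2) by auto
      then show "z \<in> ?Y" using y(1) component_step[of "mono_adj ?f" y z a] by simp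
    qed
    then have "K a \<subseteq> ?Y" using closed_under_rtranclp[of "mono_adj f" ?Y a] by (auto simp: component_def)
    then show False using sub a(1) by blast
  qed
  show thesis
    by (rule that[OF opt']) (use CUT.relink_components closed cut_cycle in metis)
qed

end

section \<open>Two passes\<close>

context list_graph
begin

lemma exists_recolouring:
  assumes "optimal L f" "4 \<le> \<Delta>"
  obtains b lst where "recolouring V E \<Delta> k L f b lst"
proof -
  have "\<exists>c. v \<in> V \<longrightarrow> col_degree f v (f v) = 2 \<longrightarrow> c \<in> L v \<and> c \<noteq> f v \<and> col_degree f v c = 2" for v
    using alternative_colour[OF assms(1), of v] by metis
  then obtain b where b: "\<And>v. v \<in> V \<Longrightarrow> col_degree f v (f v) = 2 \<Longrightarrow> b v \<in> L v \<and> b v \<noteq> f v \<and> col_degree f v (b v) = 2"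
    by metis
  let ?good = "\<lambda>C p. distinct p \<and> p \<noteq> [] \<and> set p = C \<and> successively (mono_adj f) p \<and>
      ((\<exists>y\<in>C. col_degree f y (f y) \<le> 1) \<longrightarrow> chordless (mono_adj f) p)"
  have ex: "\<exists>p. ?good (component (mono_adj f) x) p" for x
  proof -
    obtain p where "distinct p" "p \<noteq> []" "set p = component (mono_adj f) x" "successively (mono_adj f) p"
      "\<exists>y\<in>component (mono_adj f) x. card {z. mono_adj f y z} \<le> 1 \<Longrightarrow> chordless (mono_adj f) p"
    proof (rule component_list[OF symp_mono_adj irreflp_mono_adj, of f x])
      show "finite {z. mono_adj f y z}" for y by (simp add: mono_nbrs)
      show "card {z. mono_adj f y z} \<le> 2" for y using mono_degree_le_2[OF assms(1)] by (simp add: card_mono_nbrs)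
    qed (rule finite_component, rule that)
    then show ?thesis unfolding card_mono_nbrs by blast
  qed
  \<comment> \<open>The list is chosen for the component as a set, so all vertices of a component
    share it.\<close>
  define lst where "lst C = (SOME p. ?good C p)" for C
  have "?good (component (mono_adj f) x) (lst (component (mono_adj f) x))" for x
    unfolding lst_def by (rule someI_ex[OF ex])
  then have "recolouring V E \<Delta> k L f b lst"
    using assms b by unfold_locales blast+
  then show thesis by (rule that)
qed

lemma small_mono_components:
  assumes "4 \<le> \<Delta>" "\<And>v. v \<in> V \<Longrightarrow> L v \<noteq> {}"
  obtains f where "optimal L f"
    "\<And>a. \<exists>S. closed_under (mono_adj f) S \<and> finite S \<and> card S \<le> 9 * (\<Delta> - 3) + 10 \<and> a \<in> S"
proof -
  let ?B = "9 * (\<Delta> - 3) + 10"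
  let ?small = "\<lambda>f a. \<exists>S. closed_under (mono_adj f) S \<and> finite S \<and> card S \<le> ?B \<and> a \<in> S"
  obtain f0 where f0: "optimal L f0" using exists_optimal assms(2) by blast
  have step: "\<exists>f'. optimal L f' \<and> (\<forall>a. ?small f' a \<or>
      \<not> (\<exists>y\<in>component (mono_adj f) a. col_degree f y (f y) \<le> 1) \<and> ?B < card (component (mono_adj f) a) \<and>
      (\<exists>y\<in>component (mono_adj f') a. col_degree f' y (f' y) \<le> 1))" if opt: "optimal L f" for f
  proof -
    obtain b lst where "recolouring V E \<Delta> k L f b lst" using exists_recolouring[OF opt assms(1)] .
    then interpret recolouring V E \<Delta> k L f b lst .
    show ?thesis using recolouring_step unfolding low_def by metis
  qed
  obtain f1 where f1: "optimal L f1" "\<And>a. ?small f1 a \<or> (\<exists>y\<in>component (mono_adj f1) a. col_degree f1 y (f1 y) \<le> 1)"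
    using step[OF f0] by blast
  have no_big_cycle: "(\<exists>y\<in>component (mono_adj f1) a. col_degree f1 y (f1 y) \<le> 1) \<or> card (component (mono_adj f1) a) \<le> ?B" for a
  proof (cases "?small f1 a")
    case True
    then obtain S where S: "closed_under (mono_adj f1) S" "finite S" "card S \<le> ?B" "a \<in> S" by blast
    then have "component (mono_adj f1) a \<subseteq> S" using closed_under_rtranclp[OF S(1)] by (auto simp: component_def)
    then show ?thesis using S card_mono le_trans by metis
  next
    case False
    then show ?thesis using f1(2) by blast
  qed
  obtain f2 where "optimal L f2" "\<And>a. ?small f2 a"
    using step[OF f1(1)] no_big_cycle by (metis not_le)
  then show thesis by (rule that)
qed

end

section \<open>Clustered list colouring\<close>

text \<open>This transfers bounds by closed sets to the strongly connected components of the
  digraph: every vertex of \<open>C\<close> is reachable from \<open>a\<close> inside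
  \<open>C\<close>.\<close>

lemma sccs_subset_closed:
  assumes "C \<in> pre_digraph.sccs G" "a \<in> verts C" "a \<in> S" "closed_under (\<lambda>x y. x \<rightarrow>\<^bsub>G\<^esub> y) S"
  shows "verts C \<subseteq> S"
proof
  fix z assume z: "z \<in> verts C"
  have C: "induced_subgraph C G" "strongly_connected C"
    using assms(1) by (auto simp: pre_digraph.sccs_def)
  have sub: "arcs_ends C \<subseteq> arcs_ends G"
    using C(1) by (auto simp: induced_subgraph_def subgraph_def compatible_def arcs_ends_def arc_to_ends_def)
  have "(a, z) \<in> rtrancl_on (verts C) (arcs_ends C)"
    using C(2) assms(2) z by (auto simp: strongly_connected_def reachable_def)
  then show "z \<in> S"
  proof (induction rule: rtrancl_on_induct)
    case base
    show ?case by (fact assms(3))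
  next
    case (step y z)
    then have "y \<rightarrow>\<^bsub>G\<^esub> z" using sub by blast
    then show ?case using assms(4) step.IH by (auto simp: closed_under_def)
  qed
qed

theorem theorem9:
  fixes G :: "('a, 'b) pre_digraph" and \<Delta> :: nat
  assumes "graph G"
    and "max_degree G = \<Delta>"
    and "\<Delta> \<ge> 3"
  shows "choosable_with_clustering TYPE('c) G
           (nat \<lceil>1 / 3 * (real \<Delta> + 2)\<rceil>) (nat (\<lceil>19 / 2 * real \<Delta>\<rceil> - 17))"
  unfolding choosable_with_clustering_def
proof (intro allI impI)
  let ?k = "nat \<lceil>1 / 3 * (real \<Delta> + 2)\<rceil>" and ?B = "nat (\<lceil>19 / 2 * real \<Delta>\<rceil> - 17)"
  fix L :: "'a \<Rightarrow> 'c set"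
  assume L: "list_assignment G ?k L"
  interpret graph G by (fact assms(1))
  have k: "\<Delta> + 2 \<le> 3 * ?k"
  proof -
    have "real \<Delta> + 2 \<le> 3 * r" if "1 / 3 * (real \<Delta> + 2) \<le> r" for r using that by simp
    from this[OF of_nat_ceiling] have "real (\<Delta> + 2) \<le> real (3 * ?k)"
      by (simp only: of_nat_add of_nat_mult of_nat_numeral)
    then show ?thesis by (simp only: of_nat_le_iff)
  qed
  let ?E = "\<lambda>x y. x \<rightarrow>\<^bsub>G\<^esub> y"
  have deg: "card {w. ?E v w} \<le> \<Delta>" for v
  proof (cases "v \<in> verts G")
    case True
    have "{w. ?E v w} = head G ` out_arcs G v" by (auto simp: arcs_ends_def arc_to_ends_def)
    then have "card {w. ?E v w} \<le> out_degree G v"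
      unfolding out_degree_def by (simp add: card_image_le out_arcs_def)
    also have "\<dots> \<le> max_degree G" unfolding max_degree_def using True by (intro Max_ge) auto
    finally show ?thesis using assms(2) by simp
  next
    case False
    then have "{w. ?E v w} = {}" by (auto dest: adj_in_verts)
    then show ?thesis by (metis card.empty zero_le)
  qed
  interpret list_graph "verts G" ?E \<Delta> ?k L
  proof
    show "symp ?E" by (auto intro!: sympI graph_symmetric)
    show "irreflp ?E" using no_loops by (auto intro!: irreflpI simp: arcs_ends_def arc_to_ends_def)
    show "infinite (L v) \<or> ?k \<le> card (L v)" if "v \<in> verts G" for v
      using L that by (auto simp: list_assignment_def)
  qed (use deg k in \<open>auto dest: adj_in_verts\<close>)
  have ne: "L v \<noteq> {}" if "v \<in> verts G" for v
  proof
    assume "L v = {}"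
    then have "?k \<le> 0" using lists[OF that] by (metis card.empty finite.emptyI)
    then show False using k assms(3) by linarith
  qed
  obtain f where f: "optimal L f"
    "\<And>a. \<exists>S. closed_under (mono_adj f) S \<and> finite S \<and> card S \<le> ?B \<and> a \<in> S"
  proof (cases "4 \<le> \<Delta>")
    case True
    obtain f where f: "optimal L f"
      "\<And>a. \<exists>S. closed_under (mono_adj f) S \<and> finite S \<and> card S \<le> 9 * (\<Delta> - 3) + 10 \<and> a \<in> S"
      using small_mono_components[OF True ne] by blast
    \<comment> \<open>With \<open>D = \<Delta> - 3\<close> the bound \<open>9 * D + 10\<close>
      equals \<open>9 * \<Delta> - 17\<close>, below the required value by about half of
      \<open>\<Delta>\<close>.\<close>
    have "real_of_int (int (9 * (\<Delta> - 3) + 10) + 17) = 9 * real \<Delta>" using True by (simp add: of_nat_diff)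
    also have "\<dots> \<le> 19 / 2 * real \<Delta>" by simp
    also have "\<dots> \<le> real_of_int \<lceil>19 / 2 * real \<Delta>\<rceil>" by (rule le_of_int_ceiling)
    finally have "9 * (\<Delta> - 3) + 10 \<le> ?B" by linarith
    then show thesis using f that le_trans by meson
  next
    case False
    then have \<Delta>: "\<Delta> = 3" using assms(3) by simp
    obtain f where f: "optimal L f" using exists_optimal ne by blast
    \<comment> \<open>A vertex of monochromatic degree 2 would have two neighbours in each of two
      colours, hence four neighbours.\<close>
    have low: "col_degree f v (f v) \<le> 1" for v
    proof (rule ccontr)
      assume "\<not> col_degree f v (f v) \<le> 1"
      then have two: "col_degree f v (f v) = 2" using mono_degree_le_2[OF f, of v] by simp
      then have "{w. ?E v w \<and> f w = f v} \<noteq> {}" unfolding col_degree_def by (metis card.empty zero_neq_numeral)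
      then have "v \<in> verts G" by (auto dest: adj_in_verts)
      then obtain c where "c \<noteq> f v" "col_degree f v c = 2" using alternative_colour[OF f _ two] by blast
      then show False using sum_cnt_le[of "{f v, c}" f v] two \<Delta> by simp
    qed
    have "\<exists>S. closed_under (mono_adj f) S \<and> finite S \<and> card S \<le> ?B \<and> a \<in> S" for a
    proof -
      let ?S = "insert a {y. mono_adj f a y}"
      have fin: "finite {y. mono_adj f x y}" for x by (simp add: mono_nbrs)
      have one: "y = z" if "mono_adj f x y" "mono_adj f x z" for x y z
        using low[of x] that card_le_Suc0_iff_eq[OF fin[of x]] by (auto simp: card_mono_nbrs)
      have "closed_under (mono_adj f) ?S"
        unfolding closed_under_def using one symp_mono_adj[of f] by (auto dest: sympD)
      moreover have "card ?S \<le> 2" using low[of a] fin[of a] by (simp add: card_insert_if card_mono_nbrs)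
      moreover have "(2 :: nat) \<le> ?B" using \<Delta> by (simp add: ceiling_def floor_eq_iff)
      ultimately show ?thesis using fin by (intro exI[of _ ?S]) auto
    qed
    then show thesis using f that by blast
  qed
  have "has_clustering G f ?B"
    unfolding has_clustering_def
  proof
    fix C assume C: "C \<in> pre_digraph.sccs (mono_subgraph G f)"
    then obtain a where a: "a \<in> verts C" by (auto simp: pre_digraph.sccs_def strongly_connected_def)
    obtain S where S: "closed_under (mono_adj f) S" "finite S" "card S \<le> ?B" "a \<in> S" using f(2) by blast
    have "(\<lambda>x y. x \<rightarrow>\<^bsub>mono_subgraph G f\<^esub> y) = mono_adj f"
      unfolding fun_eq_iff mono_adj_def
      unfolding mono_subgraph_def arcs_ends_def arc_to_ends_def by (auto simp: image_iff)
    then have "verts C \<subseteq> S" using sccs_subset_closed[OF C a S(4)] S(1) by simp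
    then show "card (verts C) \<le> ?B" using S card_mono le_trans by meson
  qed
  then show "\<exists>f. list_colouring G L f \<and> has_clustering G f ?B"
    using f(1) by (auto simp: optimal_def list_col_def list_colouring_def)
qed

end
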